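(* Let $G$ be a countably infinite abelian group and $(F_n)_{n=1}^\infty$ a F\o lner sequence in $G$. Let $(X,\mathscr{B},\nu)$ be a standard probability space and let $(T_g)_{g\in G}$, $(S_g)_{g\in G}$ be measure preserving actions of $G$ on $X$ such that $(T_g)_{g\in G}$ has singular spectrum. Let $a:G\rightarrow G$ be a map such that for every nontrivial $\chi\in\widehat{G}$ and every $h\in G\setminus\{e_G\}$ we have $$\lim_{N\rightarrow\infty}\frac{1}{|F_N|}\sum_{g\in F_N}\chi(a(g+h)-a(g))=0,\qquad(\ast)$$ which is equivalent to requiring that $(\chi(a(g+h)-a(g)))_{g\in G}$ be uniformly distributed (with respect to $(F_n)_{n=1}^\infty$) in $\overline{\{\chi(g)\mid g\in G\}}$ for all $\chi\in\widehat{G}$ and $h\in G\setminus\{e_G\}$. Then: (i) For any $f_1,f_2\in L^\infty(X,\nu)$ we have $$\lim_{N\rightarrow\infty}\frac{1}{|F_N|}\sum_{g\in F_N}T_gf_1\,S_{a(g)}f_2=\mathbb{E}[f_1|\mathcal{I}_T]\,\mathbb{E}[f_2|\mathcal{I}_S]$$ with convergence taking place in $L^2(X,\nu)$. (ii) If $A\in\mathscr{B}$, then $$\lim_{N\rightarrow\infty}\frac{1}{|F_N|}\sum_{g\in F_N}\nu\left(A\cap T_gA\cap S_{a(g)}A\right)\ge\nu(A)^3.$$ (iii) Now assume that $G$ is finitely generated and that $(\ast)$ is only assumed to hold for all $h\in G\setminus\{e_G\}$ and all $\chi\in\widehat{G}$ that do not vanish on any subgroup $H\le G$ of finite index. Then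 the conclusions of (i) and (ii) still hold when the action $(S_g)_{g\in G}$ is totally ergodic.
   Context: Groups are discrete; $e_G$ is the identity, $\widehat G$ the Pontryagin dual of $G$. A character $\chi$ vanishes on a subgroup $H$ if $\chi(g)=1$ for all $g\in H$. Uniform distribution in the compact group $\overline{\{\chi(g)\mid g\in G\}}$ is with respect to its normalized Haar measure, averages being taken along $(F_n)$. A F\o lner sequence in a countable abelian group $G$ is a sequence of finite sets $F_n\subseteq G$ with $\lim_n|F_n\triangle(F_n+g)|/|F_n|=0$ for all $g\in G$. A measure preserving action of $G$ on a standard probability space $(X,\mathscr{B},\nu)$ is a family of invertible bi-measurable measure preserving maps $T_g$ with $T_{e_G}=\mathrm{Id}$ and $T_gT_h=T_{gh}$ (group operation of $G$). The induced unitary representation on $L^2(X,\nu)$ is also denoted by $T_g$: $T_gf=f\circ T_g^{-1}$. The action of a group is ergodic if every $A\in\mathscr{B}$ with $\nu(A\triangle T_gA)=0$ for all group elements $g$ has $\nu(A)\in\{0,1\}$; the action of $G$ is totally ergodic if for every finite index subgroup $H\le G$ the action $(T_g)_{g\in H}$ is ergodic. $\mathcal{I}_T$ is the $\sigma$-algebra of $T$-invariant sets and $\mathbb{E}[\cdot|\mathcal{I}_T]:L^2(X,\mathscr{B},\nu)\to L^2(X,\mathcal{I}_T,\nu)$ is the orthogonal projection. The actions $T$ and $S$ are not assumed to commute with each other. Singular spectrum (abelian $G$): for $f\in L^2(X,\nu)$ let $\nu_{T,f}$ be the finite positive measure on $\widehat G$ with $\langle T_gf,f\rangle=\int_{\widehat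 G}\chi(g)\,d\nu_{T,f}(\chi)$ for all $g\in G$. The maximal spectral type $[\mu_T]$ is the (minimal) measure class on $\widehat G$ such that $\nu_{T,f}\ll\mu_T$ for all $f\in L^2(X,\nu)$ with $\int_Xf\,d\nu=0$. $T$ has singular spectrum if $\mu_T$ is mutually singular with Haar measure on $\widehat G$. *)

theory Defs
  imports "HOL-Probability.Probability" "HOL-Computational_Algebra.Group_Closure"
begin

section \<open>Abelian groups: subgroups, F\o lner sequences, characters\<close>

text \<open>A countable abelian group is an additively written type of classes
  \<^class>\<open>ab_group_add\<close> and \<^class>\<open>countable\<close>; its identity is \<open>0\<close>.\<close>

definition add_subgroup :: "'g::ab_group_add set \<Rightarrow> bool" where
  "add_subgroup H \<longleftrightarrow> 0 \<in> H \<and> (\<forall>g\<in>H. \<forall>h\<in>H. g + h \<in> H) \<and> (\<forall>g\<in>H. - g \<in> H)"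

definition finite_index :: "'g::ab_group_add set \<Rightarrow> bool" where
  "finite_index H \<longleftrightarrow> finite (range (\<lambda>g. (\<lambda>h. g + h) ` H))"

definition finitely_generated :: "'g::ab_group_add itself \<Rightarrow> bool" where
  "finitely_generated _ \<longleftrightarrow> (\<exists>B::'g set. finite B \<and> group_closure B = UNIV)"

text \<open>Nonemptiness is what makes the quotients meaningful, as \<open>x / 0 = 0\<close>.\<close>

definition Folner :: "(nat \<Rightarrow> 'g::ab_group_add set) \<Rightarrow> bool" where
  "Folner F \<longleftrightarrow> (\<forall>n. finite (F n) \<and> F n \<noteq> {}) \<and>
     (\<forall>g. (\<lambda>n. real (card (sym_diff (F n) ((\<lambda>x. x + g) ` F n))) / real (card (F n)))
            \<longlonglongrightarrow> 0)"

definition avg :: "(nat \<Rightarrow> 'g set) \<Rightarrow> nat \<Rightarrow> ('g \<Rightarrow> 'b::real_vector) \<Rightarrow> 'b" where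
  "avg F N u = (\<Sum>g\<in>F N. u g) /\<^sub>R real (card (F N))"

text \<open>The Pontryagin dual of a discrete group. The product topology on \<open>'g \<Rightarrow> complex\<close>
  induces on it the topology of pointwise convergence, which for discrete groups is the
  compact-open topology.\<close>

definition pontryagin_dual :: "('g::ab_group_add \<Rightarrow> complex) set" where
  "pontryagin_dual =
     {\<gamma>. (\<forall>g h. \<gamma> (g + h) = \<gamma> g * \<gamma> h) \<and> (\<forall>g. cmod (\<gamma> g) = 1)}"

definition vanishes_on :: "('g \<Rightarrow> complex) \<Rightarrow> 'g set \<Rightarrow> bool" where
  "vanishes_on \<gamma> H \<longleftrightarrow> (\<forall>g\<in>H. \<gamma> g = 1)"

abbreviation dual_borel :: "('g::ab_group_add \<Rightarrow> complex) measure" where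
  "dual_borel \<equiv> restrict_space borel pontryagin_dual"

text \<open>\<open>m\<close> is the normalized Haar measure of the compact group \<open>K\<close> with group operation
  \<open>f\<close>. The groups in question are metrizable, so regularity is automatic and \<open>m\<close> is
  determined by this property.\<close>

definition normalized_haar ::
    "('a::topological_space \<Rightarrow> 'a \<Rightarrow> 'a) \<Rightarrow> 'a set \<Rightarrow> 'a measure \<Rightarrow> bool" where
  "normalized_haar f K m \<longleftrightarrow> sets m = sets (restrict_space borel K) \<and> prob_space m \<and>
     (\<forall>k\<in>K. distr m m (f k) = m)"

definition unif_distributed ::
    "(nat \<Rightarrow> 'g set) \<Rightarrow> ('g \<Rightarrow> complex) \<Rightarrow> complex set \<Rightarrow> bool" where
  "unif_distributed F u K \<longleftrightarrow> (\<forall>g. u g \<in> K) \<and>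
     (\<exists>m. normalized_haar (*) K m \<and>
       (\<forall>\<phi>::complex \<Rightarrow> complex. continuous_on K \<phi> \<longrightarrow>
          (\<lambda>N. avg F N (\<lambda>g. \<phi> (u g))) \<longlonglongrightarrow> (\<integral>z. \<phi> z \<partial>m)))"


section \<open>Measure preserving actions\<close>

definition standard_prob_space :: "'x measure \<Rightarrow> bool" where
  "standard_prob_space M \<longleftrightarrow> prob_space M \<and>
     (\<exists>X. completely_metrizable_space X \<and> second_countable X \<and> topspace X = space M \<and>
          sets M = sigma_sets (topspace X) {U. openin X U})"

definition mp_action :: "'x measure \<Rightarrow> ('g::ab_group_add \<Rightarrow> 'x \<Rightarrow> 'x) \<Rightarrow> bool" where
  "mp_action M T \<longleftrightarrow>
     (\<forall>g. bij_betw (T g) (space M) (space M) \<and> T g \<in> measurable M M \<and>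
          inv_into (space M) (T g) \<in> measurable M M \<and> distr M M (T g) = M) \<and>
     (\<forall>x\<in>space M. T 0 x = x) \<and>
     (\<forall>g h. \<forall>x\<in>space M. T (g + h) x = T g (T h x))"

definition koopman :: "'x measure \<Rightarrow> ('g \<Rightarrow> 'x \<Rightarrow> 'x) \<Rightarrow> 'g \<Rightarrow> ('x \<Rightarrow> complex) \<Rightarrow> 'x \<Rightarrow> complex"
  where "koopman M T g f = (\<lambda>x. f (inv_into (space M) (T g) x))"

text \<open>Sets invariant, up to null sets, under the elements of \<open>H\<close>.\<close>

definition invariant_sets :: "'x measure \<Rightarrow> ('g \<Rightarrow> 'x \<Rightarrow> 'x) \<Rightarrow> 'g set \<Rightarrow> 'x set set" where
  "invariant_sets M T H =
     {A \<in> sets M. \<forall>g\<in>H. measure M (sym_diff A (T g ` A)) = 0}"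

definition ergodic_on :: "'x measure \<Rightarrow> ('g \<Rightarrow> 'x \<Rightarrow> 'x) \<Rightarrow> 'g set \<Rightarrow> bool" where
  "ergodic_on M T H \<longleftrightarrow> (\<forall>A\<in>invariant_sets M T H. measure M A = 0 \<or> measure M A = 1)"

definition totally_ergodic :: "'x measure \<Rightarrow> ('g::ab_group_add \<Rightarrow> 'x \<Rightarrow> 'x) \<Rightarrow> bool" where
  "totally_ergodic M T \<longleftrightarrow>
     (\<forall>H. add_subgroup H \<and> finite_index H \<longrightarrow> ergodic_on M T H)"

text \<open>The sub-\<open>\<sigma>\<close>-algebra of invariant sets.\<close>

definition inv_algebra :: "'x measure \<Rightarrow> ('g \<Rightarrow> 'x \<Rightarrow> 'x) \<Rightarrow> 'x measure" where
  "inv_algebra M T = sigma (space M) (invariant_sets M T UNIV)"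


section \<open>Square integrable functions and conditional expectation\<close>

definition L2 :: "'x measure \<Rightarrow> ('x \<Rightarrow> complex) set" where
  "L2 M = {f \<in> borel_measurable M. integrable M (\<lambda>x. (cmod (f x))\<^sup>2)}"

definition Linf :: "'x measure \<Rightarrow> ('x \<Rightarrow> complex) set" where
  "Linf M = {f \<in> borel_measurable M. \<exists>C. AE x in M. cmod (f x) \<le> C}"

definition L2_inner :: "'x measure \<Rightarrow> ('x \<Rightarrow> complex) \<Rightarrow> ('x \<Rightarrow> complex) \<Rightarrow> complex" where
  "L2_inner M f h = (\<integral>x. f x * cnj (h x) \<partial>M)"

definition L2_norm :: "'x measure \<Rightarrow> ('x \<Rightarrow> complex) \<Rightarrow> real" where
  "L2_norm M f = sqrt (\<integral>x. (cmod (f x))\<^sup>2 \<partial>M)"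

definition L2_tendsto :: "'x measure \<Rightarrow> (nat \<Rightarrow> 'x \<Rightarrow> complex) \<Rightarrow> ('x \<Rightarrow> complex) \<Rightarrow> bool" where
  "L2_tendsto M u f \<longleftrightarrow> (\<forall>n. u n \<in> L2 M) \<and> f \<in> L2 M \<and>
     (\<lambda>n. L2_norm M (\<lambda>x. u n x - f x)) \<longlonglongrightarrow> 0"

text \<open>Conditional expectation of complex functions. That it is, on \<open>L2\<close>, the orthogonal
  projection onto the functions measurable with respect to the subalgebra is the content of
  \<open>complex_cond_exp_L2\<close> and \<open>complex_cond_exp_orthogonal\<close> below.\<close>

definition complex_cond_exp ::
    "'x measure \<Rightarrow> 'x measure \<Rightarrow> ('x \<Rightarrow> complex) \<Rightarrow> 'x \<Rightarrow> complex" where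
  "complex_cond_exp M F f =
     (\<lambda>x. Complex (real_cond_exp M F (\<lambda>y. Re (f y)) x) (real_cond_exp M F (\<lambda>y. Im (f y)) x))"

abbreviation inv_exp :: "'x measure \<Rightarrow> ('g \<Rightarrow> 'x \<Rightarrow> 'x) \<Rightarrow> ('x \<Rightarrow> complex) \<Rightarrow> 'x \<Rightarrow> complex" where
  "inv_exp M T \<equiv> complex_cond_exp M (inv_algebra M T)"

lemma subalgebra_inv_algebra: "subalgebra M (inv_algebra M T)"
proof -
  have "invariant_sets M T UNIV \<subseteq> sets M"
    by (auto simp: invariant_sets_def)
  moreover from this have "invariant_sets M T UNIV \<subseteq> Pow (space M)"
    using sets.space_closed by blast
  ultimately show ?thesis
    by (simp add: subalgebra_def inv_algebra_def sets.sigma_sets_subset)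
qed

lemma integrable_mult_L2:
  fixes f g :: "'x \<Rightarrow> real"
  assumes "f \<in> borel_measurable M" "g \<in> borel_measurable M"
    and "integrable M (\<lambda>x. (f x)\<^sup>2)" "integrable M (\<lambda>x. (g x)\<^sup>2)"
  shows "integrable M (\<lambda>x. f x * g x)"
proof (rule Bochner_Integration.integrable_bound)
  show "integrable M (\<lambda>x. (f x)\<^sup>2 + (g x)\<^sup>2)"
    using assms by simp
  show "AE x in M. norm (f x * g x) \<le> norm ((f x)\<^sup>2 + (g x)\<^sup>2)"
  proof (intro AE_I2)
    fix x
    have "2 * \<bar>f x * g x\<bar> \<le> (f x)\<^sup>2 + (g x)\<^sup>2"
      using sum_squares_bound[of "\<bar>f x\<bar>" "\<bar>g x\<bar>"] by (simp add: abs_mult)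
    moreover have "0 \<le> \<bar>f x * g x\<bar>"
      by simp
    ultimately show "norm (f x * g x) \<le> norm ((f x)\<^sup>2 + (g x)\<^sup>2)"
      by simp
  qed
qed (use assms in measurable)

lemma L2_Re_Im:
  assumes "f \<in> L2 M"
  shows "(\<lambda>x. Re (f x)) \<in> borel_measurable M" "(\<lambda>x. Im (f x)) \<in> borel_measurable M"
    and "integrable M (\<lambda>x. (Re (f x))\<^sup>2)" "integrable M (\<lambda>x. (Im (f x))\<^sup>2)"
proof -
  have m [measurable]: "f \<in> borel_measurable M" and i: "integrable M (\<lambda>x. (cmod (f x))\<^sup>2)"
    using assms by (auto simp: L2_def)
  show "(\<lambda>x. Re (f x)) \<in> borel_measurable M" "(\<lambda>x. Im (f x)) \<in> borel_measurable M"
    by measurable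
  show "integrable M (\<lambda>x. (Re (f x))\<^sup>2)" "integrable M (\<lambda>x. (Im (f x))\<^sup>2)"
    by (rule Bochner_Integration.integrable_bound[OF i]; simp add: cmod_power2)+
qed

lemma L2_I_Re_Im:
  assumes [measurable]: "(\<lambda>x. Re (f x)) \<in> borel_measurable M" "(\<lambda>x. Im (f x)) \<in> borel_measurable M"
    and "integrable M (\<lambda>x. (Re (f x))\<^sup>2)" "integrable M (\<lambda>x. (Im (f x))\<^sup>2)"
  shows "f \<in> L2 M"
  using assms by (auto simp: L2_def cmod_power2 borel_measurable_complex_iff)

context prob_space
begin

lemma real_cond_exp_square:
  assumes F: "subalgebra M F"
    and f: "f \<in> borel_measurable M" "integrable M (\<lambda>x. (f x)\<^sup>2)"
  shows "real_cond_exp M F f \<in> borel_measurable F"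
    and "integrable M (\<lambda>x. (real_cond_exp M F f x)\<^sup>2)"
proof -
  interpret finite_measure_subalgebra M F
    by unfold_locales (rule F)
  show "real_cond_exp M F f \<in> borel_measurable F"
    by simp
  have conv: "convex_on UNIV (\<lambda>x::real. x\<^sup>2)"
    using convex_power2 by simp
  show "integrable M (\<lambda>x. (real_cond_exp M F f x)\<^sup>2)"
    by (rule integrable_convex_cond_exp[where I = UNIV])
       (use f conv square_integrable_imp_integrable[OF f] in auto)
qed

lemma complex_cond_exp_L2:
  assumes "subalgebra M F" "f \<in> L2 M"
  shows "complex_cond_exp M F f \<in> borel_measurable F" "complex_cond_exp M F f \<in> L2 M"
proof -
  note f = L2_Re_Im[OF assms(2)]
  note R = real_cond_exp_square[OF assms(1) f(1,3)]
  note I = real_cond_exp_square[OF assms(1) f(2,4)]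
  show "complex_cond_exp M F f \<in> borel_measurable F"
    using R(1) I(1) by (simp add: complex_cond_exp_def borel_measurable_complex_iff)
  show "complex_cond_exp M F f \<in> L2 M"
    by (rule L2_I_Re_Im)
       (use R I measurable_from_subalg[OF assms(1)] in \<open>auto simp: complex_cond_exp_def\<close>)
qed

lemma complex_cond_exp_orthogonal:
  assumes F: "subalgebra M F" and f: "f \<in> L2 M" and h: "h \<in> L2 M" "h \<in> borel_measurable F"
  shows "L2_inner M (\<lambda>x. f x - complex_cond_exp M F f x) h = 0"
proof -
  interpret finite_measure_subalgebra M F
    by unfold_locales (rule F)
  have key: "integrable M (\<lambda>x. (p x - real_cond_exp M F p x) * q x)"
            "(\<integral>x. (p x - real_cond_exp M F p x) * q x \<partial>M) = 0"
    if "p \<in> borel_measurable M" "integrable M (\<lambda>x. (p x)\<^sup>2)"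
       "q \<in> borel_measurable F" "integrable M (\<lambda>x. (q x)\<^sup>2)" for p q :: "'a \<Rightarrow> real"
  proof -
    have pq: "integrable M (\<lambda>x. q x * p x)"
      using that measurable_from_subalg[OF F] by (intro integrable_mult_L2) auto
    note r = real_cond_exp_intg[OF pq that(3,1)]
    have eq: "(\<lambda>x. (p x - real_cond_exp M F p x) * q x)
                = (\<lambda>x. q x * p x - q x * real_cond_exp M F p x)"
      by (auto simp: algebra_simps)
    show "integrable M (\<lambda>x. (p x - real_cond_exp M F p x) * q x)"
         "(\<integral>x. (p x - real_cond_exp M F p x) * q x \<partial>M) = 0"
      unfolding eq using pq r by simp_all
  qed
  note f' = L2_Re_Im[OF f] and h' = L2_Re_Im[OF h(1)]
  have hF: "(\<lambda>x. Re (h x)) \<in> borel_measurable F" "(\<lambda>x. Im (h x)) \<in> borel_measurable F"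
    using h(2) by measurable
  let ?R = "\<lambda>x. Re (f x) - real_cond_exp M F (\<lambda>y. Re (f y)) x"
  let ?I = "\<lambda>x. Im (f x) - real_cond_exp M F (\<lambda>y. Im (f y)) x"
  note RR = key[OF f'(1,3) hF(1) h'(3)] and RI = key[OF f'(1,3) hF(2) h'(4)]
    and IR = key[OF f'(2,4) hF(1) h'(3)] and II = key[OF f'(2,4) hF(2) h'(4)]
  have "(\<lambda>x. (f x - complex_cond_exp M F f x) * cnj (h x)) =
      (\<lambda>x. complex_of_real (?R x * Re (h x)) + complex_of_real (?I x * Im (h x))
         + \<i> * (complex_of_real (?I x * Re (h x)) - complex_of_real (?R x * Im (h x))))"
    by (auto simp: complex_eq_iff complex_cond_exp_def)
  moreover have "(\<integral>x. complex_of_real (?R x * Re (h x)) + complex_of_real (?I x * Im (h x))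
         + \<i> * (complex_of_real (?I x * Re (h x)) - complex_of_real (?R x * Im (h x))) \<partial>M) = 0"
  proof -
    have *: "integrable M (\<lambda>x. complex_of_real (u x)) \<and> (\<integral>x. complex_of_real (u x) \<partial>M) = 0"
      if "integrable M u" "(\<integral>x. u x \<partial>M) = 0" for u
      using that by simp
    show ?thesis
      using *[OF RR] *[OF RI] *[OF IR] *[OF II]
      by (simp del: of_real_mult of_real_diff integral_complex_of_real complex_of_real_integrable_eq)
  qed
  ultimately show ?thesis
    by (simp add: L2_inner_def)
qed

end


section \<open>Singular spectrum\<close>

text \<open>By Bochner's theorem the spectral measure of \<open>f \<in> L2 M\<close> exists and is unique.\<close>

definition is_spectral_measure ::
    "'x measure \<Rightarrow> ('g::ab_group_add \<Rightarrow> 'x \<Rightarrow> 'x) \<Rightarrow> ('x \<Rightarrow> complex) \<Rightarrow> ('g \<Rightarrow> complex) measure \<Rightarrow> bool"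
  where
  "is_spectral_measure M T f \<sigma> \<longleftrightarrow> finite_measure \<sigma> \<and> sets \<sigma> = sets dual_borel \<and>
     (\<forall>g. L2_inner M (koopman M T g f) f = (\<integral>\<gamma>. \<gamma> g \<partial>\<sigma>))"

text \<open>\<open>absolutely_continuous \<mu> \<sigma>\<close> is the library's rendering of \<open>\<sigma> \<lless> \<mu>\<close>.\<close>

definition dominates_spectrum ::
    "'x measure \<Rightarrow> ('g::ab_group_add \<Rightarrow> 'x \<Rightarrow> 'x) \<Rightarrow> ('g \<Rightarrow> complex) measure \<Rightarrow> bool" where
  "dominates_spectrum M T \<mu> \<longleftrightarrow> finite_measure \<mu> \<and> sets \<mu> = sets dual_borel \<and>
     (\<forall>f\<in>L2 M. (\<integral>x. f x \<partial>M) = 0 \<longrightarrow>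
        (\<exists>\<sigma>. is_spectral_measure M T f \<sigma> \<and> absolutely_continuous \<mu> \<sigma>))"

text \<open>\<open>\<mu>\<close> is a finite representative of the maximal spectral type, a measure class.\<close>

definition max_spectral_type ::
    "'x measure \<Rightarrow> ('g::ab_group_add \<Rightarrow> 'x \<Rightarrow> 'x) \<Rightarrow> ('g \<Rightarrow> complex) measure \<Rightarrow> bool" where
  "max_spectral_type M T \<mu> \<longleftrightarrow> dominates_spectrum M T \<mu> \<and>
     (\<forall>\<rho>. dominates_spectrum M T \<rho> \<longrightarrow> absolutely_continuous \<rho> \<mu>)"

definition mutually_singular :: "'a measure \<Rightarrow> 'a measure \<Rightarrow> bool" where
  "mutually_singular \<mu> m \<longleftrightarrow>
     (\<exists>A\<in>sets \<mu> \<inter> sets m. emeasure \<mu> A = 0 \<and> emeasure m (space m - A) = 0)"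

text \<open>The class of \<open>\<mu>\<close> and the measure \<open>m\<close> are unique, so the quantifier over them is a
  definite description.\<close>

definition singular_spectrum :: "'x measure \<Rightarrow> ('g::ab_group_add \<Rightarrow> 'x \<Rightarrow> 'x) \<Rightarrow> bool" where
  "singular_spectrum M T \<longleftrightarrow>
     (\<exists>\<mu> m. max_spectral_type M T \<mu> \<and>
        normalized_haar (\<lambda>\<psi> \<gamma> g. \<psi> g * \<gamma> g) pontryagin_dual m \<and> mutually_singular \<mu> m)"


section \<open>The averages under consideration\<close>

definition diff_avg_vanishes ::
    "(nat \<Rightarrow> 'g::ab_group_add set) \<Rightarrow> ('g \<Rightarrow> 'g) \<Rightarrow> ('g \<Rightarrow> complex) \<Rightarrow> 'g \<Rightarrow> bool" where
  "diff_avg_vanishes F a \<gamma> h \<longleftrightarrow> (\<lambda>N. avg F N (\<lambda>g. \<gamma> (a (g + h) - a g))) \<longlonglongrightarrow> 0"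

definition mean_convergence ::
    "(nat \<Rightarrow> 'g set) \<Rightarrow> 'x measure \<Rightarrow> ('g \<Rightarrow> 'x \<Rightarrow> 'x) \<Rightarrow> ('g \<Rightarrow> 'x \<Rightarrow> 'x) \<Rightarrow> ('g \<Rightarrow> 'g) \<Rightarrow> bool"
  where
  "mean_convergence F M T S a \<longleftrightarrow> (\<forall>f1\<in>Linf M. \<forall>f2\<in>Linf M.
     L2_tendsto M
       (\<lambda>N x. avg F N (\<lambda>g. koopman M T g f1 x * koopman M S (a g) f2 x))
       (\<lambda>x. inv_exp M T f1 x * inv_exp M S f2 x))"

definition recurrence_bound ::
    "(nat \<Rightarrow> 'g set) \<Rightarrow> 'x measure \<Rightarrow> ('g \<Rightarrow> 'x \<Rightarrow> 'x) \<Rightarrow> ('g \<Rightarrow> 'x \<Rightarrow> 'x) \<Rightarrow> ('g \<Rightarrow> 'g) \<Rightarrow> bool"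
  where
  "recurrence_bound F M T S a \<longleftrightarrow> (\<forall>A\<in>sets M.
     \<exists>L. (\<lambda>N. avg F N (\<lambda>g. measure M (A \<inter> T g ` A \<inter> S (a g) ` A))) \<longlonglongrightarrow> L \<and>
         measure M A ^ 3 \<le> L)"

end

theory Submission
  imports Defs
begin

text \<open>If \<open>f\<^sub>1\<close> has singular spectral measure, approximating in \<open>L\<^sup>2\<close> of spectral plus Haar measure
  the function that is \<open>1\<close> on the support of the former gives a trigonometric polynomial
  \<open>\<Sum>k. c k * \<gamma> k\<close> with \<open>\<Sum>k. \<bar>c k\<bar>\<^sup>2\<close> small and \<open>\<Sum>k. c k * T\<^sub>k f\<^sub>1\<close> close to \<open>f\<^sub>1\<close>. By the F\o lner
  property the shifts can be moved to the second factor. If \<open>f\<^sub>2\<close> has no \<open>S\<close>-invariant part, the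
  condition on \<open>a\<close> makes the functions \<open>S\<^bsub>a(g)\<^esub> f\<^sub>2\<close> asymptotically orthogonal, so the second factor
  has mean square of the order of \<open>\<Sum>k. \<bar>c k\<bar>\<^sup>2\<close>. If \<open>f\<^sub>2\<close> is \<open>S\<close>-invariant, the mean ergodic theorem for
  \<open>T\<close> applies.

  The asymptotic orthogonality would follow from dominated convergence for the spectral measure of
  \<open>f\<^sub>2\<close>. Bochner's theorem is bypassed: a positive functional on the continuous functions on the dual
  group suffices, together with a bounded convergence theorem for such functionals.\<close>


section \<open>Bounded convergence for positive functionals\<close>

text \<open>The condition on \<open>a\<close> controls the characters outside a countable set
  \<open>B\<close>: the trivial one for (i), those trivial on a finite index subgroup for (iii),
  where finite generation makes the set countable. Both cases run through one argument, which asks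
  only that no point of \<open>B\<close> be an atom for the function at hand. For the trivial
  character this is achieved by subtracting the invariant part of \<open>f2\<close>; for the others
  an atom would produce an eigenfunction of \<open>S\<close>, which ergodicity of a finite index
  subgroup excludes. The maximal spectral type sees only functions of integral 0, so the mean of
  \<open>f1\<close> is split off. A constant is an average of arbitrarily many of its own translates
  because the group is infinite, hence has the required combinations with small coefficients.
  Recurrence follows by pairing the limit with the indicator of \<open>A\<close>. The exponent 3
  comes from an inequality for conditional expectations onto two unrelated sigma-algebras, since
  \<open>T\<close> and \<open>S\<close> need not commute.\<close>

locale positive_functional =
  fixes S :: "'a::topological_space set" and L :: "('a \<Rightarrow> real) \<Rightarrow> real"
  assumes compact: "compact S"
    and add: "continuous_on S f \<Longrightarrow> continuous_on S g \<Longrightarrow> L (\<lambda>x. f x + g x) = L f + L g"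
    and scale: "continuous_on S f \<Longrightarrow> L (\<lambda>x. c * f x) = c * L f"
    and mono: "continuous_on S f \<Longrightarrow> continuous_on S g \<Longrightarrow> (\<And>x. x \<in> S \<Longrightarrow> f x \<le> g x) \<Longrightarrow> L f \<le> L g"
begin

lemma const: "L (\<lambda>_. c) = c * L (\<lambda>_. 1)"
  using scale[of "\<lambda>_. 1" c] by simp

lemma nonneg: "continuous_on S f \<Longrightarrow> (\<And>x. x \<in> S \<Longrightarrow> 0 \<le> f x) \<Longrightarrow> 0 \<le> L f"
  using mono[of "\<lambda>_. 0" f] const[of 0] by simp

lemma sum:
  assumes "finite I" "\<And>i. i \<in> I \<Longrightarrow> continuous_on S (f i)"
  shows "L (\<lambda>x. \<Sum>i\<in>I. f i x) = (\<Sum>i\<in>I. L (f i))"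
  using assms
proof (induction I rule: finite_induct)
  case empty
  then show ?case using const[of 0] by simp
next
  case (insert i I)
  then have "L (\<lambda>x. f i x + (\<Sum>i\<in>I. f i x)) = L (f i) + L (\<lambda>x. \<Sum>i\<in>I. f i x)"
    by (intro add continuous_on_sum) auto
  with insert show ?case by simp
qed

text \<open>The elementary inequality \<open>2 |u| s <= u^2 + s^2\<close>, divided by
  \<open>2 s\<close>, takes the place of Cauchy-Schwarz; only additivity and monotonicity of
  \<open>L\<close> are used.\<close>

lemma abs_le:
  assumes "continuous_on S u" "L (\<lambda>x. (u x)\<^sup>2) \<le> s\<^sup>2" "s > 0"
  shows "L (\<lambda>x. \<bar>u x\<bar>) \<le> s * (1 + L (\<lambda>_. 1)) / 2"
proof -
  have "L (\<lambda>x. \<bar>u x\<bar>) \<le> L (\<lambda>x. 1 / (2 * s) * (u x)\<^sup>2 + s / 2)"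
  proof (rule mono)
    fix x
    have "2 * \<bar>u x\<bar> * s \<le> (u x)\<^sup>2 + s\<^sup>2"
      using sum_squares_bound[of "\<bar>u x\<bar>" s] by simp
    then show "\<bar>u x\<bar> \<le> 1 / (2 * s) * (u x)\<^sup>2 + s / 2"
      using \<open>s > 0\<close> by (simp add: field_simps power2_eq_square)
  qed (use assms in \<open>auto intro!: continuous_intros\<close>)
  also have "\<dots> = 1 / (2 * s) * L (\<lambda>x. (u x)\<^sup>2) + s / 2 * L (\<lambda>_. 1)"
  proof -
    have c: "continuous_on S (\<lambda>x. (u x)\<^sup>2)" using assms by (intro continuous_intros)
    then show ?thesis
      using add[OF continuous_on_mult_left[OF c, of "1 / (2 * s)"], of "\<lambda>_. s / 2"]
        scale[OF c, of "1 / (2 * s)"] const[of "s / 2"]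
      by auto
  qed
  also have "\<dots> \<le> 1 / (2 * s) * s\<^sup>2 + s / 2 * L (\<lambda>_. 1)"
    using assms by (intro add_mono mult_left_mono) auto
  also have "\<dots> = s * (1 + L (\<lambda>_. 1)) / 2"
    using assms by (simp add: field_simps power2_eq_square)
  finally show ?thesis .
qed

end

text \<open>The parallelogram law only ever forms midpoints, so closure under midpoints replaces the
  convex hull, and every bound passes to the hull by induction without any bookkeeping of
  weights.\<close>

inductive_set midpoint_hull :: "('a \<Rightarrow> real) set \<Rightarrow> ('a \<Rightarrow> real) set" for A where
  base: "f \<in> A \<Longrightarrow> f \<in> midpoint_hull A"
| mid: "f \<in> midpoint_hull A \<Longrightarrow> g \<in> midpoint_hull A \<Longrightarrow> (\<lambda>x. (f x + g x) / 2) \<in> midpoint_hull A"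

lemma midpoint_hull_mono: "A \<subseteq> B \<Longrightarrow> midpoint_hull A \<subseteq> midpoint_hull B"
proof
  fix f assume "A \<subseteq> B" "f \<in> midpoint_hull A"
  from this(2,1) show "f \<in> midpoint_hull B"
    by induction (auto intro: midpoint_hull.intros)
qed

lemma midpoint_hull_abs_le:
  assumes "h \<in> midpoint_hull A" "\<And>f. f \<in> A \<Longrightarrow> \<bar>f x\<bar> \<le> C"
  shows "\<bar>h x\<bar> \<le> C"
  using assms(1) by induction (use assms(2) in force)+

text \<open>A bounded convergence theorem for functionals that are not known to be integrals.
  Almost norm-minimal convex combinations \<open>h i\<close> of the tails form a Cauchy sequence for the
  seminorm \<open>L (h\<^sup>2)\<close>; hence \<open>h 0\<close> is dominated by the telescoping sum
  of the \<open>\<bar>h i - h (i + 1)\<bar>\<close>, which has small \<open>L\<close>, and by compactness a finite part of this sum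
  suffices.\<close>

lemma (in positive_functional) not_frequently_large:
  fixes f :: "nat \<Rightarrow> 'a \<Rightarrow> real"
  assumes cont: "\<And>n. continuous_on S (f n)"
    and bound: "\<And>n x. x \<in> S \<Longrightarrow> \<bar>f n x\<bar> \<le> C" and "C \<ge> 0"
    and "countable B"
    and conv: "\<And>x. x \<in> S - B \<Longrightarrow> (\<lambda>n. f n x) \<longlonglongrightarrow> 0"
    and small: "\<And>b e. b \<in> B \<inter> S \<Longrightarrow> 0 < e \<Longrightarrow>
      \<exists>a. continuous_on S a \<and> (\<forall>x\<in>S. 0 \<le> a x) \<and> 1 \<le> a b \<and> L a \<le> e"
    and "0 < \<delta>" and large: "\<And>N. \<exists>n\<ge>N. \<delta> \<le> L (f n)"
  shows False
proof -
  let ?K = "L (\<lambda>_. 1)"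
  have K: "?K \<ge> 0" by (rule nonneg) auto
  \<comment> \<open>Only indices with \<open>L (f i)\<close> at least \<open>\<delta>\<close> are
    kept, so every element of every hull still has \<open>L\<close> at least
    \<open>\<delta>\<close>; the assumption \<open>large\<close> keeps the hulls nonempty.\<close>
  define A where "A n = midpoint_hull {f i | i. i \<ge> n \<and> \<delta> \<le> L (f i)}" for n
  have A_ne: "A n \<noteq> {}" for n
    using large[of n] by (auto simp: A_def intro: midpoint_hull.base)
  have A_mono: "A n \<subseteq> A k" if "k \<le> n" for k n
    unfolding A_def using that by (intro midpoint_hull_mono) auto
  have A_mid: "(\<lambda>x. (g x + h x) / 2) \<in> A n" if "g \<in> A n" "h \<in> A n" for g h n
    using that unfolding A_def by (rule midpoint_hull.mid)
  have A_cont: "continuous_on S h" if "h \<in> A n" for h n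
    using that unfolding A_def by induction (auto intro!: continuous_intros cont)
  have A_bound: "\<bar>h x\<bar> \<le> C" if "h \<in> A n" "x \<in> S" for h n x
    using that(1) unfolding A_def by (rule midpoint_hull_abs_le) (use bound that in auto)
  have A_large: "\<delta> \<le> L h" if "h \<in> A n" for h n
    using that unfolding A_def
  proof induction
    case (mid g h)
    then have "continuous_on S g" "continuous_on S h"
      using A_cont[of _ n] by (auto simp: A_def)
    then have "L (\<lambda>x. 1 / 2 * (g x + h x)) = 1 / 2 * (L g + L h)"
      by (subst scale) (auto intro!: continuous_intros simp: add)
    with mid show ?case by simp
  qed auto
  have A_conv: "\<exists>n. \<forall>h\<in>A n. \<bar>h x\<bar> \<le> r" if x: "x \<in> S - B" and "r > 0" for x r
  proof -
    obtain n where "\<forall>i\<ge>n. \<bar>f i x\<bar> < r"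
      using conv[OF x] \<open>r > 0\<close> by (auto simp: LIMSEQ_iff)
    then have "\<bar>h x\<bar> \<le> r" if "h \<in> A n" for h
      using that unfolding A_def by (rule_tac midpoint_hull_abs_le) (auto intro: less_imp_le)
    then show ?thesis by blast
  qed
  define Q where "Q h = L (\<lambda>x. (h x)\<^sup>2)" for h
  define d where "d n = Inf (Q ` A n)" for n
  have Q_nonneg: "0 \<le> Q h" if "h \<in> A n" for h n
    unfolding Q_def by (rule nonneg) (use A_cont[OF that] in \<open>auto intro!: continuous_intros\<close>)
  have Q_le: "Q h \<le> C\<^sup>2 * ?K" if "h \<in> A n" for h n
  proof -
    have "Q h \<le> L (\<lambda>_. C\<^sup>2)"
      unfolding Q_def
    proof (rule mono)
      show "(h x)\<^sup>2 \<le> C\<^sup>2" if "x \<in> S" for x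
        using A_bound[OF \<open>h \<in> A n\<close> that] by (metis abs_ge_zero power2_abs power_mono)
    qed (use A_cont[OF that] in \<open>auto intro!: continuous_intros\<close>)
    then show ?thesis using const[of "C\<^sup>2"] by simp
  qed
  have bdd: "bdd_below (Q ` A n)" for n
    using Q_nonneg by (intro bdd_belowI[of _ 0]) auto
  have d_le: "d n \<le> Q h" if "h \<in> A n" for h n
    unfolding d_def using that bdd by (intro cInf_lower) auto
  have "bdd_above (range d)"
  proof (intro bdd_aboveI[of _ "C\<^sup>2 * ?K"], clarify)
    fix n
    obtain h where "h \<in> A n" using A_ne by blast
    then show "d n \<le> C\<^sup>2 * ?K" using d_le Q_le by (meson order_trans)
  qed
  define e where "e = Sup (range d)"
  have d_e: "d n \<le> e" for n
    unfolding e_def using \<open>bdd_above (range d)\<close> by (intro cSup_upper) auto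
  \<comment> \<open>With this \<open>s\<close> the whole telescoping sum will have \<open>L\<close>
    at most \<open>s * (1 + ?K) / 2 = \<delta> / 4\<close>.\<close>
  define s where "s = \<delta> / (2 * (1 + ?K))"
  have s: "s > 0" using \<open>0 < \<delta>\<close> K by (simp add: s_def)
  \<comment> \<open>The parallelogram law will bound \<open>L ((h i - h (Suc i))^2)\<close> by
    \<open>4 e + 4 \<epsilon> i - 4 (e - \<epsilon> i) = 8 \<epsilon> i\<close>, which is to be
    \<open>(s / 2 ^ Suc i)^2\<close>.\<close>
  define \<epsilon> where "\<epsilon> i = (s / 2 ^ Suc i)\<^sup>2 / 8" for i
  have \<epsilon>: "\<epsilon> i > 0" for i using s by (simp add: \<epsilon>_def)
  have "\<exists>n. e - \<epsilon> i < d n" for i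
    using less_cSup_iff[of "range d" "e - \<epsilon> i"] \<open>bdd_above (range d)\<close> \<epsilon>[of i]
    by (auto simp: e_def)
  then obtain N0 where N0: "\<And>i. e - \<epsilon> i < d (N0 i)" by metis
  \<comment> \<open>Summing makes \<open>N\<close> monotone and keeps it above \<open>N0\<close>;
    the extra \<open>i\<close> drives the tails to infinity, so that \<open>h i\<close> inherits
    pointwise convergence to 0 outside \<open>B\<close>.\<close>
  define N where "N i = (\<Sum>j\<le>i. N0 j) + i" for i
  have N_ge: "N0 i \<le> N i" "i \<le> N i" for i
    unfolding N_def using member_le_sum[of i "{..i}" N0] by auto
  have N_Suc: "N i \<le> N (Suc i)" for i by (simp add: N_def)
  have "\<exists>h\<in>A (N i). Q h < e + \<epsilon> i" for i
  proof -
    have "Inf (Q ` A (N i)) < e + \<epsilon> i"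
      using d_e[of "N i"] \<epsilon>[of i] by (simp add: d_def)
    then show ?thesis
      using cInf_less_iff[of "Q ` A (N i)"] A_ne bdd by auto
  qed
  then obtain h where h: "\<And>i. h i \<in> A (N i)" and Qh: "\<And>i. Q (h i) < e + \<epsilon> i" by metis
  have h_cont: "continuous_on S (h i)" for i using A_cont[OF h] .
  have step: "L (\<lambda>x. \<bar>h i x - h (Suc i) x\<bar>) \<le> s / 2 ^ Suc i * (1 + ?K) / 2" for i
  proof (rule abs_le)
    let ?m = "\<lambda>x. (h i x + h (Suc i) x) / 2"
    have "?m \<in> A (N i)"
      using h A_mono[OF N_Suc[of i]] by (intro A_mid) auto
    then have "?m \<in> A (N0 i)" using A_mono[OF N_ge(1)] by blast
    then have m: "e - \<epsilon> i < Q ?m" using d_le N0[of i] by fastforce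
    have "\<epsilon> (Suc i) \<le> \<epsilon> i"
      unfolding \<epsilon>_def using s
      by (intro divide_right_mono power_mono divide_left_mono power_increasing) auto
    have eq: "(\<lambda>x. 2 * (h i x)\<^sup>2 + 2 * (h (Suc i) x)\<^sup>2) = (\<lambda>x. (h i x - h (Suc i) x)\<^sup>2 + 4 * (?m x)\<^sup>2)"
      by (auto simp: power2_eq_square algebra_simps)
    have "L (\<lambda>x. (h i x - h (Suc i) x)\<^sup>2) + 4 * Q ?m = 2 * Q (h i) + 2 * Q (h (Suc i))"
    proof -
      have c: "continuous_on S (\<lambda>x. (h i x - h (Suc i) x)\<^sup>2)" "continuous_on S (\<lambda>x. (?m x)\<^sup>2)"
        "continuous_on S (\<lambda>x. (h k x)\<^sup>2)" for k
        using h_cont by (auto intro!: continuous_intros)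
      have "L (\<lambda>x. (h i x - h (Suc i) x)\<^sup>2) + 4 * Q ?m = L (\<lambda>x. (h i x - h (Suc i) x)\<^sup>2 + 4 * (?m x)\<^sup>2)"
        unfolding Q_def using c by (subst add) (auto intro!: continuous_on_mult_left simp: scale)
      also have "\<dots> = 2 * Q (h i) + 2 * Q (h (Suc i))"
        unfolding Q_def eq[symmetric] using c(3)
        by (subst add) (auto intro!: continuous_on_mult_left simp: scale)
      finally show ?thesis .
    qed
    also have "\<dots> \<le> 4 * e + 4 * \<epsilon> i"
      using Qh[of i] Qh[of "Suc i"] \<open>\<epsilon> (Suc i) \<le> \<epsilon> i\<close> by simp
    finally show "L (\<lambda>x. (h i x - h (Suc i) x)\<^sup>2) \<le> (s / 2 ^ Suc i)\<^sup>2"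
      using m by (simp add: \<epsilon>_def)
  qed (use h_cont s in \<open>auto intro!: continuous_intros\<close>)
  obtain b :: "nat \<Rightarrow> 'a" where b: "B \<subseteq> range b"
    using \<open>countable B\<close> range_from_nat_into[of B] by (metis empty_subsetI order_refl)
  \<comment> \<open>The bumps at the points of \<open>B\<close> enter with the factor
    \<open>C\<close>, so their total contribution is at most \<open>C * t\<close>, hence at most
    \<open>\<delta> / 4\<close>; \<open>C + 1\<close> avoids division by 0.\<close>
  define t where "t = \<delta> / (4 * (C + 1))"
  have t: "t > 0" using \<open>0 < \<delta>\<close> \<open>C \<ge> 0\<close> by (simp add: t_def)
  have "\<exists>a. continuous_on S a \<and> (\<forall>x\<in>S. 0 \<le> a x) \<and> (b j \<in> B \<inter> S \<longrightarrow> 1 \<le> a (b j)) \<and> L a \<le> t / 2 ^ Suc j" for j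
  proof (cases "b j \<in> B \<inter> S")
    case True
    then show ?thesis using small[OF True, of "t / 2 ^ Suc j"] t by auto
  next
    case False
    then show ?thesis using t const[of 0] by (intro exI[of _ "\<lambda>_. 0"]) auto
  qed
  then obtain a where a: "\<And>j. continuous_on S (a j)" "\<And>j x. x \<in> S \<Longrightarrow> 0 \<le> a j x"
      "\<And>j. b j \<in> B \<inter> S \<Longrightarrow> 1 \<le> a j (b j)" "\<And>j. L (a j) \<le> t / 2 ^ Suc j"
    by metis
  \<comment> \<open>A continuous majorant of \<open>h 0\<close> up to \<open>\<eta>\<close>,
    increasing in \<open>n\<close>: the telescoping sum works where \<open>f\<close> converges, and
    \<open>C\<close> times the bumps works on \<open>B\<close>.\<close>
  define R where "R n x = (\<Sum>i<n. \<bar>h i x - h (Suc i) x\<bar>) + C * (\<Sum>j<n. a j x)" for n x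
  have R_cont: "continuous_on S (R n)" for n
    unfolding R_def by (intro continuous_intros h_cont a)
  have R_mono: "R k x \<le> R n x" if "k \<le> n" "x \<in> S" for k n x
    unfolding R_def using that a(2) \<open>C \<ge> 0\<close>
    by (intro add_mono sum_mono2 mult_left_mono) auto
  have tel: "h 0 x - h n x \<le> (\<Sum>i<n. \<bar>h i x - h (Suc i) x\<bar>)" for n x
    by (induction n) auto
  define \<eta> where "\<eta> = \<delta> / (4 * (?K + 1))"
  have \<eta>: "\<eta> > 0" using \<open>0 < \<delta>\<close> K by (simp add: \<eta>_def)
  \<comment> \<open>On \<open>B\<close> the bump at \<open>x\<close> alone lifts \<open>R\<close> to
    at least \<open>C\<close>, which dominates \<open>h 0\<close>. Elsewhere \<open>h 0 x\<close> is
    at most \<open>h n x\<close> plus the telescoping sum, and \<open>h n x\<close> is small for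
    large \<open>n\<close>.\<close>
  have cover: "\<exists>n. h 0 x - R n x < \<eta>" if x: "x \<in> S" for x
  proof (cases "x \<in> B")
    case True
    then obtain j where j: "x = b j" using b by blast
    have "1 \<le> (\<Sum>j<Suc j. a j x)"
      using a(3)[of j] member_le_sum[of j "{..<Suc j}" "\<lambda>j. a j x"] a(2) x True j by auto
    then have "C * 1 \<le> C * (\<Sum>j<Suc j. a j x)"
      using \<open>C \<ge> 0\<close> by (rule mult_left_mono)
    moreover have "0 \<le> (\<Sum>i<Suc j. \<bar>h i x - h (Suc i) x\<bar>)" by (intro sum_nonneg) auto
    moreover have "h 0 x \<le> C" using A_bound[OF h x, of 0] by auto
    ultimately have "h 0 x - R (Suc j) x \<le> 0" unfolding R_def by linarith
    then show ?thesis using \<eta> by (intro exI[of _ "Suc j"]) auto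
  next
    case False
    then obtain n where n: "\<forall>h\<in>A n. \<bar>h x\<bar> \<le> \<eta> / 2" using A_conv[of x "\<eta> / 2"] x \<eta> by auto
    have "h n \<in> A n" using h[of n] A_mono[OF N_ge(2)[of n]] by blast
    then have "h n x \<le> \<eta> / 2" using n by fastforce
    moreover have "0 \<le> C * (\<Sum>j<n. a j x)"
      using a(2) x \<open>C \<ge> 0\<close> by (intro mult_nonneg_nonneg sum_nonneg) auto
    ultimately have "h 0 x - R n x < \<eta>"
      unfolding R_def using tel[of x n] \<eta> by linarith
    then show ?thesis by blast
  qed
  \<comment> \<open>As in Dini's theorem, the sets where \<open>R n\<close> already suffices are
    relatively open and increase with \<open>n\<close>, so compactness yields a single
    \<open>n\<close> for all of \<open>S\<close>.\<close>
  have "\<exists>U. open U \<and> U \<inter> S = {x\<in>S. h 0 x - R n x < \<eta>}" for n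
  proof -
    have "continuous_on S (\<lambda>x. h 0 x - R n x)" by (intro continuous_intros h_cont R_cont)
    from this[unfolded continuous_on_open_invariant, rule_format, of "{..<\<eta>}"]
    show ?thesis by (auto simp: vimage_def Int_def conj_commute)
  qed
  then obtain U where U: "\<And>n. open (U n)" "\<And>n. U n \<inter> S = {x\<in>S. h 0 x - R n x < \<eta>}" by metis
  have "S \<subseteq> (\<Union>n. U n)" using cover U(2) by blast
  then obtain D where D: "finite D" "S \<subseteq> (\<Union>n\<in>D. U n)"
    using compactE_image[OF compact, of UNIV U] U(1) by (metis)
  obtain n where n: "\<And>k. k \<in> D \<Longrightarrow> k \<le> n"
    using D(1) by (meson finite_nat_set_iff_bounded_le)
  have h0: "h 0 x \<le> R n x + \<eta>" if x: "x \<in> S" for x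
  proof -
    obtain k where "k \<in> D" "x \<in> U k" using D x by blast
    then have "h 0 x - R k x < \<eta>" using U(2)[of k] x by blast
    with R_mono[OF n[OF \<open>k \<in> D\<close>] x] show ?thesis by linarith
  qed
  have geo: "(\<Sum>i<n. 1 / 2 ^ Suc i) \<le> (1::real)" for n
  proof -
    have "(\<Sum>i<n. 1 / 2 ^ Suc i) = 1 - 1 / (2::real) ^ n" by (induction n) (auto simp: field_simps)
    then show ?thesis by simp
  qed
  have "\<delta> \<le> L (h 0)" using A_large[OF h] .
  also have "\<dots> \<le> L (\<lambda>x. R n x + \<eta>)"
    using h0 h_cont R_cont by (intro mono) (auto intro!: continuous_intros)
  also have "\<dots> = (\<Sum>i<n. L (\<lambda>x. \<bar>h i x - h (Suc i) x\<bar>)) + C * (\<Sum>j<n. L (a j)) + \<eta> * ?K"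
  proof -
    have c: "continuous_on S (\<lambda>x. \<bar>h i x - h (Suc i) x\<bar>)" "continuous_on S (\<lambda>x. \<Sum>j<n. a j x)" for i
      using h_cont a(1) by (auto intro!: continuous_intros)
    have "L (\<lambda>x. R n x + \<eta>) = L (R n) + \<eta> * ?K"
      using add[OF R_cont continuous_on_const[of S \<eta>]] const[of \<eta>] by simp
    moreover have "L (R n) = L (\<lambda>x. \<Sum>i<n. \<bar>h i x - h (Suc i) x\<bar>) + C * L (\<lambda>x. \<Sum>j<n. a j x)"
      unfolding R_def using c by (subst add) (auto intro!: continuous_on_sum continuous_on_mult_left simp: scale)
    ultimately show ?thesis using sum[OF _ c(1), of "{..<n}"] sum[of "{..<n}" a] a(1) by simp
  qed
  also have "\<dots> \<le> (\<Sum>i<n. s / 2 ^ Suc i * (1 + ?K) / 2) + C * (\<Sum>j<n. t / 2 ^ Suc j) + \<eta> * ?K"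
    using step a(4) \<open>C \<ge> 0\<close> by (intro add_mono mult_left_mono sum_mono order_refl) auto
  also have "\<dots> = s * (1 + ?K) / 2 * (\<Sum>i<n. 1 / 2 ^ Suc i) + C * t * (\<Sum>i<n. 1 / 2 ^ Suc i) + \<eta> * ?K"
    by (simp add: sum_distrib_left sum_distrib_right mult.assoc)
  also have "\<dots> \<le> s * (1 + ?K) / 2 * 1 + C * t * 1 + \<eta> * ?K"
    using geo[of n] s K t \<open>C \<ge> 0\<close> by (intro add_mono mult_left_mono order_refl) auto
  also have "\<dots> \<le> \<delta> / 4 + \<delta> / 4 + \<delta> / 4"
  proof -
    have "s * (1 + ?K) / 2 = \<delta> / 4" using K by (simp add: s_def field_simps)
    moreover have "C * t \<le> \<delta> / 4" using \<open>C \<ge> 0\<close> \<open>0 < \<delta>\<close> by (simp add: t_def field_simps)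
    moreover have "\<eta> * ?K \<le> \<delta> / 4" using K \<open>0 < \<delta>\<close> by (simp add: \<eta>_def field_simps)
    ultimately show ?thesis by simp
  qed
  finally show False using \<open>0 < \<delta>\<close> by simp
qed

text \<open>The preceding contradiction, applied to \<open>f\<close> and to \<open>- f\<close>,
  bounds \<open>L (f n)\<close> eventually from both sides. The assumption \<open>small\<close> says
  that points of \<open>B\<close> are not atoms of \<open>L\<close>.\<close>

theorem (in positive_functional) bounded_convergence:
  fixes f :: "nat \<Rightarrow> 'a \<Rightarrow> real"
  assumes cont: "\<And>n. continuous_on S (f n)"
    and bound: "\<And>n x. x \<in> S \<Longrightarrow> \<bar>f n x\<bar> \<le> C"
    and "countable B"
    and conv: "\<And>x. x \<in> S - B \<Longrightarrow> (\<lambda>n. f n x) \<longlonglongrightarrow> 0"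
    and small: "\<And>b e. b \<in> B \<inter> S \<Longrightarrow> 0 < e \<Longrightarrow>
      \<exists>a. continuous_on S a \<and> (\<forall>x\<in>S. 0 \<le> a x) \<and> 1 \<le> a b \<and> L a \<le> e"
  shows "(\<lambda>n. L (f n)) \<longlonglongrightarrow> 0"
proof (rule LIMSEQ_I)
  fix \<delta> :: real assume "\<delta> > 0"
  have bound': "\<bar>f n x\<bar> \<le> \<bar>C\<bar>" if "x \<in> S" for n x
    using bound[OF that, of n] by linarith
  have "\<exists>N. \<forall>n\<ge>N. L (f n) < \<delta>"
  proof (rule ccontr)
    assume "\<not> ?thesis"
    then have "\<exists>n\<ge>N. \<delta> \<le> L (f n)" for N by (meson not_less)
    then show False
      using not_frequently_large[OF cont bound' _ \<open>countable B\<close> conv small \<open>\<delta> > 0\<close>] by auto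
  qed
  moreover have "\<exists>N. \<forall>n\<ge>N. L (\<lambda>x. -1 * f n x) < \<delta>"
  proof (rule ccontr)
    assume "\<not> ?thesis"
    then have "\<exists>n\<ge>N. \<delta> \<le> L (\<lambda>x. -1 * f n x)" for N by (meson not_less)
    moreover have "(\<lambda>n. -1 * f n x) \<longlonglongrightarrow> 0" if "x \<in> S - B" for x
      using tendsto_minus[OF conv[OF that]] by simp
    ultimately show False
      using not_frequently_large[OF _ _ _ \<open>countable B\<close> _ small \<open>\<delta> > 0\<close>, of "\<lambda>n x. -1 * f n x" "\<bar>C\<bar>"] cont bound'
      by (auto intro!: continuous_intros)
  qed
  ultimately obtain N1 N2 where N: "\<forall>n\<ge>N1. L (f n) < \<delta>" "\<forall>n\<ge>N2. - L (f n) < \<delta>"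
    using scale[OF cont, of "-1"] by auto
  show "\<exists>N. \<forall>n\<ge>N. norm (L (f n) - 0) < \<delta>"
    using N by (intro exI[of _ "max N1 N2"]) (auto simp: abs_less_iff)
qed


section \<open>Characters separate points\<close>

definition int_mult :: "int \<Rightarrow> 'g::ab_group_add \<Rightarrow> 'g" where
  "int_mult k g = (if 0 \<le> k then (\<Sum>i<nat k. g) else - (\<Sum>i<nat (- k). g))"

text \<open>Every integer is a difference of two naturals, so this form lets additivity be checked
  without distinguishing signs.\<close>

lemma int_mult_diff: "int_mult (int m - int n) g = (\<Sum>i<m. g) - (\<Sum>i<n. g)"
proof -
  have *: "(\<Sum>i<m + n. g) = (\<Sum>i<m. g) + (\<Sum>i<n. g)" for m n :: nat
    by (induction n) (auto simp: add_ac)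
  show ?thesis
  proof (cases "n \<le> m")
    case True
    then have "int m - int n = int (m - n)" by simp
    then show ?thesis using *[of "m - n" n] True by (simp add: int_mult_def flip: of_nat_diff)
  next
    case False
    then have "int m - int n = - int (n - m)" "n - m > 0" by simp_all
    then show ?thesis using *[of "n - m" m] False
      unfolding \<open>int m - int n = - int (n - m)\<close> int_mult_def by (simp del: of_nat_diff)
  qed
qed

lemma int_mult_add: "int_mult (j + k) g = int_mult j g + int_mult k g"
proof -
  obtain a b c d where "j = int a - int b" "k = int c - int d"
    by (metis int_diff_cases)
  moreover have "(\<Sum>i<m + n. g) = (\<Sum>i<m. g) + (\<Sum>i<n. g)" for m n :: nat
    by (induction n) (auto simp: add_ac)
  moreover have "int a - int b + (int c - int d) = int (a + c) - int (b + d)" by simp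
  ultimately show ?thesis by (simp only: int_mult_diff) simp
qed

lemma int_mult_0 [simp]: "int_mult 0 g = 0" and int_mult_1 [simp]: "int_mult 1 g = g"
  by (simp_all add: int_mult_def)

lemma int_mult_minus: "int_mult (- k) g = - int_mult k g"
  using int_mult_add[of "- k" k g] by (simp add: eq_neg_iff_add_eq_0)

text \<open>Graphs of characters of subgroups.\<close>

definition partial_character :: "('g::ab_group_add \<times> complex) set \<Rightarrow> bool" where
  "partial_character R \<longleftrightarrow> (0, 1) \<in> R \<and>
     (\<forall>x y x' y'. (x, y) \<in> R \<longrightarrow> (x', y') \<in> R \<longrightarrow> (x + x', y * y') \<in> R) \<and>
     (\<forall>x y. (x, y) \<in> R \<longrightarrow> (- x, inverse y) \<in> R) \<and>
     (\<forall>x y. (x, y) \<in> R \<longrightarrow> cmod y = 1) \<and> (\<forall>y. (0, y) \<in> R \<longrightarrow> y = 1)"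

lemma partial_characterD:
  assumes "partial_character R"
  shows "(0, 1) \<in> R" "(x, y) \<in> R \<Longrightarrow> (x', y') \<in> R \<Longrightarrow> (x + x', y * y') \<in> R"
    "(x, y) \<in> R \<Longrightarrow> (- x, inverse y) \<in> R" "(x, y) \<in> R \<Longrightarrow> cmod y = 1" "(0, y) \<in> R \<Longrightarrow> y = 1"
  using assms unfolding partial_character_def by blast+

lemma partial_character_unique:
  assumes "partial_character R" "(x, y) \<in> R" "(x, y') \<in> R"
  shows "y = y'"
proof -
  note R = partial_characterD[OF assms(1)]
  have "(x + - x, y * inverse y') \<in> R" using assms R(2,3) by blast
  then have "y * inverse y' = 1" using R(5) by simp
  then show ?thesis
    by (metis inverse_inverse_eq inverse_unique mult.commute)
qed

lemma partial_character_int_mult: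
  assumes "partial_character R" "(int_mult n g, y) \<in> R"
  shows "(int_mult (q * n) g, y powi q) \<in> R"
proof -
  note R = partial_characterD[OF assms(1)]
  have y0: "y \<noteq> 0" using R(4)[OF assms(2)] by auto
  show ?thesis
  proof (induction q rule: int_induct[where k = 0])
    case base
    then show ?case using R(1) by simp
  next
    case (step1 i)
    show ?case
      using R(2)[OF step1(2) assms(2)] y0
      by (simp add: int_mult_add[symmetric] power_int_add_1 distrib_right)
  next
    case (step2 i)
    have "int_mult (i * n) g + - int_mult n g = int_mult ((i - 1) * n) g"
      by (simp add: int_mult_minus[symmetric] int_mult_add[symmetric] left_diff_distrib del: add_uminus_conv_diff)
         (simp add: algebra_simps)
    moreover have "y powi i * inverse y = y powi (i - 1)"
      using y0 by (simp add: power_int_diff field_simps)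
    ultimately show ?case
      using R(2)[OF step2(2) R(3)[OF assms(2)]] by simp
  qed
qed

text \<open>If \<open>y\<close> is 1 there are \<open>n >= 2\<close> roots of unity to choose from;
  otherwise no root of \<open>y\<close> equals 1. The condition \<open>z \<noteq> 1\<close> is what
  makes the extended character nontrivial at the new element.\<close>

lemma unit_root_neq_1:
  assumes "n \<ge> 2" "cmod y = 1"
  obtains z :: complex where "z ^ n = y" "cmod z = 1" "z \<noteq> 1"
proof (cases "y = 1")
  case True
  have "card {z::complex. z ^ n = 1} = n" using assms by (intro card_roots_unity_eq) auto
  then have "\<not> {z::complex. z ^ n = 1} \<subseteq> {1}"
    using card_mono[of "{1::complex}" "{z. z ^ n = 1}"] assms by auto
  then obtain z :: complex where "z ^ n = 1" "z \<noteq> 1" by auto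
  moreover from this have "cmod z = 1"
    using assms by (metis norm_ge_zero norm_one norm_power power_eq_1_iff numeral_2_eq_2 not_less_eq_eq zero_le)
  ultimately show ?thesis using that True by blast
next
  case False
  define z where "z = cis (Arg y / n)"
  have "z ^ n = cis (real n * (Arg y / real n))" unfolding z_def by (rule Complex.DeMoivre)
  also have "\<dots> = cis (Arg y)" using assms by simp
  also have "\<dots> = y" using assms by (metis cis_Arg norm_zero zero_neq_one sgn_eq div_by_1 of_real_1)
  finally show ?thesis using that[of z] False by (metis norm_cis power_one z_def)
qed

text \<open>The integers \<open>k\<close> with \<open>k g\<close> in the domain form an ideal
  \<open>J\<close>. If it is zero the value at \<open>g\<close> is free, and \<open>-1\<close> is
  taken. Otherwise it is generated by some \<open>n >= 2\<close>, as \<open>g\<close> itself is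
  outside the domain, and the value must be an \<open>n\<close>-th root of the value prescribed at
  \<open>n g\<close>; such roots exist since the circle is divisible.\<close>

lemma partial_character_extend:
  assumes R: "partial_character R" and g: "g \<notin> fst ` R"
  obtains R' z where "partial_character R'" "R \<subseteq> R'" "(g, z) \<in> R'" "z \<noteq> 1"
proof -
  note RD = partial_characterD[OF R]
  define J where "J = {k. int_mult k g \<in> fst ` R}"
  have "\<exists>z. cmod z = 1 \<and> z \<noteq> 1 \<and> (\<forall>k y. (int_mult k g, y) \<in> R \<longrightarrow> y = z powi k)"
  proof (cases "J \<subseteq> {0}")
    case True
    show ?thesis
    proof (intro exI[of _ "- 1"] conjI allI impI)
      fix k y assume *: "(int_mult k g, y) \<in> R"
      then have "k \<in> J" by (force simp: J_def)
      then have "k = 0" using True by auto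
      then show "y = (- 1) powi k" using * RD(5)[of y] by auto
    qed auto
  next
    case False
    have minus: "- k \<in> J" if "k \<in> J" for k
      using that RD(3) by (force simp: J_def int_mult_minus)
    obtain k where "k \<in> J" "k \<noteq> 0" using False by auto
    then have ex: "\<exists>n. int n \<in> J \<and> n > 0"
      using minus[of k] by (intro exI[of _ "nat \<bar>k\<bar>"]) (auto simp: abs_if)
    define n where "n = (LEAST n. int n \<in> J \<and> n > 0)"
    have n: "int n \<in> J" "n > 0" using LeastI_ex[OF ex] by (auto simp: n_def)
    have n_min: "n \<le> l" if "int l \<in> J" "l > 0" for l
      unfolding n_def using that by (intro Least_le) auto
    have "n \<noteq> 1"
    proof
      assume "n = 1"
      with n(1) have "int_mult 1 g \<in> fst ` R" by (simp add: J_def)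
      with g show False by simp
    qed
    then have "n \<ge> 2" using n by auto
    obtain y0 where y0: "(int_mult (int n) g, y0) \<in> R" using n by (auto simp: J_def)
    obtain z where z: "z ^ n = y0" "cmod z = 1" "z \<noteq> 1"
      using unit_root_neq_1[OF \<open>n \<ge> 2\<close> RD(4)[OF y0]] by blast
    have "y = z powi k" if ky: "(int_mult k g, y) \<in> R" for k y
    proof -
      \<comment> \<open>Division by the least positive \<open>n\<close> in \<open>J\<close> leaves a
        remainder in \<open>J\<close>, which must be 0; this is the proof that \<open>n\<close>
        generates \<open>J\<close>.\<close>
      define q r where "q = k div int n" and "r = k mod int n"
      have k: "k = q * int n + r" by (simp add: q_def r_def)
      have q: "(int_mult (q * int n) g, y0 powi q) \<in> R"
        by (rule partial_character_int_mult[OF R y0])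
      have "(int_mult k g + - int_mult (q * int n) g, y * inverse (y0 powi q)) \<in> R"
        using RD(2)[OF ky RD(3)[OF q]] .
      then have "r \<in> J" by (force simp: J_def k int_mult_add)
      moreover have "0 \<le> r" "r < int n" using n by (auto simp: r_def)
      ultimately have "r = 0" using n_min[of "nat r"] by (cases "r = 0") auto
      then have "(int_mult k g, y0 powi q) \<in> R" using q k by simp
      then have "y = y0 powi q" using partial_character_unique[OF R ky] by blast
      also have "\<dots> = z powi k"
        using k \<open>r = 0\<close> z(1) power_int_mult[of z "int n" q] by (simp add: mult.commute)
      finally show ?thesis .
    qed
    then show ?thesis using z by blast
  qed
  then obtain z where z: "cmod z = 1" "z \<noteq> 1" and zR: "\<And>k y. (int_mult k g, y) \<in> R \<Longrightarrow> y = z powi k"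
    by blast
  have z0: "z \<noteq> 0" using z by auto
  define R' where "R' = {(x + int_mult k g, y * z powi k) | x y k. (x, y) \<in> R}"
  have R'I: "(x + int_mult k g, y * z powi k) \<in> R'" if "(x, y) \<in> R" for x y k
    using that by (auto simp: R'_def)
  have "partial_character R'"
    unfolding partial_character_def
  proof (intro conjI allI impI)
    show "(0, 1) \<in> R'" using R'I[OF RD(1), of 0] by simp
    fix x y assume "(x, y) \<in> R'"
    then obtain u v k where *: "x = u + int_mult k g" "y = v * z powi k" "(u, v) \<in> R"
      by (auto simp: R'_def)
    show "(- x, inverse y) \<in> R'"
      using R'I[OF RD(3)[OF *(3)], of "- k"] * by (simp add: int_mult_minus power_int_minus)
    show "cmod y = 1" using RD(4)[OF *(3)] z by (simp add: * norm_mult norm_power_int)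
    {
      fix x' y' assume "(x', y') \<in> R'"
      then obtain u' v' k' where **: "x' = u' + int_mult k' g" "y' = v' * z powi k'" "(u', v') \<in> R"
        by (auto simp: R'_def)
      show "(x + x', y * y') \<in> R'"
        using R'I[OF RD(2)[OF *(3) **(3)], of "k + k'"] z0
        by (simp add: * ** int_mult_add power_int_add algebra_simps)
    }
  next
    fix w assume "(0, w) \<in> R'"
    then obtain u v k where *: "0 = u + int_mult k g" "w = v * z powi k" "(u, v) \<in> R"
      by (auto simp: R'_def)
    \<comment> \<open>The enlarged relation is single-valued: a representation of 0 places
      \<open>(int_mult k g, inverse v)\<close> in \<open>R\<close>, and compatibility of
      \<open>z\<close> with \<open>R\<close> forces \<open>inverse v = z powi k\<close>.\<close>
    have "- u = int_mult k g" using *(1) by (simp add: minus_unique)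
    then have "inverse v = z powi k" using zR RD(3)[OF *(3)] by simp
    moreover have "v \<noteq> 0" using RD(4)[OF *(3)] by auto
    ultimately show "w = 1" by (simp add: *(2) flip: \<open>inverse v = z powi k\<close>)
  qed
  moreover have "R \<subseteq> R'"
  proof (clarify)
    fix x y assume "(x, y) \<in> R"
    from R'I[OF this, of 0] show "(x, y) \<in> R'" by simp
  qed
  moreover have "(g, z) \<in> R'" using R'I[OF RD(1), of 1] by simp
  ultimately show ?thesis using that z by blast
qed

text \<open>Extending the trivial partial character once already fixes a value other than 1 at
  \<open>k\<close>; Zorn's lemma gives a maximal extension, and one-step extension shows that it is
  defined everywhere.\<close>

theorem exists_character:
  fixes k :: "'g::ab_group_add"
  assumes "k \<noteq> 0"
  obtains \<gamma> where "\<gamma> \<in> pontryagin_dual" "\<gamma> k \<noteq> 1"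
proof -
  have "partial_character {(0::'g, 1)}" by (auto simp: partial_character_def)
  then obtain R0 z where R0: "partial_character R0" "(k, z) \<in> R0" "z \<noteq> 1"
    by (rule partial_character_extend[of _ k]) (use assms in auto)
  have "\<exists>M\<in>{R. partial_character R \<and> R0 \<subseteq> R}. \<forall>X\<in>{R. partial_character R \<and> R0 \<subseteq> R}. M \<subseteq> X \<longrightarrow> X = M"
  proof (rule subset_Zorn_nonempty)
    fix C assume "C \<noteq> {}" and "subset.chain {R. partial_character R \<and> R0 \<subseteq> R} C"
    then have C: "\<And>R. R \<in> C \<Longrightarrow> partial_character R" "\<And>R. R \<in> C \<Longrightarrow> R0 \<subseteq> R"
      and lin: "\<And>R R'. R \<in> C \<Longrightarrow> R' \<in> C \<Longrightarrow> R \<subseteq> R' \<or> R' \<subseteq> R"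
      by (auto simp: subset_chain_def)
    have "(x + x', y * y') \<in> \<Union>C" if xy: "(x, y) \<in> \<Union>C" "(x', y') \<in> \<Union>C" for x y x' y'
    proof -
      obtain R R' where "R \<in> C" "R' \<in> C" "(x, y) \<in> R" "(x', y') \<in> R'" using xy by auto
      with lin obtain Q where "Q \<in> C" "(x, y) \<in> Q" "(x', y') \<in> Q" by blast
      with partial_characterD(2)[OF C(1)] show ?thesis by blast
    qed
    moreover have "(0, 1) \<in> \<Union>C" using \<open>C \<noteq> {}\<close> partial_characterD(1)[OF C(1)] by blast
    moreover have "(- x, inverse y) \<in> \<Union>C \<and> cmod y = 1" if xy: "(x, y) \<in> \<Union>C" for x y
      using xy partial_characterD(3,4)[OF C(1)] by blast
    moreover have "y = 1" if "(0, y) \<in> \<Union>C" for y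
      using that partial_characterD(5)[OF C(1)] by blast
    ultimately show "\<Union>C \<in> {R. partial_character R \<and> R0 \<subseteq> R}"
      using \<open>C \<noteq> {}\<close> C(2) unfolding partial_character_def by blast
  qed (use R0 in auto)
  then obtain M where M: "partial_character M" "R0 \<subseteq> M"
    and max: "\<And>X. partial_character X \<Longrightarrow> M \<subseteq> X \<Longrightarrow> X = M" by auto
  have dom: "\<exists>y. (g, y) \<in> M" for g
  proof (rule ccontr)
    assume "\<nexists>y. (g, y) \<in> M"
    then have "g \<notin> fst ` M" by auto
    then obtain R' z where "partial_character R'" "M \<subseteq> R'" "(g, z) \<in> R'"
      by (rule partial_character_extend[OF M(1)])
    with max \<open>\<nexists>y. (g, y) \<in> M\<close> show False by blast
  qed
  define \<gamma> where "\<gamma> g = (THE y. (g, y) \<in> M)" for g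
  have \<gamma>: "(g, \<gamma> g) \<in> M" for g
    unfolding \<gamma>_def using dom[of g] by (rule_tac theI') (auto intro: partial_character_unique[OF M(1)])
  have \<gamma>_eq: "\<gamma> g = y" if "(g, y) \<in> M" for g y
    using partial_character_unique[OF M(1) \<gamma> that] .
  have "\<gamma> \<in> pontryagin_dual"
    unfolding pontryagin_dual_def
    using \<gamma>_eq[OF partial_characterD(2)[OF M(1) \<gamma> \<gamma>]] partial_characterD(4)[OF M(1) \<gamma>] by auto
  moreover have "\<gamma> k \<noteq> 1" using \<gamma>_eq[of k z] R0 M(2) by auto
  ultimately show ?thesis using that by blast
qed


section \<open>F\o lner averages and mean squares\<close>

definition folner_ratio :: "(nat \<Rightarrow> 'g::ab_group_add set) \<Rightarrow> 'g \<Rightarrow> nat \<Rightarrow> real" where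
  "folner_ratio F k n = real (card (sym_diff (F n) ((\<lambda>x. x + k) ` F n))) / real (card (F n))"

lemma folner_ratio_tendsto: "Folner F \<Longrightarrow> (\<lambda>n. folner_ratio F k n) \<longlonglongrightarrow> 0"
  by (simp add: Folner_def folner_ratio_def)

lemma folner_ratio_nonneg: "0 \<le> folner_ratio F k n"
  by (simp add: folner_ratio_def)

lemma FolnerD:
  assumes "Folner F"
  shows "finite (F n)" "F n \<noteq> {}" "card (F n) > 0"
  using assms by (auto simp: Folner_def card_gt_0_iff)

text \<open>After reindexing, the two sums run over \<open>F N\<close> and its translate; they
  cancel on the intersection, leaving the symmetric difference.\<close>

lemma avg_shift:
  fixes \<psi> :: "'g::ab_group_add \<Rightarrow> 'b::real_normed_vector"
  assumes F: "Folner F" and bound: "\<And>g. norm (\<psi> g) \<le> C"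
  shows "norm (avg F N (\<lambda>g. \<psi> (g + k)) - avg F N \<psi>) \<le> C * folner_ratio F k N"
proof -
  let ?A = "F N" and ?B = "(\<lambda>x. x + k) ` F N"
  note [simp] = FolnerD[OF F]
  have "(\<Sum>g\<in>?A. \<psi> (g + k)) = sum \<psi> ?B"
    by (subst sum.reindex) (auto simp: inj_on_def)
  also have "\<dots> - sum \<psi> ?A = sum \<psi> (?B - ?A) - sum \<psi> (?A - ?B)"
    using sum.Int_Diff[of ?B \<psi> ?A] sum.Int_Diff[of ?A \<psi> ?B] by (simp add: Int_commute)
  finally have "norm ((\<Sum>g\<in>?A. \<psi> (g + k)) - sum \<psi> ?A) \<le> norm (sum \<psi> (?B - ?A)) + norm (sum \<psi> (?A - ?B))"
    using norm_triangle_ineq4 by simp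
  also have "\<dots> \<le> real (card (?B - ?A)) * C + real (card (?A - ?B)) * C"
    using bound by (intro add_mono sum_norm_bound) auto
  also have "\<dots> = C * real (card (sym_diff ?A ?B))"
    by (subst card_Un_disjoint) (auto simp: algebra_simps)
  finally have *: "norm ((\<Sum>g\<in>?A. \<psi> (g + k)) - sum \<psi> ?A) \<le> C * real (card (sym_diff ?A ?B))" .
  have "norm (avg F N (\<lambda>g. \<psi> (g + k)) - avg F N \<psi>) = norm ((\<Sum>g\<in>?A. \<psi> (g + k)) - sum \<psi> ?A) / real (card ?A)"
    unfolding avg_def by (simp add: scaleR_diff_right[symmetric] divide_inverse)
  also have "\<dots> \<le> C * real (card (sym_diff ?A ?B)) / real (card ?A)"
    using * by (intro divide_right_mono) auto
  finally show ?thesis by (simp add: folner_ratio_def)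
qed

lemma avg_shift_tendsto:
  fixes \<psi> :: "'g::ab_group_add \<Rightarrow> 'b::real_normed_vector"
  assumes F: "Folner F" and bound: "\<And>g. norm (\<psi> g) \<le> C"
  shows "(\<lambda>N. avg F N (\<lambda>g. \<psi> (g + k)) - avg F N \<psi>) \<longlonglongrightarrow> 0"
proof (rule Lim_null_comparison)
  show "\<forall>\<^sub>F N in sequentially. norm (avg F N (\<lambda>g. \<psi> (g + k)) - avg F N \<psi>) \<le> C * folner_ratio F k N"
    using avg_shift[where \<psi> = \<psi> and C = C, OF F bound] by auto
  show "(\<lambda>N. C * folner_ratio F k N) \<longlonglongrightarrow> 0"
    using tendsto_mult_left[OF folner_ratio_tendsto[OF F, of k], of C] by simp
qed

lemma norm_avg_le:
  fixes u :: "'g::ab_group_add \<Rightarrow> 'b::real_normed_vector"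
  assumes "Folner F" "\<And>g. norm (u g) \<le> C"
  shows "norm (avg F N u) \<le> C"
proof -
  have "norm (sum u (F N)) \<le> real (card (F N)) * C"
    using assms by (intro sum_norm_bound) auto
  then show ?thesis
    using FolnerD[OF assms(1), of N] by (simp add: avg_def field_simps)
qed

lemma avg_const: "Folner F \<Longrightarrow> avg F N (\<lambda>_. c) = c"
  using FolnerD(3)[of F N] by (simp add: avg_def sum_constant_scaleR)

lemma avg_add: "avg F N (\<lambda>g. u g + v g) = avg F N u + avg F N v"
  by (simp add: avg_def sum.distrib scaleR_right_distrib)

lemma avg_diff: "avg F N (\<lambda>g. u g - v g) = avg F N u - avg F N v"
  by (simp add: avg_def sum_subtractf scaleR_right_diff_distrib)

lemma avg_mult_left: "avg F N (\<lambda>g. c * u g) = c * avg F N (u :: _ \<Rightarrow> 'b::real_algebra)"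
  by (simp add: avg_def sum_distrib_left)

lemma avg_sum: "avg F N (\<lambda>g. \<Sum>i\<in>I. u i g) = (\<Sum>i\<in>I. avg F N (u i))"
  by (simp add: avg_def sum.swap[of _ I] scaleR_sum_right)

text \<open>Convexity of the square, obtained from Cauchy-Schwarz by splitting each weight into two
  factors \<open>sqrt (p k)\<close>.\<close>

lemma norm_sum_weighted_sq_le:
  fixes z :: "'i \<Rightarrow> complex"
  assumes "\<And>k. k \<in> D \<Longrightarrow> 0 \<le> p k" "sum p D = (1::real)"
  shows "(cmod (\<Sum>k\<in>D. p k *\<^sub>R z k))\<^sup>2 \<le> (\<Sum>k\<in>D. p k * (cmod (z k))\<^sup>2)"
proof -
  have "cmod (\<Sum>k\<in>D. p k *\<^sub>R z k) \<le> (\<Sum>k\<in>D. sqrt (p k) * (sqrt (p k) * cmod (z k)))"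
    using assms(1) by (intro sum_norm_le) (simp add: mult.assoc[symmetric])
  then have "(cmod (\<Sum>k\<in>D. p k *\<^sub>R z k))\<^sup>2 \<le> (\<Sum>k\<in>D. sqrt (p k) * (sqrt (p k) * cmod (z k)))\<^sup>2"
    by (intro power_mono) auto
  also have "\<dots> \<le> (\<Sum>k\<in>D. (sqrt (p k))\<^sup>2) * (\<Sum>k\<in>D. (sqrt (p k) * cmod (z k))\<^sup>2)"
    by (rule Cauchy_Schwarz_ineq_sum)
  also have "(\<Sum>k\<in>D. (sqrt (p k))\<^sup>2) = 1" using assms by simp
  also have "(\<Sum>k\<in>D. (sqrt (p k) * cmod (z k))\<^sup>2) = (\<Sum>k\<in>D. p k * (cmod (z k))\<^sup>2)"
    using assms(1) by (intro sum.cong) (auto simp: power_mult_distrib)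
  finally show ?thesis by simp
qed

lemma sum_indicator_scaleR_eq_avg:
  assumes "F i \<subseteq> D" "finite D"
  shows "(\<Sum>k\<in>D. (indicator (F i) k / real (card (F i))) *\<^sub>R z k) = avg F i z"
proof -
  have "(\<Sum>k\<in>D. (indicator (F i) k / real (card (F i))) *\<^sub>R z k)
      = (\<Sum>k\<in>F i. (indicator (F i) k / real (card (F i))) *\<^sub>R z k)"
    using assms by (intro sum.mono_neutral_right) auto
  also have "\<dots> = avg F i z"
    by (simp add: avg_def scaleR_sum_right divide_inverse)
  finally show ?thesis .
qed

section \<open>Mean squares of essentially bounded functions\<close>

definition mean_sq :: "'x measure \<Rightarrow> ('x \<Rightarrow> complex) \<Rightarrow> real" where
  "mean_sq M f = (\<integral>x. (cmod (f x))\<^sup>2 \<partial>M)"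

lemma L2_norm_mean_sq: "L2_norm M f = sqrt (mean_sq M f)"
  by (simp add: L2_norm_def mean_sq_def)

lemma mean_sq_nonneg [simp]: "0 \<le> mean_sq M f"
  by (simp add: mean_sq_def)

lemma mean_sq_cong: "(\<And>x. x \<in> space M \<Longrightarrow> cmod (f x) = cmod (g x)) \<Longrightarrow> mean_sq M f = mean_sq M g"
  unfolding mean_sq_def by (intro Bochner_Integration.integral_cong) auto

lemma LinfI: "f \<in> borel_measurable M \<Longrightarrow> AE x in M. cmod (f x) \<le> C \<Longrightarrow> f \<in> Linf M"
  by (auto simp: Linf_def)

lemma Linf_measurable: "f \<in> Linf M \<Longrightarrow> f \<in> borel_measurable M"
  by (auto simp: Linf_def)

lemma LinfE:
  assumes "f \<in> Linf M"
  obtains C where "C > 0" "AE x in M. cmod (f x) \<le> C"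
proof -
  obtain C where "AE x in M. cmod (f x) \<le> C" using assms by (auto simp: Linf_def)
  then have "AE x in M. cmod (f x) \<le> \<bar>C\<bar> + 1" by eventually_elim auto
  then show ?thesis using that[of "\<bar>C\<bar> + 1"] by auto
qed

lemma Linf_const [simp]: "(\<lambda>_. c) \<in> Linf M"
  by (rule LinfI[of _ _ "cmod c"]) auto

lemma Linf_add: "f \<in> Linf M \<Longrightarrow> g \<in> Linf M \<Longrightarrow> (\<lambda>x. f x + g x) \<in> Linf M"
proof -
  assume fg: "f \<in> Linf M" "g \<in> Linf M"
  then obtain C D where "AE x in M. cmod (f x) \<le> C" "AE x in M. cmod (g x) \<le> D" by (auto simp: Linf_def)
  then have "AE x in M. cmod (f x + g x) \<le> C + D"
    by eventually_elim (metis add_mono norm_triangle_le)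
  then show ?thesis using fg[THEN Linf_measurable] by (intro LinfI) auto
qed

lemma Linf_mult: "f \<in> Linf M \<Longrightarrow> g \<in> Linf M \<Longrightarrow> (\<lambda>x. f x * g x) \<in> Linf M"
proof -
  assume fg: "f \<in> Linf M" "g \<in> Linf M"
  obtain C where C: "C > 0" "AE x in M. cmod (f x) \<le> C" using LinfE[OF fg(1)] .
  obtain D where D: "D > 0" "AE x in M. cmod (g x) \<le> D" using LinfE[OF fg(2)] .
  have "AE x in M. cmod (f x * g x) \<le> C * D"
    using C(2) D(2) by eventually_elim (use C D in \<open>auto simp: norm_mult intro: mult_mono\<close>)
  then show ?thesis using fg[THEN Linf_measurable] by (intro LinfI) auto
qed

lemma Linf_cmult: "f \<in> Linf M \<Longrightarrow> (\<lambda>x. c * f x) \<in> Linf M"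
  using Linf_mult[of "\<lambda>_. c" M f] by simp

lemma Linf_scaleR: "f \<in> Linf M \<Longrightarrow> (\<lambda>x. c *\<^sub>R f x) \<in> Linf M"
  using Linf_cmult[of f M "of_real c"] by (simp add: scaleR_conv_of_real)

lemma Linf_divide: "f \<in> Linf M \<Longrightarrow> (\<lambda>x. f x / c) \<in> Linf M"
  using Linf_cmult[of f M "inverse c"] by (simp add: divide_inverse mult.commute)

lemma Linf_diff: "f \<in> Linf M \<Longrightarrow> g \<in> Linf M \<Longrightarrow> (\<lambda>x. f x - g x) \<in> Linf M"
  using Linf_add[of f M "\<lambda>x. (-1) * g x"] Linf_cmult[of g M "-1"] by simp

lemma Linf_cnj: "f \<in> Linf M \<Longrightarrow> (\<lambda>x. cnj (f x)) \<in> Linf M"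
  by (auto simp: Linf_def borel_measurable_complex_iff)

lemma Linf_sum: "(\<And>i. i \<in> I \<Longrightarrow> f i \<in> Linf M) \<Longrightarrow> (\<lambda>x. \<Sum>i\<in>I. f i x) \<in> Linf M"
  by (induction I rule: infinite_finite_induct) (auto intro: Linf_add)

lemma Linf_avg: "(\<And>g. f g \<in> Linf M) \<Longrightarrow> (\<lambda>x. avg F N (\<lambda>g. f g x)) \<in> Linf M"
  unfolding avg_def by (intro Linf_scaleR Linf_sum)

lemmas Linf_intros = Linf_const Linf_add Linf_mult Linf_diff Linf_cnj Linf_sum Linf_avg Linf_scaleR Linf_divide

context prob_space
begin

lemma Linf_integrable: "f \<in> Linf M \<Longrightarrow> integrable M f"
  unfolding Linf_def using integrable_const_bound by blast

lemma Linf_integrable_sq: "f \<in> Linf M \<Longrightarrow> integrable M (\<lambda>x. (cmod (f x))\<^sup>2)"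
proof -
  assume f: "f \<in> Linf M"
  then obtain C where C: "C > 0" "AE x in M. cmod (f x) \<le> C" by (rule LinfE)
  have "AE x in M. norm ((cmod (f x))\<^sup>2) \<le> C\<^sup>2"
    using C(2) by eventually_elim (auto intro: power_mono)
  then show ?thesis using Linf_measurable[OF f] by (intro integrable_const_bound) auto
qed

lemma Linf_L2: "f \<in> Linf M \<Longrightarrow> f \<in> L2 M"
  using Linf_integrable_sq Linf_measurable by (auto simp: L2_def)

lemma mean_sq_mono:
  assumes "f \<in> Linf M" "g \<in> Linf M" "AE x in M. cmod (f x) \<le> cmod (g x)"
  shows "mean_sq M f \<le> mean_sq M g"
  unfolding mean_sq_def using assms(3)
  by (intro integral_mono_AE Linf_integrable_sq assms) (auto intro: power_mono)

lemma mean_sq_cong_AE: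
  assumes "f \<in> Linf M" "g \<in> Linf M" "AE x in M. f x = g x"
  shows "mean_sq M f = mean_sq M g"
  using assms(3) by (intro antisym mean_sq_mono assms) auto

lemma mean_sq_le:
  assumes "f \<in> Linf M" "AE x in M. cmod (f x) \<le> c"
  shows "mean_sq M f \<le> c\<^sup>2"
proof -
  have "AE x in M. cmod (f x) \<le> cmod (complex_of_real c)" using assms(2) by eventually_elim auto
  then have "mean_sq M f \<le> mean_sq M (\<lambda>_. complex_of_real c)"
    using assms by (intro mean_sq_mono) auto
  then show ?thesis by (simp add: mean_sq_def prob_space)
qed

text \<open>Serves as the triangle inequality for squared norms; the factors 2 accumulate into the
  constants of later estimates, and no square roots have to be handled.\<close>

lemma mean_sq_add_le:
  assumes "f \<in> Linf M" "g \<in> Linf M"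
  shows "mean_sq M (\<lambda>x. f x + g x) \<le> 2 * mean_sq M f + 2 * mean_sq M g"
proof -
  have "mean_sq M (\<lambda>x. f x + g x) \<le> (\<integral>x. 2 * (cmod (f x))\<^sup>2 + 2 * (cmod (g x))\<^sup>2 \<partial>M)"
    unfolding mean_sq_def
  proof (intro integral_mono)
    fix x
    have "(cmod (f x + g x))\<^sup>2 \<le> (cmod (f x) + cmod (g x))\<^sup>2"
      by (intro power_mono norm_triangle_ineq) auto
    also have "\<dots> \<le> 2 * (cmod (f x))\<^sup>2 + 2 * (cmod (g x))\<^sup>2"
      using sum_squares_bound[of "cmod (f x)" "cmod (g x)"] by (simp add: power2_sum)
    finally show "(cmod (f x + g x))\<^sup>2 \<le> 2 * (cmod (f x))\<^sup>2 + 2 * (cmod (g x))\<^sup>2" .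
  qed (use assms Linf_integrable_sq Linf_add in auto)
  also have "\<dots> = 2 * mean_sq M f + 2 * mean_sq M g"
    unfolding mean_sq_def using assms Linf_integrable_sq by simp
  finally show ?thesis .
qed

lemma mean_sq_mult_le:
  assumes "f \<in> Linf M" "g \<in> Linf M" "AE x in M. cmod (g x) \<le> C"
  shows "mean_sq M (\<lambda>x. g x * f x) \<le> C\<^sup>2 * mean_sq M f"
proof -
  have "AE x in M. cmod (g x * f x) \<le> cmod (complex_of_real C * f x)"
    using assms(3) by eventually_elim (auto simp: norm_mult intro: mult_right_mono order_trans)
  then have "mean_sq M (\<lambda>x. g x * f x) \<le> mean_sq M (\<lambda>x. complex_of_real C * f x)"
    using assms by (intro mean_sq_mono Linf_mult Linf_cmult)
  also have "\<dots> = C\<^sup>2 * mean_sq M f"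
    by (simp add: mean_sq_def norm_mult power_mult_distrib)
  finally show ?thesis .
qed

lemma mean_sq_weighted_le:
  assumes "\<And>k. k \<in> D \<Longrightarrow> f k \<in> Linf M" "\<And>k. k \<in> D \<Longrightarrow> 0 \<le> p k" "sum p D = (1::real)"
  shows "mean_sq M (\<lambda>x. \<Sum>k\<in>D. p k *\<^sub>R f k x) \<le> (\<Sum>k\<in>D. p k * mean_sq M (f k))"
proof -
  have "mean_sq M (\<lambda>x. \<Sum>k\<in>D. p k *\<^sub>R f k x) \<le> (\<integral>x. (\<Sum>k\<in>D. p k * (cmod (f k x))\<^sup>2) \<partial>M)"
    unfolding mean_sq_def using assms
    by (intro integral_mono norm_sum_weighted_sq_le Linf_integrable_sq Linf_sum Linf_scaleR
        Bochner_Integration.integrable_sum integrable_mult_right) auto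
  also have "\<dots> = (\<Sum>k\<in>D. p k * mean_sq M (f k))"
    unfolding mean_sq_def using assms
    by (subst Bochner_Integration.integral_sum)
       (auto intro!: Linf_integrable_sq integrable_mult_right sum.cong)
  finally show ?thesis .
qed

lemma mean_sq_avg_le:
  assumes F: "Folner F" and "\<And>g. f g \<in> Linf M"
  shows "mean_sq M (\<lambda>x. avg F N (\<lambda>g. f g x)) \<le> avg F N (\<lambda>g. mean_sq M (f g))"
proof -
  have "mean_sq M (\<lambda>x. \<Sum>g\<in>F N. (1 / real (card (F N))) *\<^sub>R f g x)
      \<le> (\<Sum>g\<in>F N. 1 / real (card (F N)) * mean_sq M (f g))"
    using FolnerD[OF F, of N] assms by (intro mean_sq_weighted_le) auto
  then show ?thesis
    by (simp add: avg_def scaleR_sum_right sum_distrib_left divide_inverse)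
qed

lemma mean_sq_eq_0:
  assumes "f \<in> Linf M" "mean_sq M f = 0"
  shows "AE x in M. f x = 0"
  using integral_nonneg_eq_0_iff_AE[OF Linf_integrable_sq[OF assms(1)]] assms(2)
  by (auto simp: mean_sq_def)

lemma parallelogram:
  assumes "f \<in> Linf M" "g \<in> Linf M"
  shows "mean_sq M (\<lambda>x. f x - g x) = 2 * mean_sq M f + 2 * mean_sq M g - 4 * mean_sq M (\<lambda>x. (f x + g x) / 2)"
proof -
  have "mean_sq M (\<lambda>x. f x - g x) + 4 * mean_sq M (\<lambda>x. (f x + g x) / 2)
      = (\<integral>x. (cmod (f x - g x))\<^sup>2 + 4 * (cmod ((f x + g x) / 2))\<^sup>2 \<partial>M)"
    unfolding mean_sq_def using assms
    by (subst Bochner_Integration.integral_add)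
       (auto intro!: Linf_integrable_sq[OF Linf_diff] integrable_mult_right Linf_integrable_sq[OF Linf_divide[OF Linf_add]] simp del: norm_divide norm_divide_numeral power_divide)
  also have "\<dots> = (\<integral>x. 2 * (cmod (f x))\<^sup>2 + 2 * (cmod (g x))\<^sup>2 \<partial>M)"
    by (intro Bochner_Integration.integral_cong refl)
       (simp add: norm_divide cmod_power2 power_divide, simp add: power2_eq_square algebra_simps)
  also have "\<dots> = 2 * mean_sq M f + 2 * mean_sq M g"
    unfolding mean_sq_def using assms by (simp add: Linf_integrable_sq)
  finally show ?thesis by simp
qed

lemma integral_norm_le:
  assumes "f \<in> Linf M" "mean_sq M f \<le> r\<^sup>2" "r > 0"
  shows "(\<integral>x. cmod (f x) \<partial>M) \<le> r"
proof -
  have "(\<integral>x. cmod (f x) \<partial>M) \<le> (\<integral>x. 1 / (2 * r) * (cmod (f x))\<^sup>2 + r / 2 \<partial>M)"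
  proof (rule integral_mono)
    fix x
    have "2 * cmod (f x) * r \<le> (cmod (f x))\<^sup>2 + r\<^sup>2" by (rule sum_squares_bound)
    then show "cmod (f x) \<le> 1 / (2 * r) * (cmod (f x))\<^sup>2 + r / 2"
      using \<open>r > 0\<close> by (simp add: field_simps power2_eq_square)
  qed (use assms Linf_integrable Linf_integrable_sq in auto)
  also have "\<dots> = 1 / (2 * r) * mean_sq M f + r / 2"
    unfolding mean_sq_def using assms Linf_integrable_sq by (simp add: prob_space)
  also have "\<dots> \<le> 1 / (2 * r) * r\<^sup>2 + r / 2"
    using assms by (intro add_mono mult_left_mono) auto
  also have "\<dots> = r" using \<open>r > 0\<close> by (simp add: power2_eq_square)
  finally show ?thesis .
qed

text \<open>Completeness as in Riesz-Fischer, with the addition that the limit keeps the essential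
  bound \<open>C\<close>: a fast subsequence converges almost everywhere, the bound passes to the
  pointwise limit, and dominated convergence gives convergence in mean square.\<close>

lemma bounded_Cauchy_converges:
  fixes f :: "nat \<Rightarrow> 'a \<Rightarrow> complex"
  assumes f: "\<And>n. f n \<in> borel_measurable M" and C: "\<And>n. AE x in M. cmod (f n x) \<le> C"
    and Cauchy: "\<And>e. e > 0 \<Longrightarrow> \<exists>N. \<forall>m\<ge>N. \<forall>n\<ge>N. mean_sq M (\<lambda>x. f m x - f n x) < e"
  obtains w where "w \<in> borel_measurable M" "AE x in M. cmod (w x) \<le> C"
    "(\<lambda>n. mean_sq M (\<lambda>x. f n x - w x)) \<longlonglongrightarrow> 0"
proof -
  have fL: "f n \<in> Linf M" for n using f C by (rule LinfI)
  have "\<exists>N. \<forall>m\<ge>N. \<forall>n\<ge>N. mean_sq M (\<lambda>x. f m x - f n x) < ((1/2) ^ i)\<^sup>2" for i :: nat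
    by (rule Cauchy) auto
  then obtain N0 where N0: "\<And>i m n. m \<ge> N0 i \<Longrightarrow> n \<ge> N0 i \<Longrightarrow> mean_sq M (\<lambda>x. f m x - f n x) < ((1/2) ^ i)\<^sup>2"
    by metis
  define r where "r i = (\<Sum>j\<le>i. N0 j) + i" for i
  have r_ge: "N0 i \<le> r i" "N0 i \<le> r (Suc i)" "i \<le> r i" for i
    unfolding r_def using member_le_sum[of i "{..i}" N0] by auto
  have r: "filterlim r at_top sequentially"
    using r_ge(3) by (intro filterlim_at_top_mono[OF filterlim_ident]) auto
  \<comment> \<open>On a probability space the mean square bound controls the first moment, so the
    successive differences have summable integrals and hence converge absolutely almost
    everywhere.\<close>
  have int_le: "(\<integral>x. cmod (f (r (Suc i)) x - f (r i) x) \<partial>M) \<le> (1/2) ^ i" for i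
    by (rule integral_norm_le) (use N0[OF r_ge(2) r_ge(1), of i] in \<open>auto intro!: Linf_diff fL\<close>)
  have "AE x in M. summable (\<lambda>i. f (r (Suc i)) x - f (r i) x)"
  proof -
    let ?d = "\<lambda>i x. ennreal (cmod (f (r (Suc i)) x - f (r i) x))"
    have "(\<integral>\<^sup>+x. (\<Sum>i. ?d i x) \<partial>M) = (\<Sum>i. \<integral>\<^sup>+x. ?d i x \<partial>M)"
      using f by (intro nn_integral_suminf) auto
    also have "\<dots> = (\<Sum>i. ennreal (\<integral>x. cmod (f (r (Suc i)) x - f (r i) x) \<partial>M))"
      by (subst nn_integral_eq_integral) (auto intro!: Linf_integrable integrable_norm Linf_diff fL)
    also have "\<dots> \<le> (\<Sum>i. ennreal ((1/2) ^ i))"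
      using int_le by (intro suminf_le ennreal_leI) auto
    also have "\<dots> = ennreal (\<Sum>i. (1/2) ^ i)"
      by (intro suminf_ennreal2) (auto intro: summable_geometric)
    also have "\<dots> < \<infinity>" by simp
    finally have "AE x in M. (\<Sum>i. ?d i x) \<noteq> \<infinity>"
      using f by (intro nn_integral_PInf_AE) auto
    then show ?thesis
    proof eventually_elim
      case (elim x)
      then have "summable (\<lambda>i. cmod (f (r (Suc i)) x - f (r i) x))"
        by (intro summable_suminf_not_top) auto
      then show ?case by (rule summable_norm_cancel)
    qed
  qed
  then have conv: "AE x in M. convergent (\<lambda>i. f (r i) x)"
  proof eventually_elim
    case (elim x)
    then have "(\<lambda>n. \<Sum>i<n. f (r (Suc i)) x - f (r i) x) \<longlonglongrightarrow> (\<Sum>i. f (r (Suc i)) x - f (r i) x)"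
      by (rule summable_LIMSEQ)
    then have "(\<lambda>n. f (r n) x - f (r 0) x) \<longlonglongrightarrow> (\<Sum>i. f (r (Suc i)) x - f (r i) x)"
      by (simp only: sum_lessThan_telescope[of "\<lambda>i. f (r i) x"])
    then have "(\<lambda>n. f (r n) x - f (r 0) x + f (r 0) x) \<longlonglongrightarrow> (\<Sum>i. f (r (Suc i)) x - f (r i) x) + f (r 0) x"
      by (intro tendsto_intros)
    then show ?case by (auto simp: convergent_def)
  qed
  define w where "w x = lim (\<lambda>i. f (r i) x)" for x
  have w [measurable]: "w \<in> borel_measurable M"
    unfolding w_def using f by (intro borel_measurable_lim_metric) auto
  have lim: "AE x in M. (\<lambda>i. f (r i) x) \<longlonglongrightarrow> w x"
    using conv by eventually_elim (simp add: w_def convergent_LIMSEQ_iff)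
  have C': "AE x in M. \<forall>n. cmod (f n x) \<le> C" using C by (simp add: AE_all_countable)
  have wC: "AE x in M. cmod (w x) \<le> C"
    using lim C' by eventually_elim (auto intro!: LIMSEQ_le_const2[OF tendsto_norm])
  have wL: "w \<in> Linf M" using w wC by (rule LinfI)
  have "(\<lambda>i. mean_sq M (\<lambda>x. f (r i) x - w x)) \<longlonglongrightarrow> (\<integral>x. 0 \<partial>M)"
    unfolding mean_sq_def
  proof (rule integral_dominated_convergence[where w = "\<lambda>_. (2 * C)\<^sup>2"])
    show "AE x in M. (\<lambda>i. (cmod (f (r i) x - w x))\<^sup>2) \<longlonglongrightarrow> 0"
      using lim
    proof eventually_elim
      case (elim x)
      then have "(\<lambda>i. (cmod (f (r i) x - w x))\<^sup>2) \<longlonglongrightarrow> (cmod (w x - w x))\<^sup>2"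
        by (intro tendsto_intros)
      then show ?case by simp
    qed
    show "AE x in M. norm ((cmod (f (r i) x - w x))\<^sup>2) \<le> (2 * C)\<^sup>2" for i
      using wC C[of "r i"]
    proof eventually_elim
      case (elim x)
      then have "cmod (f (r i) x - w x) \<le> 2 * C"
        using norm_triangle_ineq4[of "f (r i) x" "w x"] by simp
      then show ?case using power_mono[of "cmod (f (r i) x - w x)" "2 * C" 2] by simp
    qed
  qed (use f in auto)
  then have sub: "(\<lambda>i. mean_sq M (\<lambda>x. f (r i) x - w x)) \<longlonglongrightarrow> 0" by simp
  \<comment> \<open>The Cauchy property carries convergence from the subsequence to the whole
    sequence; two terms below \<open>e / 4\<close>, each doubled, stay below
    \<open>e\<close>.\<close>
  have "(\<lambda>n. mean_sq M (\<lambda>x. f n x - w x)) \<longlonglongrightarrow> 0"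
  proof (rule LIMSEQ_I)
    fix e :: real assume "e > 0"
    then obtain N where N: "\<And>m n. m \<ge> N \<Longrightarrow> n \<ge> N \<Longrightarrow> mean_sq M (\<lambda>x. f m x - f n x) < e / 4"
      using Cauchy[of "e / 4"] by auto
    obtain I where I: "\<And>i. i \<ge> I \<Longrightarrow> mean_sq M (\<lambda>x. f (r i) x - w x) < e / 4"
      using LIMSEQ_D[OF sub, of "e / 4"] \<open>e > 0\<close> by auto
    define i where "i = max I N"
    have i: "i \<ge> I" "r i \<ge> N" using r_ge(3)[of i] by (auto simp: i_def)
    have "mean_sq M (\<lambda>x. f n x - w x) < e" if "n \<ge> N" for n
    proof -
      have "mean_sq M (\<lambda>x. (f n x - f (r i) x) + (f (r i) x - w x))
          \<le> 2 * mean_sq M (\<lambda>x. f n x - f (r i) x) + 2 * mean_sq M (\<lambda>x. f (r i) x - w x)"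
        using fL wL by (intro mean_sq_add_le Linf_diff)
      also have "\<dots> < e" using N[OF that i(2)] I[OF i(1)] by simp
      finally show ?thesis by simp
    qed
    then show "\<exists>N. \<forall>n\<ge>N. norm (mean_sq M (\<lambda>x. f n x - w x) - 0) < e" by auto
  qed
  then show ?thesis using that[OF w wC] by blast
qed

end


section \<open>The mean ergodic theorem\<close>

locale mp_system = prob_space M for M :: "'x measure" +
  fixes T :: "'g::{ab_group_add, countable} \<Rightarrow> 'x \<Rightarrow> 'x"
  assumes mp: "mp_action M T"
begin

lemma action_measurable [measurable]: "T g \<in> measurable M M"
  and action_distr: "distr M M (T g) = M"
  and action_bij: "bij_betw (T g) (space M) (space M)"
  using mp by (auto simp: mp_action_def)

lemma action_space: "x \<in> space M \<Longrightarrow> T g x \<in> space M"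
  using action_bij by (auto simp: bij_betw_def)

lemma action_0: "x \<in> space M \<Longrightarrow> T 0 x = x"
  and action_add: "x \<in> space M \<Longrightarrow> T (g + h) x = T g (T h x)"
  using mp by (auto simp: mp_action_def)

lemma inv_action: "x \<in> space M \<Longrightarrow> inv_into (space M) (T g) x = T (- g) x"
proof (rule inv_into_f_eq)
  show "inj_on (T g) (space M)" using action_bij by (auto simp: bij_betw_def)
  assume x: "x \<in> space M"
  show "T (- g) x \<in> space M" using x by (rule action_space)
  show "T g (T (- g) x) = x" using action_add[OF x, of g "- g"] action_0[OF x] by simp
qed

lemma koopman_eq: "x \<in> space M \<Longrightarrow> koopman M T g f x = f (T (- g) x)"
  by (simp add: koopman_def inv_action)

lemma koopman_add:
  assumes "x \<in> space M"
  shows "koopman M T g (koopman M T h f) x = koopman M T (g + h) f x"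
proof -
  have "T (- h) (T (- g) x) = T (- (g + h)) x"
    using action_add[OF assms, of "- h" "- g"] by (simp add: algebra_simps)
  then show ?thesis using assms action_space by (simp add: koopman_eq)
qed

lemma koopman_measurable [measurable (raw)]:
  assumes "f \<in> borel_measurable M"
  shows "koopman M T g f \<in> borel_measurable M"
proof -
  have "(\<lambda>x. f (T (- g) x)) \<in> borel_measurable M" using assms by measurable
  then show ?thesis by (subst measurable_cong[OF koopman_eq])
qed

lemma AE_action: "(AE x in M. P x) \<Longrightarrow> AE x in M. P (T g x)"
  using AE_distrD[OF action_measurable, of P g] by (simp only: action_distr)

lemma AE_koopman:
  assumes "AE x in M. P (f x)"
  shows "AE x in M. P (koopman M T g f x)"
  using AE_action[OF assms, of "- g"] AE_space by eventually_elim (simp add: koopman_eq)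

lemma koopman_Linf:
  assumes "f \<in> Linf M"
  shows "koopman M T g f \<in> Linf M"
proof -
  obtain C where "AE x in M. cmod (f x) \<le> C" using LinfE[OF assms] by blast
  then show ?thesis
    using assms AE_koopman[of "\<lambda>z. cmod z \<le> C"] by (intro LinfI[OF koopman_measurable] Linf_measurable)
qed

lemma integral_koopman:
  fixes h :: "complex \<Rightarrow> 'b::{banach, second_countable_topology}"
  assumes [measurable]: "f \<in> borel_measurable M" "h \<in> borel_measurable borel"
  shows "(\<integral>x. h (koopman M T g f x) \<partial>M) = (\<integral>x. h (f x) \<partial>M)"
proof -
  have "(\<integral>x. h (koopman M T g f x) \<partial>M) = (\<integral>x. h (f (T (- g) x)) \<partial>M)"
    by (intro Bochner_Integration.integral_cong) (auto simp: koopman_eq)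
  also have "\<dots> = (\<integral>x. h (f x) \<partial>distr M M (T (- g)))"
    by (subst integral_distr) auto
  finally show ?thesis by (simp add: action_distr)
qed

lemma mean_sq_koopman: "f \<in> borel_measurable M \<Longrightarrow> mean_sq M (koopman M T g f) = mean_sq M f"
  unfolding mean_sq_def by (rule integral_koopman) auto

lemma koopman_bound:
  assumes "AE x in M. cmod (f x) \<le> C"
  shows "AE x in M. \<forall>g. cmod (koopman M T g f x) \<le> C"
  using AE_koopman[of "\<lambda>z. cmod z \<le> C", OF assms] by (simp add: AE_all_countable)

lemma inner_koopman:
  assumes "f \<in> Linf M" "h \<in> Linf M"
  shows "L2_inner M (koopman M T g f) (koopman M T k h) = L2_inner M (koopman M T (g - k) f) h"
proof -
  note [measurable] = assms[THEN Linf_measurable]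
  have "L2_inner M (koopman M T (g - k) f) h = (\<integral>x. f (T (k - g) x) * cnj (h x) \<partial>distr M M (T (- k)))"
    unfolding L2_inner_def action_distr by (intro Bochner_Integration.integral_cong) (auto simp: koopman_eq)
  also have "\<dots> = (\<integral>x. f (T (k - g) (T (- k) x)) * cnj (h (T (- k) x)) \<partial>M)"
    by (subst integral_distr) (auto simp: borel_measurable_complex_iff)
  also have "\<dots> = L2_inner M (koopman M T g f) (koopman M T k h)"
    unfolding L2_inner_def
    by (intro Bochner_Integration.integral_cong) (auto simp: koopman_eq simp flip: action_add)
  finally show ?thesis by simp
qed

text \<open>The averages themselves form an asymptotically norm-minimal sequence in the convex hull of
  the orbit, so the parallelogram law makes them a Cauchy sequence.\<close>

theorem mean_ergodic:
  assumes F: "Folner F" and f: "f \<in> Linf M" and \<gamma>: "\<gamma> \<in> pontryagin_dual"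
  obtains w where "w \<in> Linf M" "\<And>k. AE x in M. koopman M T k w x = \<gamma> k * w x"
    "(\<lambda>N. mean_sq M (\<lambda>x. avg F N (\<lambda>g. cnj (\<gamma> g) * koopman M T g f x) - w x)) \<longlonglongrightarrow> 0"
proof -
  \<comment> \<open>Twisting by the conjugate character gives again an isometric representation,
    whose invariant functions are the eigenfunctions with eigenvalue \<open>\<gamma>\<close>. The
    theorem is thus the ordinary one for \<open>V\<close>.\<close>
  define V where "V g f x = cnj (\<gamma> g) * koopman M T g f x" for g f x
  define W where "W D p x = (\<Sum>k\<in>D. p k *\<^sub>R V k f x)" for D and p :: "'g \<Rightarrow> real" and x
  define A where "A N x = avg F N (\<lambda>g. V g f x)" for N x
  have \<gamma>1: "cmod (\<gamma> g) = 1" "\<gamma> (g + h) = \<gamma> g * \<gamma> h" for g h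
    using \<gamma> by (auto simp: pontryagin_dual_def)
  have VL: "V g u \<in> Linf M" if "u \<in> Linf M" for g u
    unfolding V_def by (intro Linf_cmult koopman_Linf that)
  have V_add: "V g (V h u) x = V (g + h) u x" if "x \<in> space M" for g h u x
    using that koopman_add[OF that, of g h u]
    by (simp add: V_def \<gamma>1 koopman_eq action_space)
  have V_sq: "mean_sq M (V g u) = mean_sq M u" if "u \<in> Linf M" for g u
  proof -
    have "mean_sq M (V g u) = mean_sq M (koopman M T g u)"
      unfolding V_def by (intro mean_sq_cong) (simp add: norm_mult \<gamma>1)
    then show ?thesis using mean_sq_koopman[OF Linf_measurable[OF that]] by simp
  qed
  obtain C where C: "C > 0" "AE x in M. cmod (f x) \<le> C" using LinfE[OF f] .
  have Vb: "AE x in M. \<forall>g. cmod (V g f x) \<le> C"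
    using koopman_bound[OF C(2)] by eventually_elim (simp add: V_def norm_mult \<gamma>1)
  have AL: "A N \<in> Linf M" for N
    unfolding A_def by (intro Linf_avg VL f)
  have Ab: "AE x in M. cmod (A N x) \<le> C" for N
    using Vb unfolding A_def by eventually_elim (intro norm_avg_le[OF F], auto)
  define H :: "('g set \<times> ('g \<Rightarrow> real)) set" where "H = {(D, p). finite D \<and> (\<forall>k\<in>D. 0 \<le> p k) \<and> sum p D = 1}"
  have WL: "W D p \<in> Linf M" for D p
    unfolding W_def by (intro Linf_sum Linf_scaleR VL f)
  have A_W: "A N = W (F N) (\<lambda>_. 1 / real (card (F N)))" for N
    by (auto simp: A_def W_def avg_def scaleR_sum_right divide_inverse)
  have H_A: "(F N, \<lambda>_. 1 / real (card (F N))) \<in> H" for N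
    using FolnerD[OF F, of N] by (auto simp: H_def)
  define d where "d = Inf ((\<lambda>(D, p). mean_sq M (W D p)) ` H)"
  have bdd: "bdd_below ((\<lambda>(D, p). mean_sq M (W D p)) ` H)"
    by (intro bdd_belowI[of _ 0]) auto
  have d_le: "d \<le> mean_sq M (W D p)" if "(D, p) \<in> H" for D p
    unfolding d_def using that bdd by (intro cInf_lower) auto
  have mid: "d \<le> mean_sq M (\<lambda>x. (A m x + A n x) / 2)" for m n
  proof -
    let ?p = "\<lambda>k. (indicator (F m) k / real (card (F m)) + indicator (F n) k / real (card (F n))) / 2 :: real"
    have fin: "finite (F m \<union> F n)" using FolnerD(1)[OF F] by auto
    note split = sum_indicator_scaleR_eq_avg[of F m, OF _ fin] sum_indicator_scaleR_eq_avg[of F n, OF _ fin]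
    have "W (F m \<union> F n) ?p = (\<lambda>x. (A m x + A n x) / 2)"
    proof
      fix x
      have "W (F m \<union> F n) ?p x = (1/2) *\<^sub>R ((\<Sum>k\<in>F m \<union> F n. (indicator (F m) k / real (card (F m))) *\<^sub>R V k f x)
         + (\<Sum>k\<in>F m \<union> F n. (indicator (F n) k / real (card (F n))) *\<^sub>R V k f x))"
        unfolding W_def sum.distrib[symmetric] scaleR_sum_right
        by (intro sum.cong refl) (simp add: scaleR_left_distrib[symmetric])
      then show "W (F m \<union> F n) ?p x = (A m x + A n x) / 2"
        unfolding split(1)[OF Un_upper1] split(2)[OF Un_upper2] A_def by (simp add: scaleR_conv_of_real)
    qed
    moreover have "(F m \<union> F n, ?p) \<in> H"
      using split(1)[of "\<lambda>_. 1::real"] split(2)[of "\<lambda>_. 1::real"] fin avg_const[OF F, of _ "1::real"]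
      by (auto simp: H_def sum.distrib simp flip: sum_divide_distrib)
    ultimately show ?thesis using d_le by metis
  qed
  have shift: "AE x in M. cmod (avg F N (\<lambda>g. V (g + k) f x) - A N x) \<le> C * folner_ratio F k N" for N k
    using Vb unfolding A_def by eventually_elim (intro avg_shift[OF F], auto)
  have lim_d: "\<exists>N0. \<forall>N\<ge>N0. mean_sq M (A N) < d + e" if "e > 0" for e
  proof -
    have "H \<noteq> {}" using H_A by blast
    then have "\<exists>z\<in>(\<lambda>(D, p). mean_sq M (W D p)) ` H. z < d + e"
      using cInf_less_iff[of "(\<lambda>(D, p). mean_sq M (W D p)) ` H" "d + e"] bdd that by (auto simp: d_def)
    then obtain D p where Dp: "(D, p) \<in> H" "mean_sq M (W D p) < d + e" by auto
    then have D: "finite D" "\<And>k. k \<in> D \<Longrightarrow> 0 \<le> p k" "sum p D = 1" by (auto simp: H_def)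
    define B where "B N x = avg F N (\<lambda>g. V g (W D p) x)" for N x
    define r where "r N = C * (\<Sum>k\<in>D. p k * folner_ratio F k N)" for N
    have r0: "r N \<ge> 0" for N
      unfolding r_def using C D folner_ratio_nonneg by (intro mult_nonneg_nonneg sum_nonneg) auto
    have "r \<longlonglongrightarrow> C * (\<Sum>k\<in>D. p k * 0)"
      unfolding r_def by (intro tendsto_intros folner_ratio_tendsto F)
    then have r_lim: "r \<longlonglongrightarrow> 0" by simp
    have BL: "B N \<in> Linf M" for N unfolding B_def by (intro Linf_avg VL WL)
    have "mean_sq M (B N) \<le> avg F N (\<lambda>g. mean_sq M (V g (W D p)))" for N
      unfolding B_def by (intro mean_sq_avg_le[OF F] VL WL)
    then have B_le: "mean_sq M (B N) \<le> mean_sq M (W D p)" for N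
      using WL by (simp add: V_sq avg_const[OF F])
    have AB: "AE x in M. cmod (A N x) \<le> cmod (B N x) + r N" for N
    proof -
      have "AE x in M. \<forall>k\<in>D. cmod (avg F N (\<lambda>g. V (g + k) f x) - A N x) \<le> C * folner_ratio F k N"
        using shift D(1) by (simp add: AE_finite_all)
      then show ?thesis using AE_space
      proof eventually_elim
        case (elim x)
        have "V g (W D p) x = (\<Sum>k\<in>D. p k *\<^sub>R V (g + k) f x)" for g
        proof -
          have "V g (W D p) x = (\<Sum>k\<in>D. p k *\<^sub>R V g (V k f) x)"
            using elim(2) by (simp add: V_def[of g] W_def koopman_eq sum_distrib_left)
          then show ?thesis using V_add[OF elim(2)] by simp
        qed
        then have "B N x = (\<Sum>k\<in>D. p k *\<^sub>R avg F N (\<lambda>g. V (g + k) f x))"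
          by (simp add: B_def avg_def sum.swap[of _ D] scaleR_sum_right mult.commute[of "p _"])
        moreover have "A N x = (\<Sum>k\<in>D. p k *\<^sub>R A N x)"
          using D(3) by (simp flip: scaleR_sum_left)
        ultimately have "A N x - B N x = (\<Sum>k\<in>D. p k *\<^sub>R (A N x - avg F N (\<lambda>g. V (g + k) f x)))"
          by (simp add: scaleR_diff_right sum_subtractf)
        also have "cmod \<dots> \<le> (\<Sum>k\<in>D. p k * (C * folner_ratio F k N))"
          using elim(1) D(2) by (intro sum_norm_le) (auto intro!: mult_left_mono simp: norm_minus_commute)
        finally have "cmod (A N x - B N x) \<le> r N"
          by (simp add: r_def sum_distrib_left mult_ac)
        then show ?case using norm_triangle_sub[of "A N x" "B N x"] by linarith
      qed
    qed
    have le: "mean_sq M (A N) \<le> mean_sq M (W D p) + (2 * C * r N)" for N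
    proof -
      have "mean_sq M (A N) \<le> (\<integral>x. (cmod (B N x))\<^sup>2 + 2 * C * r N \<partial>M)"
        unfolding mean_sq_def
      proof (intro integral_mono_AE)
        show "AE x in M. (cmod (A N x))\<^sup>2 \<le> (cmod (B N x))\<^sup>2 + 2 * C * r N"
          using AB[of N] Ab[of N]
        proof eventually_elim
          case (elim x)
          show ?case
          proof (cases "cmod (A N x) \<le> cmod (B N x)")
            case True
            then have "(cmod (A N x))\<^sup>2 \<le> (cmod (B N x))\<^sup>2" by (intro power_mono) auto
            then show ?thesis using C r0[of N] by (simp add: add_increasing2)
          next
            case False
            \<comment> \<open>In this case both moduli are at most \<open>C\<close> and they differ
              by at most \<open>r N\<close>, which gives the bound \<open>2 * C * r N\<close> for
              the difference of squares.\<close>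
            have "(cmod (A N x))\<^sup>2 - (cmod (B N x))\<^sup>2 = (cmod (A N x) - cmod (B N x)) * (cmod (A N x) + cmod (B N x))"
              by (simp add: power2_eq_square algebra_simps)
            also have "\<dots> \<le> r N * (2 * C)"
              using False elim by (intro mult_mono) auto
            finally show ?thesis by (simp add: mult_ac)
          qed
        qed
      qed (use Linf_integrable_sq[OF AL] Linf_integrable_sq[OF BL] in auto)
      also have "\<dots> = mean_sq M (B N) + 2 * C * r N"
        using Linf_integrable_sq[OF BL] by (simp add: mean_sq_def prob_space)
      finally show ?thesis using B_le[of N] by simp
    qed
    have "(\<lambda>N. mean_sq M (W D p) + 2 * C * r N) \<longlonglongrightarrow> mean_sq M (W D p) + 2 * C * 0"
      by (intro tendsto_intros r_lim)
    then have "\<forall>\<^sub>F N in sequentially. mean_sq M (W D p) + 2 * C * r N < d + e"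
      by (rule order_tendstoD) (use Dp in auto)
    then show ?thesis using le unfolding eventually_sequentially by (meson le_less_trans)
  qed
  obtain w where w: "w \<in> borel_measurable M" "AE x in M. cmod (w x) \<le> C"
    "(\<lambda>n. mean_sq M (\<lambda>x. A n x - w x)) \<longlonglongrightarrow> 0"
  proof (rule bounded_Cauchy_converges[of A C])
    show "A n \<in> borel_measurable M" "AE x in M. cmod (A n x) \<le> C" for n
      using Linf_measurable[OF AL] Ab by auto
    fix e :: real assume "e > 0"
    then obtain N0 where N0: "\<And>N. N \<ge> N0 \<Longrightarrow> mean_sq M (A N) < d + e / 4"
      using lim_d[of "e / 4"] by auto
    \<comment> \<open>Parallelogram law: twice two quantities below \<open>d + e / 4\<close>, minus
      four times a quantity at least \<open>d\<close>, is below \<open>e\<close>.\<close>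
    have "mean_sq M (\<lambda>x. A m x - A n x) < e" if "m \<ge> N0" "n \<ge> N0" for m n
      unfolding parallelogram[OF AL AL] using N0[OF that(1)] N0[OF that(2)] mid[of m n] by simp
    then show "\<exists>N. \<forall>m\<ge>N. \<forall>n\<ge>N. mean_sq M (\<lambda>x. A m x - A n x) < e" by blast
  qed auto
  have wL: "w \<in> Linf M" using w by (intro LinfI)
  have "AE x in M. koopman M T k w x = \<gamma> k * w x" for k
  proof -
    have "mean_sq M (\<lambda>x. V k w x - w x) \<le> 0"
    proof (rule LIMSEQ_le_const)
      show "(\<lambda>N. 2 * (2 * mean_sq M (\<lambda>x. A N x - w x) + 2 * (C * folner_ratio F k N)\<^sup>2)
          + 2 * mean_sq M (\<lambda>x. A N x - w x)) \<longlonglongrightarrow> 0"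
        by (rule tendsto_eq_intros w(3) folner_ratio_tendsto[OF F] refl | simp)+
      have "mean_sq M (\<lambda>x. V k w x - w x) \<le> 2 * (2 * mean_sq M (\<lambda>x. A N x - w x) + 2 * (C * folner_ratio F k N)\<^sup>2)
          + 2 * mean_sq M (\<lambda>x. A N x - w x)" for N
      proof -
        have 1: "mean_sq M (V k (\<lambda>x. A N x - w x)) = mean_sq M (\<lambda>x. A N x - w x)"
          by (rule V_sq[OF Linf_diff[OF AL wL]])
        have 2: "AE x in M. cmod (V k (A N) x - A N x) \<le> C * folner_ratio F k N"
          using shift[of N k] AE_space
        proof eventually_elim
          case (elim x)
          have "V k (A N) x = avg F N (\<lambda>g. V k (V g f) x)"
            using elim(2) by (simp add: V_def[of k] A_def koopman_eq avg_mult_left)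
          also have "\<dots> = avg F N (\<lambda>g. V (g + k) f x)"
            using V_add[OF elim(2)] by (simp add: add.commute)
          finally show ?case using elim(1) by simp
        qed
        have eq: "mean_sq M (\<lambda>x. V k w x - w x) = mean_sq M (\<lambda>x. ((-1) * V k (\<lambda>x. A N x - w x) x + (V k (A N) x - A N x)) + (A N x - w x))"
          by (intro mean_sq_cong arg_cong[where f = cmod])
             (simp add: V_def koopman_eq algebra_simps)
        have "mean_sq M (\<lambda>x. (-1) * V k (\<lambda>x. A N x - w x) x + (V k (A N) x - A N x))
            \<le> 2 * mean_sq M (\<lambda>x. (-1) * V k (\<lambda>x. A N x - w x) x) + 2 * mean_sq M (\<lambda>x. V k (A N) x - A N x)"
          by (intro mean_sq_add_le Linf_intros VL AL wL)
        also have "mean_sq M (\<lambda>x. (-1) * V k (\<lambda>x. A N x - w x) x) = mean_sq M (\<lambda>x. A N x - w x)"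
          using 1 by (simp add: mean_sq_def)
        also have "mean_sq M (\<lambda>x. V k (A N) x - A N x) \<le> (C * folner_ratio F k N)\<^sup>2"
          by (intro mean_sq_le 2 Linf_intros VL AL)
        finally have "mean_sq M (\<lambda>x. (-1) * V k (\<lambda>x. A N x - w x) x + (V k (A N) x - A N x))
          \<le> 2 * mean_sq M (\<lambda>x. A N x - w x) + 2 * (C * folner_ratio F k N)\<^sup>2" by simp
        moreover have "mean_sq M (\<lambda>x. V k w x - w x) \<le> 2 * mean_sq M (\<lambda>x. (-1) * V k (\<lambda>x. A N x - w x) x + (V k (A N) x - A N x)) + 2 * mean_sq M (\<lambda>x. A N x - w x)"
          unfolding eq by (intro mean_sq_add_le Linf_intros VL AL wL)
        moreover have "y \<le> b \<Longrightarrow> x \<le> 2 * y + 2 * z \<Longrightarrow> x \<le> 2 * b + 2 * z" for x y z b :: real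
          by simp
        ultimately show ?thesis by blast
      qed
      then show "\<exists>N. \<forall>n\<ge>N. mean_sq M (\<lambda>x. V k w x - w x) \<le> 2 * (2 * mean_sq M (\<lambda>x. A n x - w x) + 2 * (C * folner_ratio F k n)\<^sup>2)
          + 2 * mean_sq M (\<lambda>x. A n x - w x)" by blast
    qed
    then have "mean_sq M (\<lambda>x. V k w x - w x) = 0" using mean_sq_nonneg by (metis antisym)
    then have "AE x in M. V k w x - w x = 0"
      by (intro mean_sq_eq_0 Linf_diff VL wL)
    then show ?thesis
    proof eventually_elim
      case (elim x)
      have "\<gamma> k * cnj (\<gamma> k) = 1" using \<gamma>1(1)[of k] by (simp add: complex_norm_square[symmetric])
      then have "\<gamma> k * V k w x = koopman M T k w x"
        unfolding V_def by (simp flip: mult.assoc)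
      then show ?case using elim by simp
    qed
  qed
  then show ?thesis using that[OF wL] w(3) by (simp add: A_def V_def)
qed

end

text \<open>Reduces equality of real functions to countably many level sets, so that almost
  everywhere statements about the levels can be combined.\<close>

lemma eq_if_same_rats_above:
  fixes a b :: real
  assumes "\<And>q::rat. a < of_rat q \<longleftrightarrow> b < of_rat q"
  shows "a = b"
  using assms of_rat_dense[of a b] of_rat_dense[of b a] by (meson less_asym linorder_neqE_linordered_idom)

section \<open>Conditional expectation onto the invariant sets\<close>

context prob_space
begin

lemma L2_inner_cong_AE:
  assumes "f \<in> Linf M" "g \<in> Linf M" "AE x in M. f x = f' x" "AE x in M. g x = g' x"
    and "f' \<in> Linf M" "g' \<in> Linf M"
  shows "L2_inner M f g = L2_inner M f' g'"
  unfolding L2_inner_def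
  by (rule integral_cong_AE)
     (use assms in \<open>auto intro!: Linf_measurable[OF Linf_mult] Linf_cnj elim: AE_mp\<close>)

lemma L2_inner_avg_left:
  assumes "\<And>g. f g \<in> Linf M" "h \<in> Linf M"
  shows "L2_inner M (\<lambda>x. avg F N (\<lambda>g. f g x)) h = avg F N (\<lambda>g. L2_inner M (f g) h)"
proof -
  have "(\<lambda>x. avg F N (\<lambda>g. f g x) * cnj (h x)) = (\<lambda>x. (\<Sum>g\<in>F N. f g x * cnj (h x)) /\<^sub>R real (card (F N)))"
    by (auto simp: avg_def sum_distrib_right)
  then show ?thesis
    unfolding L2_inner_def avg_def
    by (simp add: Linf_integrable Linf_mult Linf_cnj assms)
qed

lemma mean_sq_diff:
  assumes "f \<in> Linf M" "g \<in> Linf M"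
  shows "mean_sq M (\<lambda>x. f x - g x) = mean_sq M f + mean_sq M g - 2 * Re (L2_inner M f g)"
proof -
  have "mean_sq M (\<lambda>x. f x - g x) = (\<integral>x. (cmod (f x))\<^sup>2 + (cmod (g x))\<^sup>2 - 2 * Re (f x * cnj (g x)) \<partial>M)"
    unfolding mean_sq_def
    by (intro Bochner_Integration.integral_cong refl)
       (simp add: cmod_power2, simp add: power2_eq_square algebra_simps)
  also have "\<dots> = mean_sq M f + mean_sq M g - 2 * Re (L2_inner M f g)"
    unfolding mean_sq_def L2_inner_def using assms
    by (simp add: Linf_integrable_sq Linf_integrable Linf_mult Linf_cnj del: times_complex.sel complex_cnj)
  finally show ?thesis .
qed

lemma complex_cond_exp_Linf:
  assumes F: "subalgebra M F" and f: "f \<in> Linf M"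
  shows "complex_cond_exp M F f \<in> Linf M"
proof -
  interpret finite_measure_subalgebra M F by unfold_locales (rule F)
  obtain C where C: "AE x in M. cmod (f x) \<le> C" using LinfE[OF f] by blast
  have *: "AE x in M. \<bar>real_cond_exp M F u x\<bar> \<le> C"
    if "integrable M u" "AE x in M. \<bar>u x\<bar> \<le> C" for u
  proof -
    have "AE x in M. u x \<le> C" "AE x in M. - C \<le> u x" using that(2) by (eventually_elim, auto)+
    then have "AE x in M. real_cond_exp M F u x \<le> C" "AE x in M. - C \<le> real_cond_exp M F u x"
      using real_cond_exp_le_c[OF that(1)] real_cond_exp_ge_c[OF that(1)] by auto
    then show ?thesis by eventually_elim auto
  qed
  have "AE x in M. \<bar>Re (f x)\<bar> \<le> C" "AE x in M. \<bar>Im (f x)\<bar> \<le> C"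
    using C by (eventually_elim, metis abs_Re_le_cmod abs_Im_le_cmod order_trans)+
  then have "AE x in M. \<bar>real_cond_exp M F (\<lambda>y. Re (f y)) x\<bar> \<le> C" "AE x in M. \<bar>real_cond_exp M F (\<lambda>y. Im (f y)) x\<bar> \<le> C"
    using *[of "\<lambda>y. Re (f y)"] *[of "\<lambda>y. Im (f y)"] Linf_integrable[OF f] by auto
  then have "AE x in M. cmod (complex_cond_exp M F f x) \<le> C + C"
    by eventually_elim (auto simp: complex_cond_exp_def intro!: order_trans[OF cmod_le])
  moreover have "complex_cond_exp M F f \<in> borel_measurable M"
    using complex_cond_exp_L2(2)[OF F Linf_L2[OF f]] by (simp add: L2_def)
  ultimately show ?thesis by (intro LinfI)
qed

end

context mp_system
begin

text \<open>Turns null symmetric differences with image sets into pointwise statements about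
  \<open>T (- g)\<close>, which combine directly with the formula for
  \<open>koopman\<close>.\<close>

lemma invariant_sets_iff:
  assumes A [measurable]: "A \<in> sets M"
  shows "A \<in> invariant_sets M T H \<longleftrightarrow> (\<forall>g\<in>H. AE x in M. x \<in> A \<longleftrightarrow> T (- g) x \<in> A)"
proof -
  have "measure M (sym_diff A (T g ` A)) = 0 \<longleftrightarrow> (AE x in M. x \<in> A \<longleftrightarrow> T (- g) x \<in> A)" for g
  proof -
    have "T g ` A = {x \<in> space M. T (- g) x \<in> A}"
    proof (intro equalityI subsetI)
      fix x assume "x \<in> T g ` A"
      then obtain y where "x = T g y" "y \<in> A" by auto
      moreover from this have "y \<in> space M" using sets.sets_into_space[OF A] by auto
      ultimately show "x \<in> {x \<in> space M. T (- g) x \<in> A}"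
        using action_add[of y "- g" g] by (auto simp: action_0 action_space)
    next
      fix x assume x: "x \<in> {x \<in> space M. T (- g) x \<in> A}"
      then have "x = T g (T (- g) x)" using action_add[of x g "- g"] by (auto simp: action_0)
      then show "x \<in> T g ` A" using x by blast
    qed
    moreover have "{x \<in> space M. T (- g) x \<in> A} \<in> sets M" by measurable
    ultimately have m: "T g ` A \<in> sets M" "T g ` A = {x \<in> space M. T (- g) x \<in> A}" by auto
    have "measure M (sym_diff A (T g ` A)) = 0 \<longleftrightarrow> (AE x in M. x \<notin> sym_diff A (T g ` A))"
      using m(1) by (intro prob_eq_0) auto
    also have "\<dots> \<longleftrightarrow> (AE x in M. x \<in> A \<longleftrightarrow> T (- g) x \<in> A)"
      by (rule AE_cong) (auto simp: m(2))
    finally show ?thesis .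
  qed
  then show ?thesis by (simp add: invariant_sets_def)
qed

lemma invariant_set_vimage:
  assumes w: "w \<in> borel_measurable M" and inv: "\<And>g. g \<in> H \<Longrightarrow> AE x in M. koopman M T g w x = w x"
    and B: "B \<in> sets borel"
  shows "{x \<in> space M. w x \<in> B} \<in> invariant_sets M T H"
proof -
  have m: "{x \<in> space M. w x \<in> B} \<in> sets M" using w B by measurable
  have "AE x in M. x \<in> {x \<in> space M. w x \<in> B} \<longleftrightarrow> T (- g) x \<in> {x \<in> space M. w x \<in> B}" if "g \<in> H" for g
    using inv[OF that] AE_space by eventually_elim (auto simp: koopman_eq action_space)
  then show ?thesis using invariant_sets_iff[OF m] by blast
qed

lemma inv_algebra_measurableI:
  assumes w: "w \<in> borel_measurable M" and inv: "\<And>g. AE x in M. koopman M T g w x = w x"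
  shows "w \<in> borel_measurable (inv_algebra M T)"
proof (rule measurableI)
  have sub: "invariant_sets M T UNIV \<subseteq> Pow (space M)"
    by (auto simp: invariant_sets_def dest: sets.sets_into_space)
  fix B :: "complex set" assume B: "B \<in> sets borel"
  have "w -` B \<inter> space (inv_algebra M T) = {x \<in> space M. w x \<in> B}"
    using sub by (auto simp: inv_algebra_def)
  also have "\<dots> \<in> invariant_sets M T UNIV"
    using invariant_set_vimage[OF w inv B] by blast
  finally show "w -` B \<inter> space (inv_algebra M T) \<in> sets (inv_algebra M T)"
    using sub by (auto simp: inv_algebra_def)
qed auto

text \<open>The algebra is only generated by the almost invariant sets; induction over the
  generation shows that nothing else was added, countable unions being harmless for null
  sets.\<close>

lemma AE_invariant_set:
  assumes "A \<in> sets (inv_algebra M T)"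
  shows "AE x in M. x \<in> A \<longleftrightarrow> T g x \<in> A"
proof -
  have sub: "invariant_sets M T UNIV \<subseteq> Pow (space M)"
    by (auto simp: invariant_sets_def dest: sets.sets_into_space)
  have "A \<in> sigma_sets (space M) (invariant_sets M T UNIV)"
    using assms sub by (simp add: inv_algebra_def)
  then show ?thesis
  proof induction
    case (Basic A)
    then have "A \<in> sets M" by (simp add: invariant_sets_def)
    then show ?case using Basic invariant_sets_iff[of A UNIV] by (metis UNIV_I minus_minus)
  next
    case (Compl A)
    from Compl.IH AE_space show ?case by eventually_elim (auto simp: action_space)
  next
    case (Union A)
    then have "AE x in M. \<forall>i. x \<in> A i \<longleftrightarrow> T g x \<in> A i" by (simp add: AE_all_countable)
    then show ?case by eventually_elim auto
  qed auto
qed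

lemma inv_algebra_measurableD:
  assumes h: "h \<in> borel_measurable (inv_algebra M T)"
  shows "AE x in M. koopman M T g h x = h x"
proof -
  have sp: "space (inv_algebra M T) = space M"
    using subalgebra_inv_algebra[of M T] by (simp add: subalgebra_def)
  have *: "AE x in M. u (T (- g) x) = u x" if [measurable]: "u \<in> borel_measurable (inv_algebra M T)" for u :: "'x \<Rightarrow> real"
  proof -
    have "AE x in M. \<forall>q::rat. x \<in> {x \<in> space M. u x < of_rat q} \<longleftrightarrow> T (- g) x \<in> {x \<in> space M. u x < of_rat q}"
      unfolding AE_all_countable
    proof
      fix q :: rat
      have "{x \<in> space (inv_algebra M T). u x < of_rat q} \<in> sets (inv_algebra M T)" by measurable
      then show "AE x in M. x \<in> {x \<in> space M. u x < of_rat q} \<longleftrightarrow> T (- g) x \<in> {x \<in> space M. u x < of_rat q}"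
        by (intro AE_invariant_set) (simp only: sp)
    qed
    then show ?thesis using AE_space
      by eventually_elim (rule eq_if_same_rats_above, auto simp: action_space)
  qed
  have "(\<lambda>x. Re (h x)) \<in> borel_measurable (inv_algebra M T)" "(\<lambda>x. Im (h x)) \<in> borel_measurable (inv_algebra M T)"
    using h by (auto simp: borel_measurable_complex_iff)
  from this[THEN *] show ?thesis using AE_space
    by eventually_elim (auto simp: koopman_eq complex_eq_iff)
qed

text \<open>Each rational level set of the real and imaginary parts is invariant, so almost every
  point gives the same answer to all these countably many questions. The value at any one point with
  these answers is the constant.\<close>

lemma ergodic_on_constant:
  assumes erg: "ergodic_on M T H" and w: "w \<in> borel_measurable M"
    and inv: "\<And>g. g \<in> H \<Longrightarrow> AE x in M. koopman M T g w x = w x"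
  obtains c where "AE x in M. w x = c"
proof -
  have *: "\<exists>x0. AE x in M. u (w x) = (x0 :: real)" if [measurable]: "u \<in> borel_measurable borel" for u
  proof -
    have ex: "\<exists>b. AE x in M. (u (w x) < of_rat q) = b" for q :: rat
    proof -
      have "{z. u z < of_rat q} \<in> sets borel" by measurable
      from invariant_set_vimage[OF w inv this]
      have A: "{x \<in> space M. u (w x) < of_rat q} \<in> invariant_sets M T H" by simp
      then have m: "{x \<in> space M. u (w x) < of_rat q} \<in> sets M" by (simp add: invariant_sets_def)
      have "prob {x \<in> space M. u (w x) < of_rat q} = 0 \<or> prob {x \<in> space M. u (w x) < of_rat q} = 1"
        using erg A by (auto simp: ergodic_on_def)
      then show ?thesis
      proof
        assume "prob {x \<in> space M. u (w x) < of_rat q} = 0"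
        then have "AE x in M. x \<notin> {x \<in> space M. u (w x) < of_rat q}" using m by (simp add: prob_eq_0)
        then have "AE x in M. (u (w x) < of_rat q) = False" using AE_space by eventually_elim auto
        then show ?thesis by blast
      next
        assume "prob {x \<in> space M. u (w x) < of_rat q} = 1"
        then have "AE x in M. x \<in> {x \<in> space M. u (w x) < of_rat q}" using m by (simp add: prob_eq_1)
        then have "AE x in M. (u (w x) < of_rat q) = True" by eventually_elim auto
        then show ?thesis by blast
      qed
    qed
    then obtain b where "\<And>q::rat. AE x in M. (u (w x) < of_rat q) = b q" by metis
    then have b: "AE x in M. \<forall>q::rat. (u (w x) < of_rat q) = b q" by (simp add: AE_all_countable)
    have "\<exists>x0. \<forall>q::rat. (u (w x0) < of_rat q) = b q"
    proof (rule ccontr)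
      assume "\<nexists>x0. \<forall>q::rat. (u (w x0) < of_rat q) = b q"
      then have "\<not> (\<forall>q::rat. (u (w x) < of_rat q) = b q)" for x by blast
      then have "AE x in M. False" by (rule_tac AE_mp[OF b], intro AE_I2) blast
      then show False by simp
    qed
    then obtain x0 where x0: "\<And>q::rat. (u (w x0) < of_rat q) = b q" by blast
    from b have "AE x in M. u (w x) = u (w x0)"
      by eventually_elim (rule eq_if_same_rats_above, simp add: x0)
    then show ?thesis by blast
  qed
  obtain a b where "AE x in M. Re (w x) = a" "AE x in M. Im (w x) = b"
    using *[of Re] *[of Im] by auto
  then have "AE x in M. w x = Complex a b" by eventually_elim (simp add: complex_eq_iff)
  then show ?thesis by (rule that)
qed

lemma inv_exp_Linf: "f \<in> Linf M \<Longrightarrow> inv_exp M T f \<in> Linf M"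
  by (rule complex_cond_exp_Linf[OF subalgebra_inv_algebra])

lemma koopman_inv_exp:
  assumes "f \<in> Linf M"
  shows "AE x in M. koopman M T g (inv_exp M T f) x = inv_exp M T f x"
  using complex_cond_exp_L2(1)[OF subalgebra_inv_algebra Linf_L2[OF assms]]
  by (rule inv_algebra_measurableD)

text \<open>The limit \<open>w\<close> is invariant, hence orthogonal to
  \<open>f - inv_exp M T f\<close>, to all its translates and so to the averages. By Pythagoras the
  averages are no larger in norm than their distance to \<open>w\<close>, which tends to 0.\<close>

lemma avg_koopman_orthogonal_part:
  assumes F: "Folner F" and f: "f \<in> Linf M"
  shows "(\<lambda>N. mean_sq M (\<lambda>x. avg F N (\<lambda>g. koopman M T g (\<lambda>y. f y - inv_exp M T f y) x))) \<longlonglongrightarrow> 0"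
proof -
  let ?f = "\<lambda>y. f y - inv_exp M T f y"
  have fL: "?f \<in> Linf M" by (intro Linf_diff f inv_exp_Linf)
  have "(\<lambda>_. 1) \<in> pontryagin_dual" by (simp add: pontryagin_dual_def)
  then obtain w where w: "w \<in> Linf M" "\<And>k. AE x in M. koopman M T k w x = 1 * w x"
    "(\<lambda>N. mean_sq M (\<lambda>x. avg F N (\<lambda>g. cnj 1 * koopman M T g ?f x) - w x)) \<longlonglongrightarrow> 0"
    by (rule mean_ergodic[OF F fL]) (rule that)
  let ?A = "\<lambda>N x. avg F N (\<lambda>g. koopman M T g ?f x)"
  have AL: "?A N \<in> Linf M" for N by (intro Linf_avg koopman_Linf fL)
  have "w \<in> borel_measurable (inv_algebra M T)"
    using w(2) by (intro inv_algebra_measurableI Linf_measurable w(1)) simp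
  then have orth: "L2_inner M ?f w = 0"
    by (intro complex_cond_exp_orthogonal subalgebra_inv_algebra Linf_L2 f w)
  have "L2_inner M (koopman M T g ?f) w = 0" for g
  proof -
    have "L2_inner M (koopman M T g ?f) w = L2_inner M (koopman M T g ?f) (koopman M T g w)"
      using w(2)[of g] by (intro L2_inner_cong_AE koopman_Linf fL w) auto
    also have "\<dots> = L2_inner M (koopman M T 0 ?f) w"
      using inner_koopman[OF fL w(1), of g g] by simp
    also have "\<dots> = L2_inner M ?f w"
      unfolding L2_inner_def by (intro Bochner_Integration.integral_cong) (auto simp: koopman_eq action_0)
    finally show ?thesis using orth by simp
  qed
  then have "L2_inner M (?A N) w = 0" for N
    by (subst L2_inner_avg_left) (auto intro: koopman_Linf fL w simp: avg_def)
  then have "mean_sq M (\<lambda>x. ?A N x - w x) = mean_sq M (?A N) + mean_sq M w" for N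
    by (subst mean_sq_diff[OF AL w(1)]) simp
  then have "mean_sq M (?A N) \<le> mean_sq M (\<lambda>x. avg F N (\<lambda>g. cnj 1 * koopman M T g ?f x) - w x)" for N
    by simp
  then show ?thesis
    by (intro tendsto_sandwich[OF _ _ tendsto_const w(3)]) auto
qed

text \<open>The limit is an eigenfunction with eigenvalue \<open>\<gamma>\<close>. It is invariant
  under \<open>H\<close>, where \<open>\<gamma>\<close> is trivial, so ergodicity makes it constant;
  a constant with eigenvalue different from 1 at \<open>k\<close> is 0.\<close>

lemma avg_twisted_koopman:
  assumes F: "Folner F" and f: "f \<in> Linf M" and \<gamma>: "\<gamma> \<in> pontryagin_dual" "\<gamma> k \<noteq> 1"
    and H: "ergodic_on M T H" "vanishes_on \<gamma> H"
  shows "(\<lambda>N. mean_sq M (\<lambda>x. avg F N (\<lambda>g. cnj (\<gamma> g) * koopman M T g f x))) \<longlonglongrightarrow> 0"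
proof -
  obtain w where w: "w \<in> Linf M" "\<And>k. AE x in M. koopman M T k w x = \<gamma> k * w x"
    "(\<lambda>N. mean_sq M (\<lambda>x. avg F N (\<lambda>g. cnj (\<gamma> g) * koopman M T g f x) - w x)) \<longlonglongrightarrow> 0"
    by (rule mean_ergodic[OF F f \<gamma>(1)]) (rule that)
  obtain c where c: "AE x in M. w x = c"
  proof (rule ergodic_on_constant[OF H(1) Linf_measurable[OF w(1)]])
    show "AE x in M. koopman M T g w x = w x" if "g \<in> H" for g
      using w(2)[of g] H(2) that by (simp add: vanishes_on_def)
  qed auto
  have "AE x in M. w x = 0"
    using w(2)[of k] c AE_koopman[OF c, of k]
  proof eventually_elim
    case (elim x)
    then have "(1 - \<gamma> k) * c = 0" by (simp add: algebra_simps)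
    then show ?case using \<gamma>(2) elim by simp
  qed
  have "mean_sq M (\<lambda>x. avg F N (\<lambda>g. cnj (\<gamma> g) * koopman M T g f x) - w x)
      = mean_sq M (\<lambda>x. avg F N (\<lambda>g. cnj (\<gamma> g) * koopman M T g f x))" for N
    using \<open>AE x in M. w x = 0\<close>
    by (intro mean_sq_cong_AE Linf_diff Linf_avg Linf_cmult koopman_Linf f w) auto
  then show ?thesis using w(3) by simp
qed

end


section \<open>Harmonic analysis on the dual group\<close>

lemma compact_continuous_measurable:
  assumes "sets \<sigma> = sets (restrict_space borel K)" "continuous_on K f"
  shows "f \<in> borel_measurable \<sigma>"
  using borel_measurable_continuous_on_restrict[OF assms(2)] measurable_cong_sets[OF assms(1) refl] by blast

lemma compact_continuous_integrable:
  fixes f :: "'a::topological_space \<Rightarrow> 'b::{banach, second_countable_topology}"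
  assumes "finite_measure \<sigma>" "sets \<sigma> = sets (restrict_space borel K)" "compact K" "continuous_on K f"
  shows "integrable \<sigma> f"
proof -
  interpret finite_measure \<sigma> by fact
  obtain C where "\<And>x. x \<in> K \<Longrightarrow> norm (f x) \<le> C"
    using compact_imp_bounded[OF compact_continuous_image[OF assms(4,3)]] by (auto simp: bounded_iff)
  moreover have "space \<sigma> = K"
    using sets_eq_imp_space_eq[OF assms(2)] by (simp add: space_restrict_space)
  ultimately have "AE x in \<sigma>. norm (f x) \<le> C" by (intro AE_I2) auto
  then show ?thesis
    using compact_continuous_measurable[OF assms(2,4)] by (intro integrable_const_bound)
qed


lemma dualD:
  assumes "\<gamma> \<in> pontryagin_dual"
  shows "\<gamma> (g + h) = \<gamma> g * \<gamma> h" "cmod (\<gamma> g) = 1" "\<gamma> 0 = 1" "\<gamma> (- g) = cnj (\<gamma> g)"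
    "\<gamma> (g - h) = \<gamma> g * cnj (\<gamma> h)" "\<gamma> g * cnj (\<gamma> g) = 1"
proof -
  show a: "\<gamma> (g + h) = \<gamma> g * \<gamma> h" and n: "cmod (\<gamma> g) = 1" for g h
    using assms by (auto simp: pontryagin_dual_def)
  have "\<gamma> 0 * \<gamma> 0 = \<gamma> 0" using a[of 0 0] by simp
  moreover have "\<gamma> 0 \<noteq> 0" using n[of 0] by auto
  ultimately show z: "\<gamma> 0 = 1" by simp
  show u: "\<gamma> g * cnj (\<gamma> g) = 1" for g
    using n[of g] by (simp add: complex_norm_square[symmetric])
  have "\<gamma> g * \<gamma> (- g) = \<gamma> g * cnj (\<gamma> g)" for g using a[of g "- g"] z u[of g] by simp
  moreover have "\<gamma> g \<noteq> 0" for g using n[of g] by auto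
  ultimately show m: "\<gamma> (- g) = cnj (\<gamma> g)" for g by simp
  show "\<gamma> (g - h) = \<gamma> g * cnj (\<gamma> h)" using a[of g "- h"] m by simp
qed

lemma dual_mult: "\<psi> \<in> pontryagin_dual \<Longrightarrow> \<gamma> \<in> pontryagin_dual \<Longrightarrow> (\<lambda>g. \<psi> g * \<gamma> g) \<in> pontryagin_dual"
  by (auto simp: pontryagin_dual_def norm_mult)

lemma continuous_on_eval [continuous_intros]: "continuous_on S (\<lambda>\<gamma>. \<gamma> g :: 'b::topological_space)"
  by (rule continuous_on_subset[OF continuous_on_product_coordinates]) simp

lemma closed_dual: "closed (pontryagin_dual :: ('g::ab_group_add \<Rightarrow> complex) set)"
proof -
  have "pontryagin_dual = {\<gamma> :: 'g \<Rightarrow> complex. (\<forall>g. \<forall>h. \<gamma> (g + h) = \<gamma> g * \<gamma> h) \<and> (\<forall>g. cmod (\<gamma> g) = 1)}"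
    by (simp add: pontryagin_dual_def)
  also have "closed \<dots>"
    by (intro closed_Collect_conj closed_Collect_all closed_Collect_eq continuous_intros)
  finally show ?thesis .
qed

lemma compact_dual: "compact (pontryagin_dual :: ('g::ab_group_add \<Rightarrow> complex) set)"
proof -
  have "compactin (product_topology (\<lambda>_::'g. euclidean) UNIV) (PiE UNIV (\<lambda>_. sphere (0::complex) 1))"
    by (subst compactin_PiE) auto
  then have "compact (PiE UNIV (\<lambda>_::'g. sphere (0::complex) 1))"
    by (simp add: euclidean_product_topology)
  moreover have "pontryagin_dual \<subseteq> PiE UNIV (\<lambda>_::'g. sphere (0::complex) 1)"
    by (auto simp: pontryagin_dual_def)
  ultimately show ?thesis
    using closed_dual by (metis compact_Int_closed inf.absorb_iff2)
qed

lemma dual_borel_space: "sets \<sigma> = sets dual_borel \<Longrightarrow> space \<sigma> = (pontryagin_dual :: ('g::ab_group_add \<Rightarrow> complex) set)"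
  using sets_eq_imp_space_eq[of \<sigma> dual_borel] by (simp add: space_restrict_space)

lemma dual_continuous_integrable:
  fixes f :: "('g::ab_group_add \<Rightarrow> complex) \<Rightarrow> 'b::{banach, second_countable_topology}"
  assumes "finite_measure \<sigma>" "sets \<sigma> = sets dual_borel" "continuous_on pontryagin_dual f"
  shows "integrable \<sigma> f"
  by (rule compact_continuous_integrable[OF assms(1,2) compact_dual assms(3)])

text \<open>Trigonometric polynomials. Equality is asked only on the dual, since only for characters
  is a product of monomials again a monomial.\<close>

definition trig :: "(('g::ab_group_add \<Rightarrow> complex) \<Rightarrow> complex) \<Rightarrow> bool" where
  "trig f \<longleftrightarrow> (\<exists>D c. finite D \<and> (\<forall>\<gamma>\<in>pontryagin_dual. f \<gamma> = (\<Sum>k\<in>D. c k * \<gamma> k)))"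

lemma trig_cong: "trig f \<Longrightarrow> (\<And>\<gamma>. \<gamma> \<in> pontryagin_dual \<Longrightarrow> g \<gamma> = f \<gamma>) \<Longrightarrow> trig g"
  by (simp add: trig_def)

lemma trig_monomial: "trig (\<lambda>\<gamma>. c * \<gamma> k)"
  unfolding trig_def by (intro exI[of _ "{k}"] exI[of _ "\<lambda>_. c"]) auto

lemma trig_add: assumes "trig f" "trig g" shows "trig (\<lambda>\<gamma>. f \<gamma> + g \<gamma>)"
proof -
  obtain D c E d where *: "finite D" "finite E" "\<And>\<gamma>. \<gamma> \<in> pontryagin_dual \<Longrightarrow> f \<gamma> = (\<Sum>k\<in>D. c k * \<gamma> k)"
    "\<And>\<gamma>. \<gamma> \<in> pontryagin_dual \<Longrightarrow> g \<gamma> = (\<Sum>k\<in>E. d k * \<gamma> k)"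
    using assms unfolding trig_def by metis
  have "f \<gamma> + g \<gamma> = (\<Sum>k\<in>D \<union> E. ((if k \<in> D then c k else 0) + (if k \<in> E then d k else 0)) * \<gamma> k)"
    if "\<gamma> \<in> pontryagin_dual" for \<gamma>
  proof -
    have "(\<Sum>k\<in>D. c k * \<gamma> k) = (\<Sum>k\<in>D \<union> E. (if k \<in> D then c k else 0) * \<gamma> k)"
      "(\<Sum>k\<in>E. d k * \<gamma> k) = (\<Sum>k\<in>D \<union> E. (if k \<in> E then d k else 0) * \<gamma> k)"
      using *(1,2) by (auto intro!: sum.mono_neutral_cong_left)
    then show ?thesis using *(3,4)[OF that] by (simp add: sum.distrib distrib_right)
  qed
  then show ?thesis unfolding trig_def using *(1,2)
    by (intro exI[of _ "D \<union> E"] exI[of _ "\<lambda>k. (if k \<in> D then c k else 0) + (if k \<in> E then d k else 0)"]) auto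
qed

lemma trig_const: "trig (\<lambda>_. c)"
  by (rule trig_cong[OF trig_monomial[of c 0]]) (simp add: dualD)

lemma trig_sum: "finite I \<Longrightarrow> (\<And>i. i \<in> I \<Longrightarrow> trig (f i)) \<Longrightarrow> trig (\<lambda>\<gamma>. \<Sum>i\<in>I. f i \<gamma>)"
  by (induction I rule: finite_induct) (auto intro: trig_add trig_const)

lemma trig_mult: assumes "trig f" "trig g" shows "trig (\<lambda>\<gamma>. f \<gamma> * g \<gamma>)"
proof -
  obtain D c E d where *: "finite D" "finite E" "\<And>\<gamma>. \<gamma> \<in> pontryagin_dual \<Longrightarrow> f \<gamma> = (\<Sum>k\<in>D. c k * \<gamma> k)"
    "\<And>\<gamma>. \<gamma> \<in> pontryagin_dual \<Longrightarrow> g \<gamma> = (\<Sum>k\<in>E. d k * \<gamma> k)"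
    using assms unfolding trig_def by metis
  have "trig (\<lambda>\<gamma>. \<Sum>k\<in>D. \<Sum>l\<in>E. (c k * d l) * \<gamma> (k + l))"
    using * by (intro trig_sum trig_monomial)
  then show ?thesis
    by (rule trig_cong) (simp add: * dualD sum_product mult_ac)
qed

text \<open>The real and imaginary parts of evaluation at \<open>g\<close> are combinations of the
  frequencies \<open>g\<close> and \<open>- g\<close>, and these functions separate
  characters.\<close>

lemma trig_Stone_Weierstrass:
  fixes f :: "('g::{ab_group_add, countable} \<Rightarrow> complex) \<Rightarrow> real"
  assumes "continuous_on pontryagin_dual f" "e > 0"
  obtains q where "continuous_on pontryagin_dual q" "trig (\<lambda>\<gamma>. complex_of_real (q \<gamma>))"
    "\<And>\<gamma>. \<gamma> \<in> pontryagin_dual \<Longrightarrow> \<bar>f \<gamma> - q \<gamma>\<bar> < e"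
proof -
  let ?P = "\<lambda>q. continuous_on pontryagin_dual q \<and> trig (\<lambda>\<gamma>::'g \<Rightarrow> complex. complex_of_real (q \<gamma>))"
  have "\<exists>q. ?P q \<and> (\<forall>\<gamma>\<in>pontryagin_dual. \<bar>f \<gamma> - q \<gamma>\<bar> < e)"
  proof (rule Stone_Weierstrass_HOL[where P = ?P, OF compact_dual _ _ _ _ _ assms])
    show "?P (\<lambda>_. c)" for c by (simp add: trig_const)
    show "?P (\<lambda>x. f x + g x)" "?P (\<lambda>x. f x * g x)" if "?P f \<and> ?P g" for f g
      using that by (auto intro!: continuous_intros trig_add trig_mult)
    show "\<exists>q. ?P q \<and> q x \<noteq> q y" if xy: "x \<in> pontryagin_dual \<and> y \<in> pontryagin_dual \<and> x \<noteq> y" for x y :: "'g \<Rightarrow> complex"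
    proof -
      obtain g where "x g \<noteq> y g" using xy by auto
      then have "Re (x g) \<noteq> Re (y g) \<or> Im (x g) \<noteq> Im (y g)" by (auto simp: complex_eq_iff)
      moreover have "trig (\<lambda>\<gamma>. complex_of_real (Re (\<gamma> g)))"
        by (rule trig_cong[OF trig_add[OF trig_monomial[of "1/2" g] trig_monomial[of "1/2" "- g"]]])
           (simp add: dualD complex_eq_iff)
      moreover have "trig (\<lambda>\<gamma>. complex_of_real (Im (\<gamma> g)))"
        by (rule trig_cong[OF trig_add[OF trig_monomial[of "- \<i> / 2" g] trig_monomial[of "\<i> / 2" "- g"]]])
           (simp add: dualD complex_eq_iff)
      moreover have "continuous_on pontryagin_dual (\<lambda>\<gamma>. Re (\<gamma> g))" "continuous_on pontryagin_dual (\<lambda>\<gamma>. Im (\<gamma> g))"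
        by (intro continuous_intros)+
      ultimately show ?thesis by meson
    qed
  qed auto
  then show ?thesis using that by blast
qed

section \<open>Haar measure on the dual group\<close>

locale haar_dual =
  fixes m :: "('g::{ab_group_add, countable} \<Rightarrow> complex) measure"
  assumes haar: "normalized_haar (\<lambda>\<psi> \<gamma> g. \<psi> g * \<gamma> g) pontryagin_dual m"
begin

lemma haar_sets: "sets m = sets dual_borel"
  using haar by (simp add: normalized_haar_def)

sublocale prob_space m
  using haar by (simp add: normalized_haar_def)

lemma haar_integrable:
  fixes f :: "('g \<Rightarrow> complex) \<Rightarrow> 'b::{banach, second_countable_topology}"
  shows "continuous_on pontryagin_dual f \<Longrightarrow> integrable m f"
  by (rule dual_continuous_integrable[OF finite_measure_axioms haar_sets])

lemma integral_cong_dual: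
  assumes "\<And>\<gamma>. \<gamma> \<in> pontryagin_dual \<Longrightarrow> f \<gamma> = g \<gamma>"
  shows "(\<integral>\<gamma>. f \<gamma> \<partial>m) = (\<integral>\<gamma>. g \<gamma> \<partial>m)"
  using assms dual_borel_space[OF haar_sets] by (intro Bochner_Integration.integral_cong) auto

text \<open>For \<open>k \<noteq> 0\<close> some character \<open>\<psi>\<close> has
  \<open>\<psi> k \<noteq> 1\<close>; translation by it leaves the Haar integral unchanged and
  multiplies it by \<open>\<psi> k\<close>, so the integral is 0.\<close>

lemma integral_character: "(\<integral>\<gamma>. \<gamma> k \<partial>m) = (if k = 0 then 1 else 0)"
proof (cases "k = 0")
  case True
  have "(\<integral>\<gamma>. \<gamma> 0 \<partial>m) = (\<integral>\<gamma>. 1 \<partial>m)" by (rule integral_cong_dual) (simp add: dualD)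
  then show ?thesis using True by (simp add: prob_space)
next
  case False
  then obtain \<psi> where \<psi>: "\<psi> \<in> pontryagin_dual" "\<psi> k \<noteq> 1" by (rule exists_character)
  have "continuous_on UNIV (\<lambda>\<gamma> g. \<psi> g * \<gamma> g)"
    by (rule continuous_on_coordinatewise_then_product)
       (rule continuous_on_mult[OF continuous_on_const continuous_on_eval])
  then have "(\<lambda>\<gamma> g. \<psi> g * \<gamma> g) \<in> borel_measurable m"
    by (rule compact_continuous_measurable[OF haar_sets continuous_on_subset[OF _ subset_UNIV]])
  then have "(\<lambda>\<gamma> g. \<psi> g * \<gamma> g) \<in> measurable m dual_borel"
    using dual_borel_space[OF haar_sets] \<psi>(1) by (intro measurable_restrict_space2) (auto intro: dual_mult)
  then have meas: "(\<lambda>\<gamma> g. \<psi> g * \<gamma> g) \<in> measurable m m"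
    using measurable_cong_sets[OF refl haar_sets] by blast
  have d: "distr m m (\<lambda>\<gamma> g. \<psi> g * \<gamma> g) = m"
    using haar \<psi>(1) unfolding normalized_haar_def by blast
  have "(\<integral>\<gamma>. \<gamma> k \<partial>m) = (\<integral>\<gamma>. \<gamma> k \<partial>distr m m (\<lambda>\<gamma> g. \<psi> g * \<gamma> g))" by (simp only: d)
  also have "\<dots> = (\<integral>\<gamma>. \<psi> k * \<gamma> k \<partial>m)"
    by (rule integral_distr[OF meas compact_continuous_measurable[OF haar_sets continuous_on_eval]])
  also have "\<dots> = \<psi> k * (\<integral>\<gamma>. \<gamma> k \<partial>m)" by simp
  finally have "(1 - \<psi> k) * (\<integral>\<gamma>. \<gamma> k \<partial>m) = 0" by (metis diff_self left_diff_distrib mult_1)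
  then show ?thesis using \<psi> False by simp
qed

text \<open>Translates smallness in mean square for Haar measure into smallness of the squared
  coefficients; the monomials are orthonormal.\<close>

lemma parseval:
  assumes "finite D"
  shows "(\<integral>\<gamma>. (cmod (\<Sum>k\<in>D. c k * \<gamma> k))\<^sup>2 \<partial>m) = (\<Sum>k\<in>D. (cmod (c k))\<^sup>2)"
proof -
  have "complex_of_real (\<integral>\<gamma>. (cmod (\<Sum>k\<in>D. c k * \<gamma> k))\<^sup>2 \<partial>m)
      = (\<integral>\<gamma>. complex_of_real ((cmod (\<Sum>k\<in>D. c k * \<gamma> k))\<^sup>2) \<partial>m)"
    by (simp only: integral_complex_of_real)
  also have "\<dots> = (\<integral>\<gamma>. (\<Sum>k\<in>D. \<Sum>l\<in>D. c k * cnj (c l) * \<gamma> (k - l)) \<partial>m)"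
  proof (rule integral_cong_dual)
    fix \<gamma> :: "'g \<Rightarrow> complex" assume \<gamma>: "\<gamma> \<in> pontryagin_dual"
    show "complex_of_real ((cmod (\<Sum>k\<in>D. c k * \<gamma> k))\<^sup>2) = (\<Sum>k\<in>D. \<Sum>l\<in>D. c k * cnj (c l) * \<gamma> (k - l))"
      unfolding complex_norm_square cnj_sum sum_product
      by (intro sum.cong refl) (simp add: dualD(5)[OF \<gamma>])
  qed
  also have "\<dots> = (\<Sum>k\<in>D. \<Sum>l\<in>D. c k * cnj (c l) * (\<integral>\<gamma>. \<gamma> (k - l) \<partial>m))"
    by (subst Bochner_Integration.integral_sum Bochner_Integration.integral_sum,
        (intro haar_integrable continuous_intros)[1])+
       (intro sum.cong refl integral_mult_right_zero)
  also have "\<dots> = (\<Sum>k\<in>D. \<Sum>l\<in>D. if k = l then c k * cnj (c k) else 0)"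
    by (intro sum.cong refl) (auto simp: integral_character)
  also have "\<dots> = (\<Sum>k\<in>D. c k * cnj (c k))"
    using assms by (simp add: sum.delta')
  also have "\<dots> = complex_of_real (\<Sum>k\<in>D. (cmod (c k))\<^sup>2)"
    by (simp only: complex_norm_square of_real_sum)
  finally show ?thesis by (simp only: of_real_eq_iff)
qed

end

text \<open>The quadratic form is compared with 0 through its real part, so Hermitian symmetry is a
  separate clause; it makes the form real.\<close>

definition positive_definite :: "('g::ab_group_add \<Rightarrow> complex) \<Rightarrow> bool" where
  "positive_definite \<phi> \<longleftrightarrow> (\<forall>k. \<phi> (- k) = cnj (\<phi> k)) \<and>
     (\<forall>D c. finite D \<longrightarrow> 0 \<le> Re (\<Sum>g\<in>D. \<Sum>h\<in>D. c g * cnj (c h) * \<phi> (g - h)))"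

lemma positive_definiteD:
  assumes "positive_definite \<phi>"
  shows "finite D \<Longrightarrow> 0 \<le> Re (\<Sum>g\<in>D. \<Sum>h\<in>D. c g * cnj (c h) * \<phi> (g - h))"
    and "cnj (\<phi> (g - h)) = \<phi> (h - g)"
proof -
  show "finite D \<Longrightarrow> 0 \<le> Re (\<Sum>g\<in>D. \<Sum>h\<in>D. c g * cnj (c h) * \<phi> (g - h))"
    using assms by (simp add: positive_definite_def)
  have "\<phi> (- (g - h)) = cnj (\<phi> (g - h))"
    using assms unfolding positive_definite_def by (elim conjE allE)
  then show "cnj (\<phi> (g - h)) = \<phi> (h - g)" by simp
qed

text \<open>This replaces Bochner's theorem: \<open>\<phi>\<close> is represented by a positive functional on
  the continuous functions, the limit of integration against Fej\'er kernels along the F\o lner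
  sequence.\<close>

theorem (in haar_dual) positive_definite_functional:
  fixes \<phi> :: "'g \<Rightarrow> complex" and F :: "nat \<Rightarrow> 'g set"
  assumes F: "Folner F" and \<phi>: "positive_definite \<phi>"
  obtains L where "positive_functional pontryagin_dual L"
    "\<And>k. L (\<lambda>\<gamma>. Re (\<gamma> k)) = Re (\<phi> k)" "\<And>k. L (\<lambda>\<gamma>. Im (\<gamma> k)) = Im (\<phi> k)"
proof -
  \<comment> \<open>The density approximating the measure represented by \<open>\<phi>\<close>: it
    is the quadratic form of \<open>\<phi>\<close> with coefficients \<open>cnj (\<gamma> g)\<close>
    on \<open>F n\<close>, hence nonnegative, normalized by the size of \<open>F n\<close>.\<close>
  define P where "P n \<gamma> = (\<Sum>g\<in>F n. \<Sum>h\<in>F n. cnj (\<gamma> g) * \<gamma> h * \<phi> (g - h)) /\<^sub>R real (card (F n))" for n and \<gamma> :: "'g \<Rightarrow> complex"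
  define p where "p n \<gamma> = Re (P n \<gamma>)" for n \<gamma>
  have p_nonneg: "0 \<le> p n \<gamma>" for n \<gamma>
  proof -
    have "0 \<le> Re (\<Sum>g\<in>F n. \<Sum>h\<in>F n. cnj (\<gamma> g) * cnj (cnj (\<gamma> h)) * \<phi> (g - h))"
      by (rule positive_definiteD(1)[OF \<phi> FolnerD(1)[OF F]])
    then show ?thesis by (simp add: p_def P_def)
  qed
  have P_p: "P n \<gamma> = complex_of_real (p n \<gamma>)" for n \<gamma>
  proof -
    have "cnj (\<Sum>g\<in>F n. \<Sum>h\<in>F n. cnj (\<gamma> g) * \<gamma> h * \<phi> (g - h)) = (\<Sum>g\<in>F n. \<Sum>h\<in>F n. cnj (\<gamma> h) * \<gamma> g * \<phi> (h - g))"
      unfolding cnj_sum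
    proof (intro sum.cong refl)
      fix g h
      show "cnj (cnj (\<gamma> g) * \<gamma> h * \<phi> (g - h)) = cnj (\<gamma> h) * \<gamma> g * \<phi> (h - g)"
        by (simp add: positive_definiteD(2)[OF \<phi>])
    qed
    also have "\<dots> = (\<Sum>g\<in>F n. \<Sum>h\<in>F n. cnj (\<gamma> g) * \<gamma> h * \<phi> (g - h))" by (rule sum.swap)
    finally have "cnj (P n \<gamma>) = P n \<gamma>" by (simp add: P_def scaleR_conv_of_real)
    then have "P n \<gamma> \<in> \<real>" by (simp add: Reals_cnj_iff)
    then show ?thesis by (simp add: p_def of_real_Re)
  qed
  have P_cont: "continuous_on pontryagin_dual (P n)" for n
    unfolding P_def by (intro continuous_intros)
  have p_cont: "continuous_on pontryagin_dual (p n)" for n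
    unfolding p_def by (intro continuous_intros P_cont)
  \<comment> \<open>By orthogonality only the terms with \<open>g = h + k\<close> survive. The
    coefficient at \<open>k\<close> is \<open>\<phi> k\<close> times the proportion of
    \<open>F n\<close> that the shift by \<open>k\<close> keeps inside, which tends to 1.\<close>
  have coeff: "(\<integral>\<gamma>. \<gamma> k * P n \<gamma> \<partial>m) = \<phi> k * complex_of_real (avg F n (\<lambda>h. indicator (F n) (h + k)))" for k n
  proof -
    have "(\<integral>\<gamma>. \<gamma> k * P n \<gamma> \<partial>m) = (\<integral>\<gamma>. (\<Sum>h\<in>F n. \<Sum>g\<in>F n. \<phi> (g - h) * \<gamma> (h + k - g)) /\<^sub>R real (card (F n)) \<partial>m)"
    proof (rule integral_cong_dual)
      fix \<gamma> :: "'g \<Rightarrow> complex" assume \<gamma>: "\<gamma> \<in> pontryagin_dual"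
      have "\<gamma> k * (\<Sum>g\<in>F n. \<Sum>h\<in>F n. cnj (\<gamma> g) * \<gamma> h * \<phi> (g - h)) = (\<Sum>g\<in>F n. \<Sum>h\<in>F n. \<phi> (g - h) * \<gamma> (h + k - g))"
        unfolding sum_distrib_left by (intro sum.cong refl) (simp add: dualD(1,5)[OF \<gamma>])
      also have "\<dots> = (\<Sum>h\<in>F n. \<Sum>g\<in>F n. \<phi> (g - h) * \<gamma> (h + k - g))" by (rule sum.swap)
      finally show "\<gamma> k * P n \<gamma> = (\<Sum>h\<in>F n. \<Sum>g\<in>F n. \<phi> (g - h) * \<gamma> (h + k - g)) /\<^sub>R real (card (F n))"
        by (simp add: P_def)
    qed
    also have "\<dots> = (\<integral>\<gamma>. (\<Sum>h\<in>F n. \<Sum>g\<in>F n. \<phi> (g - h) * \<gamma> (h + k - g)) \<partial>m) /\<^sub>R real (card (F n))"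
      by (intro integral_scaleR_right haar_integrable continuous_intros)
    also have "(\<integral>\<gamma>. (\<Sum>h\<in>F n. \<Sum>g\<in>F n. \<phi> (g - h) * \<gamma> (h + k - g)) \<partial>m)
        = (\<Sum>h\<in>F n. \<Sum>g\<in>F n. \<phi> (g - h) * (\<integral>\<gamma>. \<gamma> (h + k - g) \<partial>m))"
      by (subst Bochner_Integration.integral_sum, (intro haar_integrable continuous_intros)[1],
          subst Bochner_Integration.integral_sum, (intro haar_integrable continuous_intros)[1])
         (intro sum.cong refl integral_mult_right_zero)
    also have "(\<Sum>h\<in>F n. \<Sum>g\<in>F n. \<phi> (g - h) * (\<integral>\<gamma>. \<gamma> (h + k - g) \<partial>m)) = (\<Sum>h\<in>F n. \<phi> k * complex_of_real (indicator (F n) (h + k)))"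
    proof (rule sum.cong)
      fix h assume "h \<in> F n"
      have "(\<Sum>g\<in>F n. \<phi> (g - h) * (\<integral>\<gamma>. \<gamma> (h + k - g) \<partial>m)) = (\<Sum>g\<in>F n. if g = h + k then \<phi> k else 0)"
        by (intro sum.cong refl) (auto simp: integral_character)
      also have "\<dots> = \<phi> k * complex_of_real (indicator (F n) (h + k))"
        using FolnerD(1)[OF F, of n] by (simp add: sum.delta indicator_def)
      finally show "(\<Sum>g\<in>F n. \<phi> (g - h) * (\<integral>\<gamma>. \<gamma> (h + k - g) \<partial>m)) = \<phi> k * complex_of_real (indicator (F n) (h + k))" .
    qed simp
    finally show ?thesis
      by (simp add: avg_def scaleR_conv_of_real sum_distrib_left mult_ac)
  qed
  have ind: "(\<lambda>n. avg F n (\<lambda>h. indicator (F n) (h + k))) \<longlonglongrightarrow> (1::real)" for k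
  proof -
    have one: "avg F n (indicator (F n)) = (1::real)" for n
      using FolnerD[OF F, of n] by (simp add: avg_def)
    have "(\<lambda>n. avg F n (\<lambda>h. indicator (F n) (h + k)) - (1::real)) \<longlonglongrightarrow> 0"
    proof (rule Lim_null_comparison)
      have "norm (avg F n (\<lambda>h. indicator (F n) (h + k)) - avg F n (indicator (F n) :: 'g \<Rightarrow> real)) \<le> 1 * folner_ratio F k n" for n
        by (rule avg_shift[OF F]) (simp add: indicator_def)
      then show "\<forall>\<^sub>F n in sequentially. norm (avg F n (\<lambda>h. indicator (F n) (h + k)) - (1::real)) \<le> folner_ratio F k n"
        by (simp add: one)
    qed (rule folner_ratio_tendsto[OF F])
    then show ?thesis by (simp add: LIM_zero_iff)
  qed
  have lim: "(\<lambda>n. \<integral>\<gamma>. \<gamma> k * complex_of_real (p n \<gamma>) \<partial>m) \<longlonglongrightarrow> \<phi> k" for k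
  proof -
    have "(\<lambda>n. \<phi> k * complex_of_real (avg F n (\<lambda>h. indicator (F n) (h + k)))) \<longlonglongrightarrow> \<phi> k * complex_of_real 1"
      by (intro tendsto_intros ind)
    then show ?thesis by (simp add: coeff flip: P_p)
  qed
  define \<Lambda> where "\<Lambda> n f = (\<integral>\<gamma>. f \<gamma> * p n \<gamma> \<partial>m)" for n and f :: "('g \<Rightarrow> complex) \<Rightarrow> real"
  have \<Lambda>_int: "integrable m (\<lambda>\<gamma>. f \<gamma> * p n \<gamma>)" if "continuous_on pontryagin_dual f" for f :: "('g \<Rightarrow> complex) \<Rightarrow> real" and n
    by (intro haar_integrable continuous_intros that p_cont)
  have \<Lambda>_mono: "\<Lambda> n f \<le> \<Lambda> n g" if "continuous_on pontryagin_dual f" "continuous_on pontryagin_dual g"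
    "\<And>\<gamma>. \<gamma> \<in> pontryagin_dual \<Longrightarrow> f \<gamma> \<le> g \<gamma>" for n f g
    unfolding \<Lambda>_def using that p_nonneg dual_borel_space[OF haar_sets]
    by (intro integral_mono \<Lambda>_int) (auto intro: mult_right_mono)
  have \<Lambda>_add: "\<Lambda> n (\<lambda>x. f x + g x) = \<Lambda> n f + \<Lambda> n g" if "continuous_on pontryagin_dual f" "continuous_on pontryagin_dual g" for n f g
    unfolding \<Lambda>_def using \<Lambda>_int[OF that(1)] \<Lambda>_int[OF that(2)] by (simp add: distrib_right)
  have \<Lambda>_scale: "\<Lambda> n (\<lambda>x. c * f x) = c * \<Lambda> n f" for n c f
    unfolding \<Lambda>_def by (simp add: mult.assoc)
  have cp: "continuous_on pontryagin_dual (\<lambda>\<gamma>. \<gamma> k * complex_of_real (p n \<gamma>))" for k n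
    by (intro continuous_intros p_cont)
  have \<Lambda>_Re: "\<Lambda> n (\<lambda>\<gamma>. Re (\<gamma> k)) = Re (\<integral>\<gamma>. \<gamma> k * complex_of_real (p n \<gamma>) \<partial>m)" for n k
    unfolding \<Lambda>_def by (subst integral_Re[symmetric, OF haar_integrable[OF cp]]) simp
  have \<Lambda>_Im: "\<Lambda> n (\<lambda>\<gamma>. Im (\<gamma> k)) = Im (\<integral>\<gamma>. \<gamma> k * complex_of_real (p n \<gamma>) \<partial>m)" for n k
    unfolding \<Lambda>_def by (subst integral_Im[symmetric, OF haar_integrable[OF cp]]) simp
  have \<Lambda>_1: "\<Lambda> n (\<lambda>_. 1) = Re (\<phi> 0)" for n
  proof -
    have "\<Lambda> n (\<lambda>_. 1) = \<Lambda> n (\<lambda>\<gamma>. Re (\<gamma> 0))"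
      unfolding \<Lambda>_def by (rule integral_cong_dual) (simp add: dualD)
    also have "\<dots> = Re (\<phi> 0 * complex_of_real (avg F n (indicator (F n))))"
      unfolding \<Lambda>_Re by (simp add: coeff flip: P_p)
    also have "avg F n (indicator (F n)) = (1::real)"
      using FolnerD[OF F, of n] by (simp add: avg_def)
    finally show ?thesis by simp
  qed
  have conv: "convergent (\<lambda>n. \<Lambda> n f)" if f: "continuous_on pontryagin_dual f" for f
  proof (rule Cauchy_convergent, rule metric_CauchyI)
    fix e :: real assume e: "e > 0"
    \<comment> \<open>Uniform error \<open>\<delta>\<close> changes \<open>\<Lambda> n\<close> by at
      most \<open>\<delta>\<close> times its value at 1, which is \<open>Re (\<phi> 0)\<close> for
      every \<open>n\<close>. This uniformity lets convergence pass from trigonometric polynomials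
      to all continuous functions.\<close>
    define \<delta> where "\<delta> = e / (4 * (\<bar>Re (\<phi> 0)\<bar> + 1))"
    have "\<delta> > 0" using e by (simp add: \<delta>_def)
    then obtain q where q: "continuous_on pontryagin_dual q" "trig (\<lambda>\<gamma>. complex_of_real (q \<gamma>))"
      and fq: "\<And>\<gamma>. \<gamma> \<in> pontryagin_dual \<Longrightarrow> \<bar>f \<gamma> - q \<gamma>\<bar> < \<delta>"
      using trig_Stone_Weierstrass[OF f] by metis
    obtain D c where D: "finite D" and qc: "\<And>\<gamma>. \<gamma> \<in> pontryagin_dual \<Longrightarrow> complex_of_real (q \<gamma>) = (\<Sum>k\<in>D. c k * \<gamma> k)"
      using q(2) unfolding trig_def by metis
    have "complex_of_real (\<Lambda> n q) = (\<Sum>k\<in>D. c k * (\<integral>\<gamma>. \<gamma> k * complex_of_real (p n \<gamma>) \<partial>m))" for n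
    proof -
      have "complex_of_real (\<Lambda> n q) = (\<integral>\<gamma>. complex_of_real (q \<gamma>) * complex_of_real (p n \<gamma>) \<partial>m)"
        unfolding \<Lambda>_def by (simp only: integral_complex_of_real[symmetric] of_real_mult)
      also have "\<dots> = (\<integral>\<gamma>. (\<Sum>k\<in>D. c k * (\<gamma> k * complex_of_real (p n \<gamma>))) \<partial>m)"
        by (rule integral_cong_dual) (simp add: qc sum_distrib_right mult.assoc)
      also have "\<dots> = (\<Sum>k\<in>D. c k * (\<integral>\<gamma>. \<gamma> k * complex_of_real (p n \<gamma>) \<partial>m))"
        by (subst Bochner_Integration.integral_sum, (intro haar_integrable continuous_intros cp)[1])
           (intro sum.cong refl integral_mult_right_zero)
      finally show ?thesis .
    qed
    then have "(\<lambda>n. complex_of_real (\<Lambda> n q)) \<longlonglongrightarrow> (\<Sum>k\<in>D. c k * \<phi> k)"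
      by (simp only:) (intro tendsto_intros lim)
    then have "(\<lambda>n. Re (complex_of_real (\<Lambda> n q))) \<longlonglongrightarrow> Re (\<Sum>k\<in>D. c k * \<phi> k)"
      by (rule tendsto_Re)
    then have "Cauchy (\<lambda>n. \<Lambda> n q)" by (intro LIMSEQ_imp_Cauchy) simp
    then obtain N where N: "\<And>k n. k \<ge> N \<Longrightarrow> n \<ge> N \<Longrightarrow> dist (\<Lambda> k q) (\<Lambda> n q) < e / 2"
      using e unfolding Cauchy_def by (meson half_gt_zero)
    have close: "\<bar>\<Lambda> n f - \<Lambda> n q\<bar> \<le> e / 4" for n
    proof -
      have "\<Lambda> n f \<le> \<Lambda> n (\<lambda>x. q x + \<delta> * 1)" "\<Lambda> n q \<le> \<Lambda> n (\<lambda>x. f x + \<delta> * 1)"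
        using fq by (auto intro!: \<Lambda>_mono continuous_on_add continuous_on_const f q(1) simp: abs_less_iff less_imp_le algebra_simps)
      moreover have "\<Lambda> n (\<lambda>x. u x + \<delta> * 1) = \<Lambda> n u + \<delta> * Re (\<phi> 0)" if "continuous_on pontryagin_dual u" for u
        by (subst \<Lambda>_add[OF that continuous_on_const]) (simp only: \<Lambda>_scale \<Lambda>_1)
      ultimately have "\<bar>\<Lambda> n f - \<Lambda> n q\<bar> \<le> \<delta> * Re (\<phi> 0)"
        using f q(1) by (simp only: abs_le_iff) simp
      also have "\<dots> \<le> \<delta> * (\<bar>Re (\<phi> 0)\<bar> + 1)" using \<open>\<delta> > 0\<close> by (intro mult_left_mono) auto
      also have "\<dots> = e / 4"
      proof -
        have "x > 0 \<Longrightarrow> e / (4 * x) * x = e / 4" for x by simp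
        from this[of "\<bar>Re (\<phi> 0)\<bar> + 1"] show ?thesis by (simp only: \<delta>_def)
      qed
      finally show ?thesis .
    qed
    have "dist (\<Lambda> k f) (\<Lambda> n f) < e" if "k \<ge> N" "n \<ge> N" for k n
      using N[OF that] close[of k] close[of n] unfolding dist_real_def by linarith
    then show "\<exists>N. \<forall>k\<ge>N. \<forall>n\<ge>N. dist (\<Lambda> k f) (\<Lambda> n f) < e" by blast
  qed
  define L where "L f = lim (\<lambda>n. \<Lambda> n f)" for f
  have L: "(\<lambda>n. \<Lambda> n f) \<longlonglongrightarrow> L f" if "continuous_on pontryagin_dual f" for f
    using conv[OF that] by (simp add: L_def convergent_LIMSEQ_iff)
  have "positive_functional pontryagin_dual L"
  proof
    fix f g :: "('g \<Rightarrow> complex) \<Rightarrow> real" and c :: real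
    assume f: "continuous_on pontryagin_dual f"
    have "(\<lambda>n. \<Lambda> n (\<lambda>x. c * f x)) \<longlonglongrightarrow> c * L f"
      unfolding \<Lambda>_scale by (intro tendsto_intros L f)
    then show "L (\<lambda>x. c * f x) = c * L f" unfolding L_def by (rule limI)
    assume g: "continuous_on pontryagin_dual g"
    have "(\<lambda>n. \<Lambda> n (\<lambda>x. f x + g x)) \<longlonglongrightarrow> L f + L g"
      unfolding \<Lambda>_add[OF f g] by (intro tendsto_intros L f g)
    then show "L (\<lambda>x. f x + g x) = L f + L g" unfolding L_def by (rule limI)
    assume "\<And>x. x \<in> pontryagin_dual \<Longrightarrow> f x \<le> g x"
    then show "L f \<le> L g"
      by (intro LIMSEQ_le[OF L[OF f] L[OF g]]) (use \<Lambda>_mono[OF f g] in blast)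
  qed (rule compact_dual)
  moreover have "L (\<lambda>\<gamma>. Re (\<gamma> k)) = Re (\<phi> k)" for k
    unfolding L_def \<Lambda>_Re by (intro limI tendsto_Re lim)
  moreover have "L (\<lambda>\<gamma>. Im (\<gamma> k)) = Im (\<phi> k)" for k
    unfolding L_def \<Lambda>_Im by (intro limI tendsto_Im lim)
  ultimately show ?thesis by (rule that)
qed

text \<open>The functional accepts real functions only, so complex coefficients are distributed over
  the real and imaginary parts of each monomial.\<close>

lemma positive_functional_trig:
  fixes L :: "(('g::ab_group_add \<Rightarrow> complex) \<Rightarrow> real) \<Rightarrow> real"
  assumes L: "positive_functional pontryagin_dual L"
    and Re: "\<And>k. L (\<lambda>\<gamma>. Re (\<gamma> k)) = Re (\<phi> k)" and Im: "\<And>k. L (\<lambda>\<gamma>. Im (\<gamma> k)) = Im (\<phi> k)"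
    and I: "finite I"
  shows "L (\<lambda>\<gamma>. Re (\<Sum>i\<in>I. c i * \<gamma> (\<kappa> i))) = Re (\<Sum>i\<in>I. c i * \<phi> (\<kappa> i))"
proof -
  interpret positive_functional pontryagin_dual L by fact
  have c: "continuous_on pontryagin_dual (\<lambda>\<gamma>. Re (\<gamma> k))" "continuous_on pontryagin_dual (\<lambda>\<gamma>. Im (\<gamma> k))" for k :: 'g
    by (intro continuous_intros)+
  have "L (\<lambda>\<gamma>. Re (c i) * Re (\<gamma> (\<kappa> i)) + (- Im (c i)) * Im (\<gamma> (\<kappa> i))) = Re (c i * \<phi> (\<kappa> i))" for i
    by (subst add) (auto intro!: continuous_on_mult_left continuous_on_minus c simp: scale[OF c(1)] scale[OF c(2), of "- Im (c i)", simplified] Re Im simp del: mult_minus_left)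
  then have "L (\<lambda>\<gamma>. \<Sum>i\<in>I. Re (c i) * Re (\<gamma> (\<kappa> i)) + (- Im (c i)) * Im (\<gamma> (\<kappa> i))) = (\<Sum>i\<in>I. Re (c i * \<phi> (\<kappa> i)))"
    by (subst sum[OF I]) (auto intro!: continuous_intros c)
  then show ?thesis by simp
qed

text \<open>The analogue of dominated convergence for the spectral measure represented by \<open>\<phi>\<close>, with a
  countable exceptional set of characters that are not atoms of it.\<close>

theorem (in haar_dual) positive_definite_avg_tendsto_0:
  fixes \<phi> :: "'g \<Rightarrow> complex" and F :: "nat \<Rightarrow> 'g set" and b :: "'g \<Rightarrow> 'g"
  assumes F: "Folner F" and \<phi>: "positive_definite \<phi>" and B: "countable B"
    and conv: "\<And>\<gamma>. \<gamma> \<in> pontryagin_dual - B \<Longrightarrow> (\<lambda>N. avg F N (\<lambda>g. \<gamma> (b g))) \<longlonglongrightarrow> 0"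
    and atom: "\<And>\<gamma>. \<gamma> \<in> B \<inter> pontryagin_dual \<Longrightarrow>
      (\<lambda>N. Re (avg F N (\<lambda>g. avg F N (\<lambda>h. cnj (\<gamma> g) * \<gamma> h * \<phi> (g - h))))) \<longlonglongrightarrow> 0"
  shows "(\<lambda>N. avg F N (\<lambda>g. \<phi> (b g))) \<longlonglongrightarrow> 0"
proof -
  obtain L where L: "positive_functional pontryagin_dual L"
    and Re: "\<And>k. L (\<lambda>\<gamma>. Re (\<gamma> k)) = Re (\<phi> k)" and Im: "\<And>k. L (\<lambda>\<gamma>. Im (\<gamma> k)) = Im (\<phi> k)"
    using positive_definite_functional[OF F \<phi>] by blast
  note trig = positive_functional_trig[OF L Re Im]
  have small: "\<exists>a. continuous_on pontryagin_dual a \<and> (\<forall>\<gamma>\<in>pontryagin_dual. 0 \<le> a \<gamma>) \<and> 1 \<le> a \<psi> \<and> L a \<le> e"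
    if \<psi>: "\<psi> \<in> B \<inter> pontryagin_dual" and e: "0 < e" for \<psi> e
  proof -
    obtain N where N: "Re (avg F N (\<lambda>g. avg F N (\<lambda>h. cnj (\<psi> g) * \<psi> h * \<phi> (g - h)))) < e"
      using order_tendstoD(2)[OF atom[OF \<psi>] e] by (auto simp: eventually_sequentially)
    define n where "n = real (card (F N))"
    \<comment> \<open>On the dual this is the squared modulus of the average of
      \<open>cnj (\<psi> g) * \<gamma> g\<close>: nonnegative, equal to 1 at \<open>\<psi>\<close>,
      and with \<open>L a\<close> equal to the double average in \<open>atom\<close>. As in Wiener's
      lemma, such averages detect the mass of the point \<open>\<psi>\<close>.\<close>
    define a where "a \<gamma> = Re (\<Sum>(g, h)\<in>F N \<times> F N. cnj (\<psi> g) * \<psi> h /\<^sub>R n\<^sup>2 * \<gamma> (g - h))" for \<gamma>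
    have fin: "finite (F N \<times> F N)" using FolnerD(1)[OF F] by simp
    have sum_avg: "(\<Sum>(g, h)\<in>F N \<times> F N. cnj (\<psi> g) * \<psi> h /\<^sub>R n\<^sup>2 * u (g - h))
        = avg F N (\<lambda>g. avg F N (\<lambda>h. cnj (\<psi> g) * \<psi> h * u (g - h)))" for u
      by (simp add: avg_def sum.cartesian_product[symmetric] scaleR_sum_right n_def power2_eq_square)
    have "L a = Re (\<Sum>(g, h)\<in>F N \<times> F N. cnj (\<psi> g) * \<psi> h /\<^sub>R n\<^sup>2 * \<phi> (g - h))"
      unfolding a_def using trig[OF fin, of "\<lambda>(g, h). cnj (\<psi> g) * \<psi> h /\<^sub>R n\<^sup>2" "\<lambda>(g, h). g - h"]
      by (simp add: case_prod_unfold)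
    then have "L a \<le> e" using N by (simp only: sum_avg)
    moreover have a_eq: "a \<gamma> = (cmod (avg F N (\<lambda>g. cnj (\<psi> g) * \<gamma> g)))\<^sup>2" if \<gamma>: "\<gamma> \<in> pontryagin_dual" for \<gamma>
    proof -
      have "complex_of_real ((cmod (avg F N (\<lambda>g. cnj (\<psi> g) * \<gamma> g)))\<^sup>2)
        = avg F N (\<lambda>g. cnj (\<psi> g) * \<gamma> g) * avg F N (\<lambda>g. \<psi> g * cnj (\<gamma> g))"
        unfolding complex_norm_square by (simp add: avg_def scaleR_conv_of_real)
      also have "\<dots> = avg F N (\<lambda>g. avg F N (\<lambda>h. cnj (\<psi> g) * \<psi> h * \<gamma> (g - h)))"
        by (simp add: avg_def sum_product scaleR_sum_right dualD(5)[OF \<gamma>] mult_ac)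
      finally show ?thesis unfolding a_def sum_avg by (metis Re_complex_of_real)
    qed
    moreover have "avg F N (\<lambda>g. cnj (\<psi> g) * \<psi> g) = 1"
      using avg_const[OF F, of N "1::complex"] dualD(6)[of \<psi>] \<psi> by (simp add: mult.commute)
    then have "a \<psi> = 1" using a_eq[of \<psi>] \<psi> by simp
    moreover have "continuous_on pontryagin_dual a"
      unfolding a_def case_prod_unfold by (intro continuous_intros)
    ultimately show ?thesis by (intro exI[of _ a]) auto
  qed
  have le1: "\<bar>Re (avg F N (\<lambda>g. \<gamma> (b g)))\<bar> \<le> 1" "\<bar>Im (avg F N (\<lambda>g. \<gamma> (b g)))\<bar> \<le> 1"
    if \<gamma>: "\<gamma> \<in> pontryagin_dual" for N and \<gamma> :: "'g \<Rightarrow> complex"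
    using norm_avg_le[OF F, of "\<lambda>g. \<gamma> (b g)" 1 N] dualD(2)[OF \<gamma>] abs_Re_le_cmod abs_Im_le_cmod
    by (auto intro: order_trans)
  have cont: "continuous_on pontryagin_dual (\<lambda>\<gamma>. Re (avg F N (\<lambda>g. \<gamma> (b g))))"
    "continuous_on pontryagin_dual (\<lambda>\<gamma>. Im (avg F N (\<lambda>g. \<gamma> (b g))))" for N
    unfolding avg_def by (intro continuous_intros)+
  have weighted: "(\<Sum>g\<in>F N. z * inverse (complex_of_nat (card (F N))) * u g) = z * avg F N u" for N z and u :: "'g \<Rightarrow> complex"
    by (simp add: avg_def scaleR_conv_of_real sum_distrib_left mult.assoc)
  have L_Re: "L (\<lambda>\<gamma>. Re (avg F N (\<lambda>g. \<gamma> (b g)))) = Re (avg F N (\<lambda>g. \<phi> (b g)))" for N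
    using trig[OF FolnerD(1)[OF F, of N], of "\<lambda>_. 1 * inverse (complex_of_nat (card (F N)))" b]
    unfolding weighted by simp
  \<comment> \<open>The coefficient \<open>- \<i>\<close> turns the real part taken in
    \<open>trig\<close> into an imaginary part.\<close>
  have L_Im: "L (\<lambda>\<gamma>. Im (avg F N (\<lambda>g. \<gamma> (b g)))) = Im (avg F N (\<lambda>g. \<phi> (b g)))" for N
    using trig[OF FolnerD(1)[OF F, of N], of "\<lambda>_. - \<i> * inverse (complex_of_nat (card (F N)))" b]
    unfolding weighted by simp
  have "(\<lambda>N. Re (avg F N (\<lambda>g. \<phi> (b g)))) \<longlonglongrightarrow> 0"
    unfolding L_Re[symmetric]
    by (rule positive_functional.bounded_convergence[OF L cont(1) le1(1) B _ small])
       (use tendsto_Re[OF conv] in simp_all)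
  moreover have "(\<lambda>N. Im (avg F N (\<lambda>g. \<phi> (b g)))) \<longlonglongrightarrow> 0"
    unfolding L_Im[symmetric]
    by (rule positive_functional.bounded_convergence[OF L cont(2) le1(2) B _ small])
       (use tendsto_Im[OF conv] in simp_all)
  ultimately show ?thesis by (simp add: tendsto_complex_iff)
qed

text \<open>Inner regularity provides a compact set outside \<open>A\<close> carrying
  \<open>\<sigma>\<close> up to \<open>e\<close> and a compact set inside \<open>A\<close> carrying
  \<open>m\<close> up to \<open>e\<close>. They are disjoint, and a Urysohn function that is 1 on
  the first and 0 on the second has both properties.\<close>

lemma singular_dual_separation:
  fixes \<sigma> m :: "('g::{ab_group_add, countable} \<Rightarrow> complex) measure"
  assumes \<sigma>: "finite_measure \<sigma>" "sets \<sigma> = sets dual_borel"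
    and m: "finite_measure m" "sets m = sets dual_borel"
    and A: "A \<in> sets \<sigma>" "emeasure \<sigma> A = 0" "emeasure m (space m - A) = 0" and e: "e > 0"
  obtains f where "continuous_on pontryagin_dual f"
    "(\<integral>\<gamma>. (1 - f \<gamma>)\<^sup>2 \<partial>\<sigma>) \<le> e" "(\<integral>\<gamma>. (f \<gamma>)\<^sup>2 \<partial>m) \<le> (e::real)"
proof -
  let ?G = "pontryagin_dual :: ('g \<Rightarrow> complex) set"
  have G: "?G \<in> sets borel" using closed_dual by (rule borel_closed)
  have sets_iff: "X \<in> sets dual_borel \<longleftrightarrow> X \<subseteq> ?G \<and> X \<in> sets borel" for X
    by (rule sets_restrict_space_iff) (use G in simp)
  have AG: "A \<subseteq> ?G" "A \<in> sets borel" using A(1) unfolding \<sigma>(2) sets_iff by auto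
  have approx: "\<exists>C. compact C \<and> C \<subseteq> X \<and> measure \<tau> (?G - C) \<le> e"
    if \<tau>: "finite_measure \<tau>" "sets \<tau> = sets dual_borel" and X: "X \<subseteq> ?G" "X \<in> sets borel"
      and null: "emeasure \<tau> (?G - X) = 0" for \<tau> X
  proof -
    interpret finite_measure \<tau> by fact
    have sp: "space \<tau> = ?G" by (rule dual_borel_space[OF \<tau>(2)])
    have id: "(\<lambda>x. x) \<in> measurable \<tau> borel"
      using measurable_cong_sets[OF \<tau>(2) refl] by (metis borel_measurable_continuous_on_restrict continuous_on_id)
    have em: "emeasure (distr \<tau> borel (\<lambda>x. x)) Y = emeasure \<tau> (Y \<inter> ?G)" if "Y \<in> sets borel" for Y
      using that id by (simp add: emeasure_distr sp)
    \<comment> \<open>Inner regularity is invoked on the whole space of functions from the group to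
      the complex numbers, which is Polish as the group is countable; hence the pushforward under
      the inclusion.\<close>
    have "emeasure (distr \<tau> borel (\<lambda>x. x)) X = (SUP K \<in> {K. K \<subseteq> X \<and> compact K}. emeasure (distr \<tau> borel (\<lambda>x. x)) K)"
    proof (rule inner_regular)
      have "emeasure (distr \<tau> borel (\<lambda>x. x)) UNIV = emeasure \<tau> ?G" by (subst em) auto
      then show "emeasure (distr \<tau> borel (\<lambda>x. x)) (space (distr \<tau> borel (\<lambda>x. x))) \<noteq> \<infinity>"
        by simp
    qed (use X in auto)
    moreover have "emeasure (distr \<tau> borel (\<lambda>x. x)) X = emeasure \<tau> X"
      using X by (simp add: em Int_absorb2)
    moreover have "emeasure (distr \<tau> borel (\<lambda>x. x)) K = emeasure \<tau> K" if "K \<subseteq> X" "compact K" for K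
      using that X by (subst em) (auto intro: borel_closed compact_imp_closed simp: Int_absorb2)
    ultimately have sup: "emeasure \<tau> X = (SUP K \<in> {K. K \<subseteq> X \<and> compact K}. emeasure \<tau> K)"
      by (metis (mono_tags, lifting) SUP_cong mem_Collect_eq)
    have Xs: "X \<in> sets \<tau>" using X unfolding \<tau>(2) sets_iff by auto
    have total: "measure \<tau> X = measure \<tau> ?G"
    proof -
      have "measure \<tau> (?G - X) = 0" using null by (simp add: measure_def)
      then show ?thesis using finite_measure_compl[OF Xs] by (simp add: sp)
    qed
    have "\<exists>K. K \<subseteq> X \<and> compact K \<and> measure \<tau> X - e < measure \<tau> K"
    proof (rule ccontr)
      assume "\<not> ?thesis"
      then have le: "measure \<tau> K \<le> measure \<tau> X - e" if "K \<subseteq> X" "compact K" for K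
        using that by (meson not_less)
      from le[of "{}"] have "measure \<tau> X - e \<ge> 0" by simp
      have "emeasure \<tau> X \<le> ennreal (measure \<tau> X - e)"
        unfolding sup by (intro SUP_least) (auto simp: emeasure_eq_measure intro!: ennreal_leI le)
      then have "measure \<tau> X \<le> measure \<tau> X - e"
        using \<open>measure \<tau> X - e \<ge> 0\<close> by (simp add: emeasure_eq_measure)
      then show False using e by simp
    qed
    then obtain K where K: "K \<subseteq> X" "compact K" "measure \<tau> X - e < measure \<tau> K" by blast
    have "K \<in> sets \<tau>"
      using K X unfolding \<tau>(2) sets_iff by (auto intro: borel_closed compact_imp_closed)
    then have "measure \<tau> (?G - K) = measure \<tau> ?G - measure \<tau> K"
      using finite_measure_compl[of K] by (simp add: sp)
    then show ?thesis using K total by (intro exI[of _ K]) auto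
  qed
  obtain C where C: "compact C" "C \<subseteq> ?G - A" "measure \<sigma> (?G - C) \<le> e"
    using approx[OF \<sigma>, of "?G - A"] AG G A(2) by (auto simp: double_diff)
  obtain D where D: "compact D" "D \<subseteq> A" "measure m (?G - D) \<le> e"
    using approx[OF m AG] A(3) by (auto simp: dual_borel_space[OF m(2)])
  have "normal_space (euclidean :: ('g \<Rightarrow> complex) topology)"
    by (intro metrizable_imp_normal_space metrizable_space_euclidean)
  then obtain f where f: "continuous_map euclidean (top_of_set {0..1::real}) f" "f ` D \<subseteq> {0}" "f ` C \<subseteq> {1}"
    using Urysohn_lemma[of euclidean D C 0 1] C D compact_imp_closed by (auto simp: disjnt_def) blast
  then have cont: "continuous_on X f" for X
    by (auto simp: continuous_map_in_subtopology intro: continuous_on_subset)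
  have f01: "0 \<le> f x" "f x \<le> 1" for x
    using f(1) by (auto simp: continuous_map_in_subtopology image_subset_iff Pi_iff)
  have bound: "(\<integral>\<gamma>. u \<gamma> \<partial>\<tau>) \<le> measure \<tau> (?G - K)"
    if \<tau>: "finite_measure \<tau>" "sets \<tau> = sets dual_borel" and K: "compact K" "K \<subseteq> ?G"
      and u: "continuous_on ?G u" "\<And>x. u x \<le> 1" "\<And>x. x \<in> K \<Longrightarrow> u x = 0" for \<tau> K and u :: "_ \<Rightarrow> real"
  proof -
    interpret finite_measure \<tau> by fact
    have "K \<in> sets \<tau>" using K unfolding \<tau>(2) sets_iff by (auto intro: borel_closed compact_imp_closed)
    then have GK: "?G - K \<in> sets \<tau>" using dual_borel_space[OF \<tau>(2)] by (metis sets.compl_sets)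
    have "(\<integral>\<gamma>. u \<gamma> \<partial>\<tau>) \<le> (\<integral>\<gamma>. indicator (?G - K) \<gamma> \<partial>\<tau>)"
    proof (rule integral_mono)
      show "integrable \<tau> u" by (rule dual_continuous_integrable[OF \<tau> u(1)])
      show "integrable \<tau> (indicator (?G - K) :: _ \<Rightarrow> real)"
        using GK by (simp add: emeasure_eq_measure)
      show "u \<gamma> \<le> indicator (?G - K) \<gamma>" if "\<gamma> \<in> space \<tau>" for \<gamma>
        using u(2)[of \<gamma>] u(3)[of \<gamma>] that dual_borel_space[OF \<tau>(2)] by (auto simp: indicator_def)
    qed
    then show ?thesis using GK by simp
  qed
  have "(\<integral>\<gamma>. (1 - f \<gamma>)\<^sup>2 \<partial>\<sigma>) \<le> measure \<sigma> (?G - C)"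
    using C(2) f f01 by (intro bound \<sigma> C(1) continuous_intros cont) (auto simp: power_le_one)
  moreover have "(\<integral>\<gamma>. (f \<gamma>)\<^sup>2 \<partial>m) \<le> measure m (?G - D)"
    using D(2) AG f f01 by (intro bound m D(1) continuous_intros cont) (auto simp: power_le_one)
  ultimately show ?thesis using that[OF cont] C(3) D(3) by fastforce
qed

text \<open>A trigonometric polynomial uniformly close to the separating function inherits both
  estimates, and Parseval reads the second one as a bound on its coefficients.\<close>

lemma (in haar_dual) singular_trig_approx:
  assumes \<sigma>: "finite_measure \<sigma>" "sets \<sigma> = sets dual_borel"
    and A: "A \<in> sets \<sigma>" "emeasure \<sigma> A = 0" "emeasure m (space m - A) = 0" and e: "e > 0"
  obtains D c where "finite D" "(\<integral>\<gamma>. (cmod (1 - (\<Sum>k\<in>D. c k * \<gamma> k)))\<^sup>2 \<partial>\<sigma>) \<le> e"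
    "(\<Sum>k\<in>D. (cmod (c k))\<^sup>2) \<le> e"
proof -
  define s where "s = measure \<sigma> (space \<sigma>) + 1"
  have s: "s \<ge> 1" by (simp add: s_def)
  \<comment> \<open>Since \<open>s\<close> bounds the mass of both measures, the uniform error costs
    \<open>\<delta>^2 * s = e / 4\<close>; together with the \<open>e / 4\<close> from the
    separation, each doubled, this gives \<open>e\<close>.\<close>
  define \<delta> where "\<delta> = sqrt (e / (4 * s))"
  have \<delta>: "\<delta> > 0" "\<delta>\<^sup>2 * s = e / 4" using e s by (auto simp: \<delta>_def)
  have "e / 4 > 0" using e by simp
  then obtain f where f: "continuous_on pontryagin_dual f"
    "(\<integral>\<gamma>. (1 - f \<gamma>)\<^sup>2 \<partial>\<sigma>) \<le> e / 4" "(\<integral>\<gamma>. (f \<gamma>)\<^sup>2 \<partial>m) \<le> e / 4"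
    by (rule singular_dual_separation[OF \<sigma> finite_measure_axioms haar_sets A])
  obtain q where q: "continuous_on pontryagin_dual q" "trig (\<lambda>\<gamma>. complex_of_real (q \<gamma>))"
    and fq: "\<And>\<gamma>. \<gamma> \<in> pontryagin_dual \<Longrightarrow> \<bar>f \<gamma> - q \<gamma>\<bar> < \<delta>"
    using trig_Stone_Weierstrass[OF f(1) \<delta>(1)] by metis
  obtain D c where D: "finite D" and qc: "\<And>\<gamma>. \<gamma> \<in> pontryagin_dual \<Longrightarrow> complex_of_real (q \<gamma>) = (\<Sum>k\<in>D. c k * \<gamma> k)"
    using q(2) unfolding trig_def by metis
  have le: "(\<integral>\<gamma>. (v \<gamma>)\<^sup>2 \<partial>\<tau>) \<le> e"
    if \<tau>: "finite_measure \<tau>" "sets \<tau> = sets dual_borel" "measure \<tau> (space \<tau>) \<le> s"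
      and u: "continuous_on pontryagin_dual u" "(\<integral>\<gamma>. (u \<gamma>)\<^sup>2 \<partial>\<tau>) \<le> e / 4"
      and v: "continuous_on pontryagin_dual v" "\<And>\<gamma>. \<gamma> \<in> pontryagin_dual \<Longrightarrow> \<bar>v \<gamma> - u \<gamma>\<bar> < \<delta>" for \<tau> and u v :: "_ \<Rightarrow> real"
  proof -
    interpret \<tau>: finite_measure \<tau> by fact
    note int = dual_continuous_integrable[OF \<tau>(1,2)]
    have "(\<integral>\<gamma>. (v \<gamma>)\<^sup>2 \<partial>\<tau>) \<le> (\<integral>\<gamma>. 2 * (u \<gamma>)\<^sup>2 + 2 * \<delta>\<^sup>2 \<partial>\<tau>)"
    proof (intro integral_mono int continuous_intros u v)
      fix \<gamma> assume "\<gamma> \<in> space \<tau>"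
      then have "\<bar>v \<gamma> - u \<gamma>\<bar> \<le> \<delta>" using v(2) dual_borel_space[OF \<tau>(2)] by (metis less_imp_le)
      then have "(v \<gamma> - u \<gamma>)\<^sup>2 \<le> \<delta>\<^sup>2" by (metis abs_ge_zero power2_abs power_mono)
      \<comment> \<open>\<open>2 u^2 + 2 (v - u)^2 - v^2\<close> is exactly this square.\<close>
      moreover have "0 \<le> (v \<gamma> - 2 * u \<gamma>)\<^sup>2" by simp
      ultimately show "(v \<gamma>)\<^sup>2 \<le> 2 * (u \<gamma>)\<^sup>2 + 2 * \<delta>\<^sup>2"
        by (simp add: power2_eq_square algebra_simps)
    qed
    also have "\<dots> = 2 * (\<integral>\<gamma>. (u \<gamma>)\<^sup>2 \<partial>\<tau>) + 2 * \<delta>\<^sup>2 * measure \<tau> (space \<tau>)"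
      by (subst Bochner_Integration.integral_add) (auto intro!: int continuous_intros u)
    also have "\<dots> \<le> 2 * (e / 4) + 2 * \<delta>\<^sup>2 * s"
      using u(2) \<tau>(3) by (intro add_mono mult_left_mono) auto
    also have "\<dots> = e" using \<delta>(2) by simp
    finally show ?thesis .
  qed
  have "(\<integral>\<gamma>. (cmod (1 - (\<Sum>k\<in>D. c k * \<gamma> k)))\<^sup>2 \<partial>\<sigma>) = (\<integral>\<gamma>. (1 - q \<gamma>)\<^sup>2 \<partial>\<sigma>)"
  proof (intro Bochner_Integration.integral_cong refl)
    fix \<gamma> assume "\<gamma> \<in> space \<sigma>"
    then have "1 - (\<Sum>k\<in>D. c k * \<gamma> k) = complex_of_real (1 - q \<gamma>)"
      using qc dual_borel_space[OF \<sigma>(2)] by auto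
    then show "(cmod (1 - (\<Sum>k\<in>D. c k * \<gamma> k)))\<^sup>2 = (1 - q \<gamma>)\<^sup>2"
      by (simp only: norm_of_real power2_abs)
  qed
  also have "\<dots> \<le> e"
    using fq by (intro le[OF \<sigma> _ _ f(2)] continuous_intros f q) (auto simp: s_def)
  finally have 1: "(\<integral>\<gamma>. (cmod (1 - (\<Sum>k\<in>D. c k * \<gamma> k)))\<^sup>2 \<partial>\<sigma>) \<le> e" .
  have "(\<Sum>k\<in>D. (cmod (c k))\<^sup>2) = (\<integral>\<gamma>. (q \<gamma>)\<^sup>2 \<partial>m)"
    unfolding parseval[OF D, symmetric]
    by (rule integral_cong_dual) (simp add: qc[symmetric])
  also have "\<dots> \<le> e"
    using fq s by (intro le[OF finite_measure_axioms haar_sets _ _ f(3)] f q) (auto simp: prob_space abs_minus_commute)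
  finally show ?thesis using that[OF D 1] by blast
qed


section \<open>Asymptotically orthogonal factors\<close>

context prob_space
begin

lemma mean_sq_sum:
  assumes "finite I" "\<And>i. i \<in> I \<Longrightarrow> u i \<in> Linf M"
  shows "complex_of_real (mean_sq M (\<lambda>x. \<Sum>i\<in>I. c i * u i x))
    = (\<Sum>i\<in>I. \<Sum>j\<in>I. c i * cnj (c j) * L2_inner M (u i) (u j))"
proof -
  have "complex_of_real (mean_sq M (\<lambda>x. \<Sum>i\<in>I. c i * u i x))
      = (\<integral>x. complex_of_real ((cmod (\<Sum>i\<in>I. c i * u i x))\<^sup>2) \<partial>M)"
    unfolding mean_sq_def by (simp only: integral_complex_of_real)
  also have "\<dots> = (\<integral>x. (\<Sum>i\<in>I. \<Sum>j\<in>I. c i * cnj (c j) * (u i x * cnj (u j x))) \<partial>M)"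
    unfolding complex_norm_square cnj_sum sum_product by (simp add: mult_ac)
  also have "\<dots> = (\<Sum>i\<in>I. \<Sum>j\<in>I. c i * cnj (c j) * L2_inner M (u i) (u j))"
  proof -
    have int: "integrable M (\<lambda>x. c i * cnj (c j) * (u i x * cnj (u j x)))" if "i \<in> I" "j \<in> I" for i j
      using that assms(2) by (intro Linf_integrable Linf_cmult Linf_mult Linf_cnj)
    have "(\<integral>x. (\<Sum>i\<in>I. \<Sum>j\<in>I. c i * cnj (c j) * (u i x * cnj (u j x))) \<partial>M)
        = (\<Sum>i\<in>I. \<integral>x. (\<Sum>j\<in>I. c i * cnj (c j) * (u i x * cnj (u j x))) \<partial>M)"
      by (intro Bochner_Integration.integral_sum Bochner_Integration.integrable_sum int)
    also have "\<dots> = (\<Sum>i\<in>I. \<Sum>j\<in>I. \<integral>x. c i * cnj (c j) * (u i x * cnj (u j x)) \<partial>M)"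
      by (intro sum.cong refl Bochner_Integration.integral_sum int)
    finally show ?thesis by (simp add: L2_inner_def)
  qed
  finally show ?thesis .
qed

lemma L2_inner_bound:
  assumes "f \<in> Linf M" "g \<in> Linf M" "AE x in M. cmod (f x) \<le> a" "AE x in M. cmod (g x) \<le> b"
  shows "cmod (L2_inner M f g) \<le> a * b"
proof -
  have "AE x in M. cmod (f x * cnj (g x)) \<le> a * b"
    using assms(3,4) by eventually_elim (auto simp: norm_mult intro!: mult_mono order_trans[OF norm_ge_zero])
  moreover have "integrable M (\<lambda>x. f x * cnj (g x))"
    by (intro Linf_integrable Linf_mult Linf_cnj assms)
  ultimately have "cmod (\<integral>x. f x * cnj (g x) \<partial>M) \<le> (\<integral>x. a * b \<partial>M)"
    by (intro order_trans[OF integral_norm_bound] integral_mono_AE integrable_norm) auto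
  then show ?thesis by (simp add: L2_inner_def prob_space)
qed

end

context mp_system
begin

text \<open>The Gram matrix of the translates depends only on differences, so it can be compared
  with integrals of characters and with positive definite functions.\<close>

lemma mean_sq_koopman_sum:
  assumes "finite I" "f \<in> Linf M"
  shows "complex_of_real (mean_sq M (\<lambda>x. \<Sum>i\<in>I. c i * koopman M T (\<kappa> i) f x))
    = (\<Sum>i\<in>I. \<Sum>j\<in>I. c i * cnj (c j) * L2_inner M (koopman M T (\<kappa> i - \<kappa> j) f) f)"
  using mean_sq_sum[OF assms(1) koopman_Linf[OF assms(2)]] by (simp add: inner_koopman[OF assms(2) assms(2)])

lemma koopman_positive_definite:
  assumes f: "f \<in> Linf M"
  shows "positive_definite (\<lambda>k. L2_inner M (koopman M T k f) f)"
  unfolding positive_definite_def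
proof (intro conjI allI impI)
  fix k
  have "L2_inner M (koopman M T (- k) f) f = L2_inner M (koopman M T 0 f) (koopman M T k f)"
    using inner_koopman[OF f f, of 0 k] by simp
  also have "\<dots> = (\<integral>x. cnj (koopman M T k f x * cnj (f x)) \<partial>M)"
    unfolding L2_inner_def
    by (intro Bochner_Integration.integral_cong refl) (simp add: koopman_eq action_0)
  also have "\<dots> = cnj (L2_inner M (koopman M T k f) f)"
    unfolding L2_inner_def by (rule Bochner_Integration.integral_cnj)
  finally show "L2_inner M (koopman M T (- k) f) f = cnj (L2_inner M (koopman M T k f) f)" .
next
  fix D :: "'g set" and c :: "'g \<Rightarrow> complex" assume "finite D"
  from mean_sq_koopman_sum[OF this f, of c "\<lambda>x. x"]
  show "0 \<le> Re (\<Sum>g\<in>D. \<Sum>h\<in>D. c g * cnj (c h) * L2_inner M (koopman M T (g - h) f) f)"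
    by (metis Re_complex_of_real mean_sq_nonneg)
qed

text \<open>Restates the absence of an atom dynamically: the twisted double average of correlations
  is the mean square of the twisted ergodic average of \<open>f\<close>, so an ergodic theorem can
  supply it.\<close>

theorem correlation_avg_tendsto_0:
  fixes F :: "nat \<Rightarrow> 'g set" and b :: "'g \<Rightarrow> 'g"
  assumes m: "haar_dual (m :: ('g \<Rightarrow> complex) measure)"
    and F: "Folner F" and f: "f \<in> Linf M" and B: "countable B"
    and conv: "\<And>\<gamma>. \<gamma> \<in> pontryagin_dual - B \<Longrightarrow> (\<lambda>N. avg F N (\<lambda>g. \<gamma> (b g))) \<longlonglongrightarrow> 0"
    and atom: "\<And>\<gamma>. \<gamma> \<in> B \<inter> pontryagin_dual \<Longrightarrow>
      (\<lambda>N. mean_sq M (\<lambda>x. avg F N (\<lambda>g. cnj (\<gamma> g) * koopman M T g f x))) \<longlonglongrightarrow> 0"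
  shows "(\<lambda>N. avg F N (\<lambda>g. L2_inner M (koopman M T (b g) f) f)) \<longlonglongrightarrow> 0"
proof (rule haar_dual.positive_definite_avg_tendsto_0[OF m F koopman_positive_definite[OF f] B conv])
  fix \<gamma> assume \<gamma>: "\<gamma> \<in> B \<inter> pontryagin_dual"
  have "Re (avg F N (\<lambda>g. avg F N (\<lambda>h. cnj (\<gamma> g) * \<gamma> h * L2_inner M (koopman M T (g - h) f) f)))
      = mean_sq M (\<lambda>x. avg F N (\<lambda>g. cnj (\<gamma> g) * koopman M T g f x))" for N
  proof -
    let ?r = "inverse (complex_of_nat (card (F N)))"
    have "avg F N (\<lambda>g. avg F N (\<lambda>h. cnj (\<gamma> g) * \<gamma> h * L2_inner M (koopman M T (g - h) f) f))
        = (\<Sum>g\<in>F N. \<Sum>h\<in>F N. (?r * cnj (\<gamma> g)) * cnj (?r * cnj (\<gamma> h)) * L2_inner M (koopman M T (g - h) f) f)"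
      by (simp add: avg_def scaleR_conv_of_real sum_distrib_left mult_ac)
    also have "\<dots> = complex_of_real (mean_sq M (\<lambda>x. \<Sum>g\<in>F N. ?r * cnj (\<gamma> g) * koopman M T g f x))"
      by (rule mean_sq_koopman_sum[OF FolnerD(1)[OF F] f, symmetric])
    also have "(\<lambda>x. \<Sum>g\<in>F N. ?r * cnj (\<gamma> g) * koopman M T g f x) = (\<lambda>x. avg F N (\<lambda>g. cnj (\<gamma> g) * koopman M T g f x))"
      by (simp add: avg_def scaleR_conv_of_real sum_distrib_left mult.assoc)
    finally show ?thesis by simp
  qed
  then show "(\<lambda>N. Re (avg F N (\<lambda>g. avg F N (\<lambda>h. cnj (\<gamma> g) * \<gamma> h * L2_inner M (koopman M T (g - h) f) f)))) \<longlonglongrightarrow> 0"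
    using atom[OF \<gamma>] by simp
qed

text \<open>Replace \<open>f\<close> by \<open>\<Sum>k\<in>D. c k * T\<^sub>k f\<close> and move the shifts to the other factor: the
  second moments of \<open>\<Sum>k\<in>D. c k * w (g - k)\<close> average to about
  \<open>\<Sum>k\<in>D. \<bar>c k\<bar>\<^sup>2\<close>, as the \<open>w g\<close> are asymptotically orthogonal.\<close>

theorem product_avg_tendsto_0:
  fixes F :: "nat \<Rightarrow> 'g set"
  assumes F: "Folner F" and f: "f \<in> Linf M"
    and approx: "\<And>e. e > 0 \<Longrightarrow> \<exists>D c. finite D \<and>
      mean_sq M (\<lambda>x. f x - (\<Sum>k\<in>D. c k * koopman M T k f x)) \<le> e \<and> (\<Sum>k\<in>D. (cmod (c k))\<^sup>2) \<le> e"
    and w: "\<And>g. w g \<in> Linf M" and w_bound: "AE x in M. \<forall>g. cmod (w g x) \<le> C"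
    and corr: "\<And>h. h \<noteq> 0 \<Longrightarrow> (\<lambda>N. avg F N (\<lambda>g. L2_inner M (w (g + h)) (w g))) \<longlonglongrightarrow> 0"
  shows "(\<lambda>N. mean_sq M (\<lambda>x. avg F N (\<lambda>g. koopman M T g f x * w g x))) \<longlonglongrightarrow> 0"
proof (rule LIMSEQ_I)
  fix e :: real assume "e > 0"
  obtain C1 where C1: "C1 > 0" "AE x in M. cmod (f x) \<le> C1" using LinfE[OF f] .
  have Uf: "AE x in M. \<forall>g. cmod (koopman M T g f x) \<le> C1" by (rule koopman_bound[OF C1(2)])
  have wb: "AE x in M. cmod (w g x) \<le> C" for g using w_bound by eventually_elim auto
  \<comment> \<open>\<open>2 * C^2\<close> comes from the approximation error and
    \<open>4 * C1^2 * C^2\<close> from the diagonal of the main term, each multiplying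
    \<open>e / (2 * K)\<close>; the summand 1 keeps \<open>K\<close> positive.\<close>
  define K where "K = 2 * C\<^sup>2 + 4 * C1\<^sup>2 * C\<^sup>2 + 1"
  have K: "K > 0" by (simp add: K_def add_nonneg_pos)
  obtain D c where D: "finite D" and r_small: "mean_sq M (\<lambda>x. f x - (\<Sum>k\<in>D. c k * koopman M T k f x)) \<le> e / (2 * K)"
    and c_small: "(\<Sum>k\<in>D. (cmod (c k))\<^sup>2) \<le> e / (2 * K)"
    using approx[of "e / (2 * K)"] \<open>e > 0\<close> K by auto
  define r where "r = (\<lambda>x. f x - (\<Sum>k\<in>D. c k * koopman M T k f x))"
  have rL: "r \<in> Linf M" unfolding r_def by (intro Linf_diff Linf_sum Linf_cmult koopman_Linf f)
  have r_sq: "mean_sq M r \<le> e / (2 * K)" using r_small by (simp add: r_def)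
  define u where "u N x = avg F N (\<lambda>g. koopman M T g f x * w g x)" for N x
  define a where "a N x = avg F N (\<lambda>g. koopman M T g r x * w g x)" for N x
  define v where "v g x = (\<Sum>k\<in>D. c k * w (g - k) x)" for g x
  define b where "b N x = avg F N (\<lambda>g. koopman M T g f x * v g x)" for N x
  have vL: "v g \<in> Linf M" for g unfolding v_def by (intro Linf_sum Linf_cmult w)
  have uL: "u N \<in> Linf M" and aL: "a N \<in> Linf M" and bL: "b N \<in> Linf M" for N
    unfolding u_def a_def b_def by (intro Linf_avg Linf_mult koopman_Linf f rL w vL)+
  have a_small: "mean_sq M (a N) \<le> C\<^sup>2 * (e / (2 * K))" for N
  proof -
    have "mean_sq M (a N) \<le> avg F N (\<lambda>g. mean_sq M (\<lambda>x. koopman M T g r x * w g x))"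
      unfolding a_def by (intro mean_sq_avg_le[OF F] Linf_mult koopman_Linf rL w)
    also have "\<dots> \<le> avg F N (\<lambda>g. C\<^sup>2 * (e / (2 * K)))"
    proof -
      have "mean_sq M (\<lambda>x. koopman M T g r x * w g x) \<le> C\<^sup>2 * (e / (2 * K))" for g
      proof -
        have "mean_sq M (\<lambda>x. w g x * koopman M T g r x) \<le> C\<^sup>2 * mean_sq M (koopman M T g r)"
          by (rule mean_sq_mult_le[OF koopman_Linf[OF rL] w wb])
        also have "\<dots> \<le> C\<^sup>2 * (e / (2 * K))"
          using r_sq by (intro mult_left_mono) (simp_all add: mean_sq_koopman[OF Linf_measurable[OF rL]])
        finally show ?thesis by (simp add: mult.commute)
      qed
      then show ?thesis unfolding avg_def by (intro scaleR_left_mono sum_mono) auto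
    qed
    finally show ?thesis by (simp add: avg_const[OF F])
  qed
  define R where "R N = (\<Sum>k\<in>D. cmod (c k) * (C1 * C * folner_ratio F k N))" for N
  have "R \<longlonglongrightarrow> (\<Sum>k\<in>D. cmod (c k) * (C1 * C * 0))"
    unfolding R_def by (intro tendsto_intros folner_ratio_tendsto F)
  then have R_lim: "R \<longlonglongrightarrow> 0" by simp
  have uab: "mean_sq M (\<lambda>x. u N x - a N x - b N x) \<le> (R N)\<^sup>2" for N
  proof (intro mean_sq_le Linf_diff uL aL bL)
    show "AE x in M. cmod (u N x - a N x - b N x) \<le> R N"
      using Uf w_bound AE_space
    proof eventually_elim
      case (elim x)
      have "koopman M T g f x - koopman M T g r x = (\<Sum>k\<in>D. c k * koopman M T (g + k) f x)" for g
      proof -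
        have "koopman M T g f x - koopman M T g r x = (\<Sum>k\<in>D. c k * koopman M T g (koopman M T k f) x)"
          using elim(3) by (simp add: koopman_eq r_def)
        then show ?thesis by (simp add: koopman_add[OF elim(3)])
      qed
      then have "u N x - a N x = avg F N (\<lambda>g. \<Sum>k\<in>D. c k * (koopman M T (g + k) f x * w (g + k - k) x))"
        unfolding u_def a_def avg_diff[symmetric]
        by (simp add: sum_distrib_right mult.assoc flip: left_diff_distrib)
      also have "\<dots> = (\<Sum>k\<in>D. c k * avg F N (\<lambda>g. koopman M T (g + k) f x * w (g + k - k) x))"
        by (simp only: avg_sum avg_mult_left)
      finally have ua: "u N x - a N x = (\<Sum>k\<in>D. c k * avg F N (\<lambda>g. koopman M T (g + k) f x * w (g + k - k) x))" .
      have "b N x = avg F N (\<lambda>g. \<Sum>k\<in>D. c k * (koopman M T g f x * w (g - k) x))"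
        unfolding b_def v_def by (simp add: sum_distrib_left mult_ac)
      also have "\<dots> = (\<Sum>k\<in>D. c k * avg F N (\<lambda>g. koopman M T g f x * w (g - k) x))"
        by (simp only: avg_sum avg_mult_left)
      finally have "u N x - a N x - b N x = (\<Sum>k\<in>D. c k * (avg F N (\<lambda>g. koopman M T (g + k) f x * w (g + k - k) x)
          - avg F N (\<lambda>g. koopman M T g f x * w (g - k) x)))"
        unfolding ua by (simp only: sum_subtractf[symmetric] right_diff_distrib)
      also have "cmod \<dots> \<le> R N"
        unfolding R_def norm_mult[symmetric]
      proof (intro sum_norm_le)
        fix k assume "k \<in> D"
        have "cmod (avg F N (\<lambda>g. koopman M T (g + k) f x * w (g + k - k) x) - avg F N (\<lambda>g. koopman M T g f x * w (g - k) x))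
            \<le> C1 * C * folner_ratio F k N"
          using elim(1,2) C1
          by (intro avg_shift[OF F, of "\<lambda>g. koopman M T g f x * w (g - k) x"]) (auto simp: norm_mult intro!: mult_mono)
        then show "cmod (c k * (avg F N (\<lambda>g. koopman M T (g + k) f x * w (g + k - k) x) - avg F N (\<lambda>g. koopman M T g f x * w (g - k) x)))
            \<le> cmod (c k) * (C1 * C * folner_ratio F k N)"
          by (simp add: norm_mult mult_left_mono)
      qed
      finally show ?case .
    qed
  qed
  \<comment> \<open>The off-diagonal part of the mean squares of \<open>v\<close>. The diagonal is
    bounded separately by \<open>C^2\<close> times the sum of the squared coefficients.\<close>
  define E where "E N = (\<Sum>k\<in>D. \<Sum>l\<in>D. if k = l then 0 else
      cmod (c k) * cmod (c l) * cmod (avg F N (\<lambda>g. L2_inner M (w (g - k)) (w (g - l)))))" for N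
  have E_lim: "E \<longlonglongrightarrow> 0"
  proof -
    have "(\<lambda>N. avg F N (\<lambda>g. L2_inner M (w (g - k)) (w (g - l)))) \<longlonglongrightarrow> 0" if "k \<noteq> l" for k l
    proof -
      \<comment> \<open>Shifting the average by \<open>- l\<close> turns the correlation of
        \<open>w (g - k)\<close> and \<open>w (g - l)\<close> into that of \<open>w (g + h)\<close>
        and \<open>w g\<close> with \<open>h = l - k \<noteq> 0\<close>.\<close>
      let ?\<psi> = "\<lambda>g. L2_inner M (w (g + (l - k))) (w g)"
      have "(\<lambda>N. avg F N (\<lambda>g. ?\<psi> (g + (- l))) - avg F N ?\<psi>) \<longlonglongrightarrow> 0"
        by (rule avg_shift_tendsto[OF F, where C = "C * C"]) (rule L2_inner_bound[OF w w wb wb])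
      from tendsto_add[OF this corr[of "l - k"]] that show ?thesis by (simp add: algebra_simps)
    qed
    then have "(\<lambda>N. if k = l then 0 else cmod (c k) * cmod (c l) * cmod (avg F N (\<lambda>g. L2_inner M (w (g - k)) (w (g - l))))) \<longlonglongrightarrow> 0" for k l
      using tendsto_mult_right_zero[OF tendsto_norm_zero, of "\<lambda>N. avg F N (\<lambda>g. L2_inner M (w (g - k)) (w (g - l)))" sequentially "cmod (c k) * cmod (c l)"]
      by (cases "k = l") simp_all
    then have "E \<longlonglongrightarrow> (\<Sum>k\<in>D. \<Sum>l\<in>D. 0)"
      unfolding E_def by (intro tendsto_sum)
    then show ?thesis by simp
  qed
  have b_small: "mean_sq M (b N) \<le> C1\<^sup>2 * (C\<^sup>2 * (e / (2 * K)) + E N)" for N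
  proof -
    have "mean_sq M (b N) \<le> avg F N (\<lambda>g. mean_sq M (\<lambda>x. koopman M T g f x * v g x))"
      unfolding b_def by (intro mean_sq_avg_le[OF F] Linf_mult koopman_Linf f vL)
    also have "\<dots> \<le> avg F N (\<lambda>g. C1\<^sup>2 * mean_sq M (v g))"
    proof -
      have "mean_sq M (\<lambda>x. koopman M T g f x * v g x) \<le> C1\<^sup>2 * mean_sq M (v g)" for g
        by (intro mean_sq_mult_le vL koopman_Linf f AE_koopman[where P = "\<lambda>z. cmod z \<le> C1"] C1)
      then show ?thesis unfolding avg_def by (intro scaleR_left_mono sum_mono) auto
    qed
    also have "\<dots> = C1\<^sup>2 * avg F N (\<lambda>g. mean_sq M (v g))" by (rule avg_mult_left)
    also have "avg F N (\<lambda>g. mean_sq M (v g)) \<le> C\<^sup>2 * (e / (2 * K)) + E N"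
    proof -
      have "complex_of_real (avg F N (\<lambda>g. mean_sq M (v g))) = avg F N (\<lambda>g. complex_of_real (mean_sq M (v g)))"
        by (simp add: avg_def scaleR_conv_of_real)
      also have "\<dots> = avg F N (\<lambda>g. \<Sum>k\<in>D. \<Sum>l\<in>D. c k * cnj (c l) * L2_inner M (w (g - k)) (w (g - l)))"
        unfolding v_def using mean_sq_sum[OF D, of "\<lambda>k. w (_ - k)" c] w by simp
      also have "\<dots> = (\<Sum>k\<in>D. \<Sum>l\<in>D. c k * cnj (c l) * avg F N (\<lambda>g. L2_inner M (w (g - k)) (w (g - l))))"
        by (simp only: avg_sum avg_mult_left)
      finally have "\<bar>avg F N (\<lambda>g. mean_sq M (v g))\<bar> = cmod (\<Sum>k\<in>D. \<Sum>l\<in>D. c k * cnj (c l) * avg F N (\<lambda>g. L2_inner M (w (g - k)) (w (g - l))))"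
        by (metis norm_of_real)
      also have "\<dots> \<le> (\<Sum>k\<in>D. \<Sum>l\<in>D. (if k = l then (cmod (c k))\<^sup>2 * C\<^sup>2 else 0) + (if k = l then 0 else
          cmod (c k) * cmod (c l) * cmod (avg F N (\<lambda>g. L2_inner M (w (g - k)) (w (g - l))))))"
      proof (intro sum_norm_le)
        fix k l
        have "cmod (avg F N (\<lambda>g. L2_inner M (w (g - k)) (w (g - k)))) \<le> C * C"
          by (intro norm_avg_le[OF F] L2_inner_bound w wb)
        then have "(cmod (c k))\<^sup>2 * cmod (avg F N (\<lambda>g. L2_inner M (w (g - k)) (w (g - k)))) \<le> (cmod (c k))\<^sup>2 * C\<^sup>2"
          by (intro mult_left_mono) (auto simp: power2_eq_square)
        then show "cmod (c k * cnj (c l) * avg F N (\<lambda>g. L2_inner M (w (g - k)) (w (g - l))))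
          \<le> (if k = l then (cmod (c k))\<^sup>2 * C\<^sup>2 else 0) + (if k = l then 0 else
          cmod (c k) * cmod (c l) * cmod (avg F N (\<lambda>g. L2_inner M (w (g - k)) (w (g - l)))))"
          by (auto simp: norm_mult power2_eq_square)
      qed
      also have "\<dots> = (\<Sum>k\<in>D. (cmod (c k))\<^sup>2) * C\<^sup>2 + E N"
        using D by (simp add: sum.distrib E_def sum_distrib_right)
      also have "\<dots> \<le> e / (2 * K) * C\<^sup>2 + E N"
        using c_small by (intro add_mono mult_right_mono) auto
      finally show ?thesis by (simp add: mult.commute)
    qed
    finally show ?thesis by (simp add: mult_left_mono)
  qed
  have bound: "mean_sq M (u N) \<le> 4 * (R N)\<^sup>2 + 4 * C1\<^sup>2 * E N + e * (K - 1) / (2 * K)" for N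
  proof -
    have "mean_sq M (\<lambda>x. a N x + ((u N x - a N x - b N x) + b N x))
        \<le> 2 * mean_sq M (a N) + 2 * mean_sq M (\<lambda>x. (u N x - a N x - b N x) + b N x)"
      by (intro mean_sq_add_le Linf_diff Linf_add uL aL bL)
    also have "mean_sq M (\<lambda>x. (u N x - a N x - b N x) + b N x) \<le> 2 * mean_sq M (\<lambda>x. u N x - a N x - b N x) + 2 * mean_sq M (b N)"
      by (intro mean_sq_add_le Linf_diff Linf_add uL aL bL)
    finally have "mean_sq M (u N) \<le> 2 * mean_sq M (a N) + 2 * (2 * mean_sq M (\<lambda>x. u N x - a N x - b N x) + 2 * mean_sq M (b N))"
      by simp
    also have "\<dots> \<le> 2 * (C\<^sup>2 * (e / (2 * K))) + 2 * (2 * (R N)\<^sup>2 + 2 * (C1\<^sup>2 * (C\<^sup>2 * (e / (2 * K)) + E N)))"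
      by (intro add_mono mult_left_mono a_small uab b_small) auto
    also have "\<dots> = 4 * (R N)\<^sup>2 + 4 * C1\<^sup>2 * E N + (e / (2 * K)) * (K - 1)"
    proof -
      have "2 * (C\<^sup>2 * t) + 2 * (2 * (R N)\<^sup>2 + 2 * (C1\<^sup>2 * (C\<^sup>2 * t + E N)))
          = 4 * (R N)\<^sup>2 + 4 * C1\<^sup>2 * E N + t * (2 * C\<^sup>2 + 4 * C1\<^sup>2 * C\<^sup>2)" for t :: real
        by (simp add: algebra_simps)
      moreover have "K - 1 = 2 * C\<^sup>2 + 4 * C1\<^sup>2 * C\<^sup>2" by (simp add: K_def)
      ultimately show ?thesis by metis
    qed
    finally show ?thesis by simp
  qed
  have "(\<lambda>N. 4 * (R N)\<^sup>2 + 4 * C1\<^sup>2 * E N + e * (K - 1) / (2 * K)) \<longlonglongrightarrow> 4 * 0\<^sup>2 + 4 * C1\<^sup>2 * 0 + e * (K - 1) / (2 * K)"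
    by (intro tendsto_intros R_lim E_lim)
  moreover have "e * (K - 1) / (2 * K) < e"
    using mult_strict_left_mono[of "K - 1" "2 * K" e] \<open>e > 0\<close> K by (simp add: pos_divide_less_eq)
  ultimately have "\<forall>\<^sub>F N in sequentially. 4 * (R N)\<^sup>2 + 4 * C1\<^sup>2 * E N + e * (K - 1) / (2 * K) < e"
    by (intro order_tendstoD(2)) auto
  then obtain N0 where "\<And>N. N \<ge> N0 \<Longrightarrow> 4 * (R N)\<^sup>2 + 4 * C1\<^sup>2 * E N + e * (K - 1) / (2 * K) < e"
    by (auto simp: eventually_sequentially)
  then have "\<forall>N\<ge>N0. norm (mean_sq M (u N) - 0) < e"
    using bound by (auto intro: le_less_trans)
  then show "\<exists>N0. \<forall>N\<ge>N0. norm (mean_sq M (\<lambda>x. avg F N (\<lambda>g. koopman M T g f x * w g x)) - 0) < e"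
    unfolding u_def by blast
qed

text \<open>The spectral isometry on trigonometric polynomials: translates of \<open>f\<close>
  correspond to evaluations in the space of square integrable functions for
  \<open>\<sigma>\<close>.\<close>

lemma spectral_mean_sq:
  assumes \<sigma>: "is_spectral_measure M T f \<sigma>" and f: "f \<in> Linf M" and I: "finite I"
  shows "mean_sq M (\<lambda>x. \<Sum>i\<in>I. c i * koopman M T (\<kappa> i) f x) = (\<integral>\<gamma>. (cmod (\<Sum>i\<in>I. c i * \<gamma> (\<kappa> i)))\<^sup>2 \<partial>\<sigma>)"
proof -
  have s: "finite_measure \<sigma>" "sets \<sigma> = sets dual_borel"
    and eq: "\<And>g. L2_inner M (koopman M T g f) f = (\<integral>\<gamma>. \<gamma> g \<partial>\<sigma>)"
    using \<sigma> by (auto simp: is_spectral_measure_def)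
  note int = dual_continuous_integrable[OF s]
  have "complex_of_real (\<integral>\<gamma>. (cmod (\<Sum>i\<in>I. c i * \<gamma> (\<kappa> i)))\<^sup>2 \<partial>\<sigma>)
      = (\<integral>\<gamma>. complex_of_real ((cmod (\<Sum>i\<in>I. c i * \<gamma> (\<kappa> i)))\<^sup>2) \<partial>\<sigma>)"
    by (simp only: integral_complex_of_real)
  also have "\<dots> = (\<integral>\<gamma>. (\<Sum>i\<in>I. \<Sum>j\<in>I. c i * cnj (c j) * \<gamma> (\<kappa> i - \<kappa> j)) \<partial>\<sigma>)"
  proof (intro Bochner_Integration.integral_cong refl)
    fix \<gamma> assume "\<gamma> \<in> space \<sigma>"
    then have \<gamma>: "\<gamma> \<in> pontryagin_dual" using dual_borel_space[OF s(2)] by simp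
    show "complex_of_real ((cmod (\<Sum>i\<in>I. c i * \<gamma> (\<kappa> i)))\<^sup>2) = (\<Sum>i\<in>I. \<Sum>j\<in>I. c i * cnj (c j) * \<gamma> (\<kappa> i - \<kappa> j))"
      unfolding complex_norm_square cnj_sum sum_product
      by (intro sum.cong refl) (simp add: dualD(5)[OF \<gamma>])
  qed
  also have "\<dots> = (\<Sum>i\<in>I. \<Sum>j\<in>I. c i * cnj (c j) * (\<integral>\<gamma>. \<gamma> (\<kappa> i - \<kappa> j) \<partial>\<sigma>))"
    by (subst Bochner_Integration.integral_sum, (intro int continuous_intros)[1],
        subst Bochner_Integration.integral_sum, (intro int continuous_intros)[1])
       (intro sum.cong refl integral_mult_right_zero)
  also have "\<dots> = complex_of_real (mean_sq M (\<lambda>x. \<Sum>i\<in>I. c i * koopman M T (\<kappa> i) f x))"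
    unfolding eq[symmetric] by (rule mean_sq_koopman_sum[OF I f, symmetric])
  finally show ?thesis by (simp only: of_real_eq_iff)
qed

text \<open>A set that separates the maximal spectral type from Haar measure also separates
  \<open>\<sigma>\<close>, by absolute continuity; the isometry carries the trigonometric
  approximation of 1 over to an approximation of \<open>f\<close>.\<close>

lemma singular_koopman_approx:
  assumes sing: "singular_spectrum M T" and f: "f \<in> Linf M" "(\<integral>x. f x \<partial>M) = 0" and e: "e > 0"
  shows "\<exists>D c. finite D \<and> mean_sq M (\<lambda>x. f x - (\<Sum>k\<in>D. c k * koopman M T k f x)) \<le> e
    \<and> (\<Sum>k\<in>D. (cmod (c k))\<^sup>2) \<le> e"
proof -
  obtain \<mu> m where \<mu>: "max_spectral_type M T \<mu>"
    and m: "normalized_haar (\<lambda>\<psi> \<gamma> g. \<psi> g * \<gamma> g) pontryagin_dual m" and sm: "mutually_singular \<mu> m"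
    using sing by (auto simp: singular_spectrum_def)
  have hd: "haar_dual m" by unfold_locales (rule m)
  obtain \<sigma> where \<sigma>: "is_spectral_measure M T f \<sigma>" "absolutely_continuous \<mu> \<sigma>" and s\<mu>: "sets \<mu> = sets dual_borel"
    using \<mu> Linf_L2[OF f(1)] f(2) by (auto simp: max_spectral_type_def dominates_spectrum_def)
  have s: "finite_measure \<sigma>" "sets \<sigma> = sets dual_borel" using \<sigma>(1) by (auto simp: is_spectral_measure_def)
  obtain A where A: "A \<in> sets \<mu>" "emeasure \<mu> A = 0" "emeasure m (space m - A) = 0"
    using sm by (auto simp: mutually_singular_def)
  then have "A \<in> null_sets \<sigma>" using \<sigma>(2) by (auto simp: absolutely_continuous_def null_sets_def)
  then have A': "A \<in> sets \<sigma>" "emeasure \<sigma> A = 0" by auto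
  obtain D c where D: "finite D" "(\<integral>\<gamma>. (cmod (1 - (\<Sum>k\<in>D. c k * \<gamma> k)))\<^sup>2 \<partial>\<sigma>) \<le> e" "(\<Sum>k\<in>D. (cmod (c k))\<^sup>2) \<le> e"
    by (rule haar_dual.singular_trig_approx[OF hd s A' A(3) e])
  \<comment> \<open>\<open>None\<close> stands for the term \<open>f\<close> itself, with shift 0
    and coefficient 1. It is kept apart from the indices in \<open>D\<close>, which may also contain
    0.\<close>
  define I where "I = insert None (Some ` D)"
  define d where "d i = (case i of None \<Rightarrow> 1 | Some k \<Rightarrow> - c k)" for i
  define \<kappa> where "\<kappa> i = (case i of None \<Rightarrow> 0 | Some k \<Rightarrow> k)" for i :: "'g option"
  have I: "(\<Sum>i\<in>I. d i * u (\<kappa> i)) = u 0 - (\<Sum>k\<in>D. c k * u k)" for u :: "'g \<Rightarrow> complex"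
    using D(1) by (simp add: I_def sum.reindex d_def \<kappa>_def sum_negf)
  have "mean_sq M (\<lambda>x. f x - (\<Sum>k\<in>D. c k * koopman M T k f x)) = mean_sq M (\<lambda>x. \<Sum>i\<in>I. d i * koopman M T (\<kappa> i) f x)"
  proof (rule mean_sq_cong)
    fix x assume "x \<in> space M"
    then show "cmod (f x - (\<Sum>k\<in>D. c k * koopman M T k f x)) = cmod (\<Sum>i\<in>I. d i * koopman M T (\<kappa> i) f x)"
      using I[of "\<lambda>k. koopman M T k f x"] by (simp add: koopman_eq[of _ 0] action_0)
  qed
  also have "\<dots> = (\<integral>\<gamma>. (cmod (\<Sum>i\<in>I. d i * \<gamma> (\<kappa> i)))\<^sup>2 \<partial>\<sigma>)"
    by (rule spectral_mean_sq[OF \<sigma>(1) f(1)]) (simp add: I_def D(1))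
  also have "\<dots> = (\<integral>\<gamma>. (cmod (1 - (\<Sum>k\<in>D. c k * \<gamma> k)))\<^sup>2 \<partial>\<sigma>)"
    unfolding I using dual_borel_space[OF s(2)] by (intro Bochner_Integration.integral_cong) (auto simp: dualD(3))
  finally show ?thesis using D by (intro exI[of _ D] exI[of _ c]) simp
qed

text \<open>Every translate of a constant is the constant, so the average over \<open>n\<close>
  distinct elements reproduces it, while the squared coefficients sum to
  \<open>1 / n\<close>.\<close>

lemma constant_koopman_approx:
  assumes inf: "infinite (UNIV :: 'g set)" and e: "e > 0"
  shows "\<exists>D c. finite D \<and> mean_sq M (\<lambda>x. z - (\<Sum>k\<in>D. c k * koopman M T k (\<lambda>_. z) x)) \<le> e
    \<and> (\<Sum>k\<in>D. (cmod (c k))\<^sup>2) \<le> e"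
proof -
  obtain n :: nat where n: "n > 0" "inverse (real n) < e" using reals_Archimedean[OF e] by (metis zero_less_Suc)
  obtain D :: "'g set" where D: "finite D" "card D = n" using infinite_arbitrarily_large[OF inf] by blast
  let ?c = "\<lambda>k::'g. inverse (complex_of_nat n)"
  have "mean_sq M (\<lambda>x. z - (\<Sum>k\<in>D. ?c k * koopman M T k (\<lambda>_. z) x)) = 0"
    using n D by (simp add: koopman_def mean_sq_def)
  moreover have "(\<Sum>k\<in>D. (cmod (?c k))\<^sup>2) \<le> e"
  proof -
    have "(\<Sum>k\<in>D. (cmod (?c k))\<^sup>2) = inverse (real n)"
    proof -
      have "(\<Sum>k\<in>D. (cmod (?c k))\<^sup>2) = real n * (inverse (real n))\<^sup>2"
        using D by (simp add: norm_inverse)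
      also have "\<dots> = inverse (real n)" using n(1) by (simp add: power2_eq_square)
      finally show ?thesis .
    qed
    then show ?thesis using n by simp
  qed
  ultimately show ?thesis using D(1) e by (intro exI[of _ D] exI[of _ ?c]) auto
qed

end


section \<open>Convergence and recurrence\<close>

text \<open>With \<open>t = sqrt (x * y)\<close> the sum of the reciprocals is at least
  \<open>2 / t\<close>, and what remains is the inequality of means for \<open>t^2 / c^2\<close>,
  \<open>c / t\<close>, \<open>c / t\<close>, whose product is 1; equivalently
  \<open>(t - c)^2 * (t + 2 * c)\<close> is nonnegative.\<close>

lemma AM_GM_reciprocals:
  fixes x y c :: real
  assumes "x > 0" "y > 0" "c > 0"
  shows "3 \<le> x * y / c\<^sup>2 + c / x + c / y"
proof -
  define t where "t = sqrt (x * y)"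
  have t: "t > 0" "t\<^sup>2 = x * y" using assms by (auto simp: t_def)
  have "0 \<le> t * ((t - c)\<^sup>2 * (t + 2 * c))" using t assms by (intro mult_nonneg_nonneg) auto
  also have "\<dots> = t\<^sup>2 * t\<^sup>2 + c ^ 3 * (2 * t) - 3 * c\<^sup>2 * t\<^sup>2"
    by (simp add: power2_eq_square power3_eq_cube algebra_simps)
  also have "\<dots> \<le> (x * y)\<^sup>2 + c ^ 3 * (x + y) - 3 * c\<^sup>2 * (x * y)"
  proof -
    have "2 * t \<le> x + y"
    proof (rule power2_le_imp_le)
      have "0 \<le> (x - y)\<^sup>2" by simp
      then show "(2 * t)\<^sup>2 \<le> (x + y)\<^sup>2" using t(2) by (simp add: power2_eq_square algebra_simps)
    qed (use assms in auto)
    then have "c ^ 3 * (2 * t) \<le> c ^ 3 * (x + y)" using assms by (intro mult_left_mono) auto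
    then show ?thesis unfolding t(2) by (simp add: power2_eq_square)
  qed
  finally have "3 * c\<^sup>2 * (x * y) \<le> (x * y)\<^sup>2 + c ^ 3 * (x + y)" by simp
  then show ?thesis
    using assms by (simp add: field_simps power2_eq_square power3_eq_cube)
qed

text \<open>An inequality of Chu: on \<open>A\<close> integrate \<open>3 \<le> e\<^sub>1 e\<^sub>2 / c\<^sup>2 + c / e\<^sub>1 + c / e\<^sub>2\<close>, where
  \<open>c\<close> is the measure of \<open>A\<close> and the \<open>e\<^sub>i\<close> are its conditional probabilities, whose reciprocals
  have integral at most \<open>1\<close> over \<open>A\<close>.\<close>

theorem (in prob_space) cond_exp_product_ge_cube:
  assumes F: "subalgebra M F1" "subalgebra M F2" and A [measurable]: "A \<in> sets M"
  defines "e1 \<equiv> real_cond_exp M F1 (indicator A)" and "e2 \<equiv> real_cond_exp M F2 (indicator A)"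
  shows "prob A ^ 3 \<le> (\<integral>x. indicator A x * e1 x * e2 x \<partial>M)"
proof -
  have E: "AE x in M. 0 \<le> real_cond_exp M Fi (indicator A) x" "AE x in M. real_cond_exp M Fi (indicator A) x \<le> 1"
    "\<And>\<delta>. \<delta> > 0 \<Longrightarrow> (\<integral>x. indicator A x / (real_cond_exp M Fi (indicator A) x + \<delta>) \<partial>M) \<le> 1"
    if Fi: "subalgebra M Fi" for Fi
  proof -
    interpret finite_measure_subalgebra M Fi by unfold_locales (rule Fi)
    have int: "integrable M (indicator A :: 'a \<Rightarrow> real)" by (simp add: emeasure_eq_measure)
    show pos: "AE x in M. 0 \<le> real_cond_exp M Fi (indicator A) x"
      by (rule real_cond_exp_pos) auto
    show "AE x in M. real_cond_exp M Fi (indicator A) x \<le> 1"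
      by (rule real_cond_exp_le_c[OF int]) (auto simp: indicator_def)
    fix \<delta> :: real assume \<delta>: "\<delta> > 0"
    let ?e = "real_cond_exp M Fi (indicator A)"
    \<comment> \<open>The shift by \<open>\<delta>\<close> keeps the reciprocal bounded. As it is
      measurable for the subalgebra, the indicator of \<open>A\<close> may be replaced by its
      conditional expectation under the integral, and the integrand becomes at most 1.\<close>
    let ?g = "\<lambda>x. 1 / (?e x + \<delta>)"
    have g: "?g \<in> borel_measurable Fi" by measurable
    have gM: "?g \<in> borel_measurable M" using g measurable_from_subalg[OF Fi] by blast
    have gb: "AE x in M. \<bar>?g x\<bar> \<le> 1 / \<delta>"
      using pos by eventually_elim (use \<delta> in \<open>auto intro!: divide_left_mono\<close>)
    have gA: "integrable M (\<lambda>x. ?g x * indicator A x)"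
    proof (rule integrable_const_bound[where B = "1 / \<delta>"])
      show "AE x in M. norm (?g x * indicator A x) \<le> 1 / \<delta>"
        using gb by eventually_elim (use \<delta> in \<open>auto simp: indicator_def\<close>)
    qed (use gM in measurable)
    have iA: "(indicator A :: 'a \<Rightarrow> real) \<in> borel_measurable M" by measurable
    note r = real_cond_exp_intg[OF gA g iA]
    have "(\<integral>x. indicator A x / (?e x + \<delta>) \<partial>M) = (\<integral>x. ?g x * ?e x \<partial>M)"
      using r(2) by (simp add: mult.commute)
    also have "\<dots> \<le> (\<integral>x. 1 \<partial>M)"
    proof (rule integral_mono_AE)
      show "AE x in M. ?g x * ?e x \<le> 1"
        using pos by eventually_elim (use \<delta> in \<open>auto simp: field_simps\<close>)
    qed (use r(1) in auto)
    finally show "(\<integral>x. indicator A x / (?e x + \<delta>) \<partial>M) \<le> 1" by (simp add: prob_space)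
  qed
  note E1 = E[OF F(1), folded e1_def] and E2 = E[OF F(2), folded e2_def]
  have m [measurable]: "e1 \<in> borel_measurable M" "e2 \<in> borel_measurable M"
    unfolding e1_def e2_def using borel_measurable_cond_exp2 by auto
  have int: "integrable M (\<lambda>x. indicator A x * e1 x * e2 x)"
  proof (rule integrable_const_bound[where B = 1])
    show "AE x in M. norm (indicator A x * e1 x * e2 x) \<le> 1"
      using E1(1,2) E2(1,2) by eventually_elim (auto simp: indicator_def abs_mult intro: mult_le_one)
  qed measurable
  define c where "c = prob A"
  show ?thesis
  proof (cases "c = 0")
    case True
    have "AE x in M. 0 \<le> indicator A x * e1 x * e2 x"
      using E1(1) E2(1) by eventually_elim auto
    then have "0 \<le> (\<integral>x. indicator A x * e1 x * e2 x \<partial>M)" by (rule integral_nonneg_AE)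
    then show ?thesis using True by (simp add: c_def)
  next
    case False
    then have c: "c > 0" by (simp add: c_def less_le)
    \<comment> \<open>Since both conditional expectations are at most 1, adding
      \<open>\<delta>\<close> to each raises their product by at most
      \<open>2 * \<delta> + \<delta>^2\<close>. Integration gives \<open>3 * c\<close> on the left
      and \<open>c + c\<close> from the reciprocals, which leaves one \<open>c\<close>.\<close>
    have key: "c ^ 3 \<le> (\<integral>x. indicator A x * e1 x * e2 x \<partial>M) + (2 * \<delta> + \<delta>\<^sup>2)" if \<delta>: "\<delta> > 0" for \<delta>
    proof -
      have i1: "integrable M (\<lambda>x. indicator A x / (e x + \<delta>))" if [measurable]: "e \<in> borel_measurable M" and "AE x in M. 0 \<le> e x" for e
      proof (rule integrable_const_bound[where B = "1 / \<delta>"])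
        show "AE x in M. norm (indicator A x / (e x + \<delta>)) \<le> 1 / \<delta>"
          using that(2) by eventually_elim (use \<delta> in \<open>auto simp: indicator_def intro!: divide_left_mono\<close>)
      qed measurable
      note i = i1[OF m(1) E1(1)] i1[OF m(2) E2(1)]
      have "3 * c = (\<integral>x. 3 * indicator A x \<partial>M)" by (simp add: c_def)
      also have "\<dots> \<le> (\<integral>x. (indicator A x * e1 x * e2 x + (2 * \<delta> + \<delta>\<^sup>2)) / c\<^sup>2
          + c * (indicator A x / (e1 x + \<delta>)) + c * (indicator A x / (e2 x + \<delta>)) \<partial>M)"
      proof (rule integral_mono_AE)
        show "integrable M (\<lambda>x. 3 * indicator A x :: real)" by (simp add: emeasure_eq_measure)
        show "integrable M (\<lambda>x. (indicator A x * e1 x * e2 x + (2 * \<delta> + \<delta>\<^sup>2)) / c\<^sup>2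
          + c * (indicator A x / (e1 x + \<delta>)) + c * (indicator A x / (e2 x + \<delta>)))"
          using int i by (intro Bochner_Integration.integrable_add integrable_mult_right integrable_divide) auto
        show "AE x in M. 3 * indicator A x \<le> (indicator A x * e1 x * e2 x + (2 * \<delta> + \<delta>\<^sup>2)) / c\<^sup>2
          + c * (indicator A x / (e1 x + \<delta>)) + c * (indicator A x / (e2 x + \<delta>))"
          using E1(1,2) E2(1,2)
        proof eventually_elim
          case (elim x)
          show ?case
          proof (cases "x \<in> A")
            case True
            have "3 \<le> (e1 x + \<delta>) * (e2 x + \<delta>) / c\<^sup>2 + c / (e1 x + \<delta>) + c / (e2 x + \<delta>)"
              using elim \<delta> c by (intro AM_GM_reciprocals) auto
            also have "(e1 x + \<delta>) * (e2 x + \<delta>) / c\<^sup>2 \<le> (e1 x * e2 x + (2 * \<delta> + \<delta>\<^sup>2)) / c\<^sup>2"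
            proof (rule divide_right_mono)
              have "\<delta> * (e1 x + e2 x) \<le> \<delta> * 2" using elim \<delta> by (intro mult_left_mono) auto
              then show "(e1 x + \<delta>) * (e2 x + \<delta>) \<le> e1 x * e2 x + (2 * \<delta> + \<delta>\<^sup>2)"
                by (simp add: algebra_simps power2_eq_square)
            qed simp
            finally show ?thesis using True by simp
          qed (use \<delta> c in auto)
        qed
      qed
      also have "\<dots> = ((\<integral>x. indicator A x * e1 x * e2 x \<partial>M) + (2 * \<delta> + \<delta>\<^sup>2)) / c\<^sup>2
          + c * (\<integral>x. indicator A x / (e1 x + \<delta>) \<partial>M) + c * (\<integral>x. indicator A x / (e2 x + \<delta>) \<partial>M)"
      proof -
        have j: "integrable M (\<lambda>x. (indicator A x * e1 x * e2 x + (2 * \<delta> + \<delta>\<^sup>2)) / c\<^sup>2)"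
          "integrable M (\<lambda>x. c * (indicator A x / (e1 x + \<delta>)))" "integrable M (\<lambda>x. c * (indicator A x / (e2 x + \<delta>)))"
          using int i by (intro Bochner_Integration.integrable_add integrable_mult_right integrable_divide; simp)+
        have "(\<integral>x. (indicator A x * e1 x * e2 x + (2 * \<delta> + \<delta>\<^sup>2)) / c\<^sup>2 \<partial>M)
            = ((\<integral>x. indicator A x * e1 x * e2 x \<partial>M) + (2 * \<delta> + \<delta>\<^sup>2)) / c\<^sup>2"
          using int by (simp add: prob_space)
        then show ?thesis
          by (simp only: Bochner_Integration.integral_add[OF Bochner_Integration.integrable_add[OF j(1,2)] j(3)]
              Bochner_Integration.integral_add[OF j(1,2)] integral_mult_right_zero)
      qed
      also have "\<dots> \<le> ((\<integral>x. indicator A x * e1 x * e2 x \<partial>M) + (2 * \<delta> + \<delta>\<^sup>2)) / c\<^sup>2 + c * 1 + c * 1"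
        using c E1(3)[OF \<delta>] E2(3)[OF \<delta>] by (intro add_mono mult_left_mono order_refl) auto
      finally have "c \<le> ((\<integral>x. indicator A x * e1 x * e2 x \<partial>M) + (2 * \<delta> + \<delta>\<^sup>2)) / c\<^sup>2" by simp
      then show ?thesis using c by (simp add: field_simps power2_eq_square power3_eq_cube)
    qed
    have "c ^ 3 \<le> (\<integral>x. indicator A x * e1 x * e2 x \<partial>M)"
    proof (rule LIMSEQ_le_const)
      have "(\<lambda>n. (\<integral>x. indicator A x * e1 x * e2 x \<partial>M) + (2 * inverse (real (Suc n)) + (inverse (real (Suc n)))\<^sup>2))
          \<longlonglongrightarrow> (\<integral>x. indicator A x * e1 x * e2 x \<partial>M) + (2 * 0 + 0\<^sup>2)"
        by (intro tendsto_intros LIMSEQ_inverse_real_of_nat)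
      then show "(\<lambda>n. (\<integral>x. indicator A x * e1 x * e2 x \<partial>M) + (2 * inverse (real (Suc n)) + (inverse (real (Suc n)))\<^sup>2))
          \<longlonglongrightarrow> (\<integral>x. indicator A x * e1 x * e2 x \<partial>M)" by simp
      show "\<exists>N. \<forall>n\<ge>N. c ^ 3 \<le> (\<integral>x. indicator A x * e1 x * e2 x \<partial>M) + (2 * inverse (real (Suc n)) + (inverse (real (Suc n)))\<^sup>2)"
        by (intro exI[of _ 0] allI impI key) simp
    qed
    then show ?thesis by (simp add: c_def)
  qed
qed

lemma (in prob_space) L2_inner_tendsto:
  assumes u: "\<And>N. u N \<in> Linf M" and v: "v \<in> Linf M" and f: "f \<in> Linf M"
    and lim: "(\<lambda>N. L2_norm M (\<lambda>x. u N x - v x)) \<longlonglongrightarrow> 0"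
  shows "(\<lambda>N. L2_inner M (u N) f) \<longlonglongrightarrow> L2_inner M v f"
proof -
  obtain C where C: "C > 0" "AE x in M. cmod (f x) \<le> C" using LinfE[OF f] .
  have bound: "cmod (L2_inner M (u N) f - L2_inner M v f) \<le> C * (L2_norm M (\<lambda>x. u N x - v x) + inverse (real (Suc N)))" for N
  proof -
    define d where "d = (\<lambda>x. u N x - v x)"
    \<comment> \<open>The summand that vanishes in the limit makes the radius strictly positive, as
      \<open>integral_norm_le\<close> requires, even when \<open>d\<close> has norm 0.\<close>
    define r where "r = L2_norm M d + inverse (real (Suc N))"
    have dL: "d \<in> Linf M" unfolding d_def by (rule Linf_diff[OF u v])
    have nn: "0 \<le> L2_norm M d" by (simp add: L2_norm_mean_sq)
    then have r: "0 < r" "L2_norm M d \<le> r" by (auto simp: r_def intro: add_nonneg_pos)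
    have "L2_inner M (u N) f - L2_inner M v f = (\<integral>x. u N x * cnj (f x) - v x * cnj (f x) \<partial>M)"
      unfolding L2_inner_def
      by (intro Bochner_Integration.integral_diff[symmetric] Linf_integrable Linf_mult Linf_cnj u v f)
    also have "\<dots> = (\<integral>x. d x * cnj (f x) \<partial>M)" by (simp add: d_def left_diff_distrib)
    finally have "cmod (L2_inner M (u N) f - L2_inner M v f) \<le> (\<integral>x. cmod (d x * cnj (f x)) \<partial>M)"
      using integral_norm_bound[of M "\<lambda>x. d x * cnj (f x)"] by simp
    also have "\<dots> \<le> (\<integral>x. C * cmod (d x) \<partial>M)"
    proof (rule integral_mono_AE)
      show "AE x in M. cmod (d x * cnj (f x)) \<le> C * cmod (d x)"
        using C(2) by eventually_elim (simp add: norm_mult, subst mult.commute[of C], rule mult_left_mono, simp_all)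
      show "integrable M (\<lambda>x. cmod (d x * cnj (f x)))" "integrable M (\<lambda>x. C * cmod (d x))"
        by (intro integrable_norm integrable_mult_right Linf_integrable Linf_mult Linf_cnj dL f)+
    qed
    also have "\<dots> = C * (\<integral>x. cmod (d x) \<partial>M)" by simp
    also have "\<dots> \<le> C * r"
    proof (rule mult_left_mono)
      have "mean_sq M d = (L2_norm M d)\<^sup>2" by (simp add: L2_norm_mean_sq)
      also have "\<dots> \<le> r\<^sup>2" using r nn by (intro power_mono)
      finally show "(\<integral>x. cmod (d x) \<partial>M) \<le> r" using r by (intro integral_norm_le[OF dL])
    qed (use C in simp)
    finally show ?thesis by (simp add: r_def d_def)
  qed
  have "(\<lambda>N. C * (L2_norm M (\<lambda>x. u N x - v x) + inverse (real (Suc N)))) \<longlonglongrightarrow> C * (0 + 0)"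
    by (intro tendsto_intros lim LIMSEQ_inverse_real_of_nat)
  then have lim0: "(\<lambda>N. C * (L2_norm M (\<lambda>x. u N x - v x) + inverse (real (Suc N)))) \<longlonglongrightarrow> 0" by simp
  have "(\<lambda>N. L2_inner M (u N) f - L2_inner M v f) \<longlonglongrightarrow> 0"
    by (rule Lim_null_comparison[OF always_eventually lim0]) (intro allI bound)
  then show ?thesis by (rule LIM_zero_cancel)
qed

lemma (in prob_space) complex_cond_exp_indicator:
  assumes F: "subalgebra M F"
  shows "AE x in M. complex_cond_exp M F (indicator A) x = complex_of_real (real_cond_exp M F (indicator A) x)"
proof -
  interpret finite_measure_subalgebra M F by unfold_locales (rule F)
  have zero: "AE x in M. real_cond_exp M F (\<lambda>_. 0) x = 0"
    by (rule real_cond_exp_F_meas[of "\<lambda>_. 0"]) simp_all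
  have Re: "Re (indicator A y) = indicator A y" and Im: "Im (indicator A y) = 0" for y
    by (auto simp: indicator_def)
  show ?thesis
    using zero unfolding complex_cond_exp_def Re Im
    by eventually_elim (simp add: complex_eq_iff)
qed

section \<open>Averages along two actions\<close>

locale mp_pair = T: mp_system M T + S: mp_system M S
  for M :: "'x measure" and T S :: "'g::{ab_group_add, countable} \<Rightarrow> 'x \<Rightarrow> 'x" +
  fixes F :: "nat \<Rightarrow> 'g set"
  assumes F: "Folner F"
begin

text \<open>Up to null sets the difference to the limit is \<open>?A + ?B + ?e2 * ?C\<close>. In
  \<open>?A\<close> and \<open>?B\<close> the second factor has no invariant part, and the first is
  the mean-zero part of \<open>f1\<close> (singular spectrum) or its mean (infinite group). In the
  last term the invariant \<open>?e2\<close> leaves the average, so only \<open>T\<close> is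
  averaged and the mean ergodic theorem applies.\<close>

lemma mean_convergenceI:
  fixes a :: "'g \<Rightarrow> 'g"
  assumes inf: "infinite (UNIV :: 'g set)" and sing: "singular_spectrum M T"
    and corr: "\<And>f h. f \<in> Linf M \<Longrightarrow> h \<noteq> 0 \<Longrightarrow>
      (\<lambda>N. avg F N (\<lambda>g. L2_inner M (koopman M S (a (g + h) - a g) (\<lambda>y. f y - inv_exp M S f y))
        (\<lambda>y. f y - inv_exp M S f y))) \<longlonglongrightarrow> 0"
  shows "mean_convergence F M T S a"
  unfolding mean_convergence_def
proof (intro ballI)
  fix f1 f2 assume f1: "f1 \<in> Linf M" and f2: "f2 \<in> Linf M"
  let ?e1 = "inv_exp M T f1" and ?e2 = "inv_exp M S f2"
  let ?f2 = "\<lambda>y. f2 y - ?e2 y"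
  let ?w = "\<lambda>g. koopman M S (a g) ?f2"
  define z where "z = (\<integral>x. f1 x \<partial>M)"
  let ?u = "\<lambda>N x. avg F N (\<lambda>g. koopman M T g f1 x * koopman M S (a g) f2 x)"
  have e1L: "?e1 \<in> Linf M" and e2L: "?e2 \<in> Linf M" and f2L: "?f2 \<in> Linf M"
    by (intro T.inv_exp_Linf S.inv_exp_Linf Linf_diff f1 f2)+
  have wL: "?w g \<in> Linf M" for g by (intro S.koopman_Linf f2L)
  obtain C where C: "AE x in M. cmod (?f2 x) \<le> C" using LinfE[OF f2L] by blast
  have w_bound: "AE x in M. \<forall>g. cmod (?w g x) \<le> C"
    using S.koopman_bound[OF C] by eventually_elim auto
  have corr': "(\<lambda>N. avg F N (\<lambda>g. L2_inner M (?w (g + h)) (?w g))) \<longlonglongrightarrow> 0" if "h \<noteq> 0" for h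
    using corr[OF f2 that] by (simp add: S.inner_koopman[OF f2L f2L])
  have zero: "(\<lambda>N. mean_sq M (\<lambda>x. avg F N (\<lambda>g. koopman M T g f x * ?w g x))) \<longlonglongrightarrow> 0"
    if "f \<in> Linf M" and "\<And>e. e > 0 \<Longrightarrow> \<exists>D c. finite D \<and>
      mean_sq M (\<lambda>x. f x - (\<Sum>k\<in>D. c k * koopman M T k f x)) \<le> e \<and> (\<Sum>k\<in>D. (cmod (c k))\<^sup>2) \<le> e" for f
    by (rule T.product_avg_tendsto_0[OF F that wL w_bound corr'])
  let ?A = "\<lambda>N x. avg F N (\<lambda>g. koopman M T g (\<lambda>y. f1 y - z) x * ?w g x)"
  let ?B = "\<lambda>N x. avg F N (\<lambda>g. koopman M T g (\<lambda>_. z) x * ?w g x)"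
  let ?C = "\<lambda>N x. avg F N (\<lambda>g. koopman M T g (\<lambda>y. f1 y - ?e1 y) x)"
  have f1z: "(\<lambda>y. f1 y - z) \<in> Linf M" by (intro Linf_diff f1 Linf_const)
  have "(\<integral>x. f1 x - z \<partial>M) = 0"
    using T.Linf_integrable[OF f1] by (simp add: z_def T.prob_space)
  then have A: "(\<lambda>N. mean_sq M (?A N)) \<longlonglongrightarrow> 0"
    by (intro zero f1z T.singular_koopman_approx[OF sing f1z])
  have B: "(\<lambda>N. mean_sq M (?B N)) \<longlonglongrightarrow> 0"
    by (intro zero Linf_const T.constant_koopman_approx[OF inf])
  have C0: "(\<lambda>N. mean_sq M (?C N)) \<longlonglongrightarrow> 0"
    by (rule T.avg_koopman_orthogonal_part[OF F f1])
  have AL: "?A N \<in> Linf M" and BL: "?B N \<in> Linf M" and CL: "?C N \<in> Linf M" and uL: "?u N \<in> Linf M" for N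
    by (intro Linf_avg Linf_mult T.koopman_Linf S.koopman_Linf f1z Linf_const wL Linf_diff f1 f2 e1L)+
  obtain C2 where C2: "AE x in M. cmod (?e2 x) \<le> C2" using LinfE[OF e2L] by blast
  have inv: "AE x in M. \<forall>g. koopman M T g ?e1 x = ?e1 x" "AE x in M. \<forall>g. koopman M S g ?e2 x = ?e2 x"
    unfolding AE_all_countable using T.koopman_inv_exp[OF f1] S.koopman_inv_exp[OF f2] by auto
  have decomp: "AE x in M. ?u N x - ?e1 x * ?e2 x = (?A N x + ?B N x) + ?e2 x * ?C N x" for N
    using inv AE_space
  proof eventually_elim
    case (elim x)
    have "?u N x = avg F N (\<lambda>g. (koopman M T g (\<lambda>y. f1 y - z) x * ?w g x + koopman M T g (\<lambda>_. z) x * ?w g x)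
        + (?e2 x * koopman M T g (\<lambda>y. f1 y - ?e1 y) x + ?e1 x * ?e2 x))"
    proof (intro arg_cong[where f = "avg F N"] ext)
      fix g
      have "?w g x = koopman M S (a g) f2 x - ?e2 x" "koopman M T g (\<lambda>y. f1 y - ?e1 y) x = koopman M T g f1 x - ?e1 x"
        "koopman M T g (\<lambda>y. f1 y - z) x = koopman M T g f1 x - z" "koopman M T g (\<lambda>_. z) x = z"
        using elim by (simp_all add: koopman_def)
      then show "koopman M T g f1 x * koopman M S (a g) f2 x = (koopman M T g (\<lambda>y. f1 y - z) x * ?w g x + koopman M T g (\<lambda>_. z) x * ?w g x)
        + (?e2 x * koopman M T g (\<lambda>y. f1 y - ?e1 y) x + ?e1 x * ?e2 x)"
        by (simp only:) (simp add: algebra_simps)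
    qed
    then show ?case by (simp only: avg_add avg_mult_left avg_const[OF F]) simp
  qed
  have le: "mean_sq M (\<lambda>x. ?u N x - ?e1 x * ?e2 x)
      \<le> 4 * mean_sq M (?A N) + 4 * mean_sq M (?B N) + 2 * C2\<^sup>2 * mean_sq M (?C N)" for N
  proof -
    have "mean_sq M (\<lambda>x. ?u N x - ?e1 x * ?e2 x) = mean_sq M (\<lambda>x. (?A N x + ?B N x) + ?e2 x * ?C N x)"
      by (intro T.mean_sq_cong_AE decomp Linf_add Linf_diff Linf_mult uL AL BL CL e1L e2L)
    also have "\<dots> \<le> 2 * mean_sq M (\<lambda>x. ?A N x + ?B N x) + 2 * mean_sq M (\<lambda>x. ?e2 x * ?C N x)"
      by (intro T.mean_sq_add_le Linf_add Linf_mult AL BL CL e2L)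
    also have "\<dots> \<le> 2 * (2 * mean_sq M (?A N) + 2 * mean_sq M (?B N)) + 2 * (C2\<^sup>2 * mean_sq M (?C N))"
      by (rule add_mono[OF mult_left_mono[OF T.mean_sq_add_le[OF AL BL]] mult_left_mono[OF T.mean_sq_mult_le[OF CL e2L C2]]]) simp_all
    finally show ?thesis by simp
  qed
  have "(\<lambda>N. 4 * mean_sq M (?A N) + 4 * mean_sq M (?B N) + 2 * C2\<^sup>2 * mean_sq M (?C N)) \<longlonglongrightarrow> 4 * 0 + 4 * 0 + 2 * C2\<^sup>2 * 0"
    by (intro tendsto_intros A B C0)
  then have bound: "(\<lambda>N. 4 * mean_sq M (?A N) + 4 * mean_sq M (?B N) + 2 * C2\<^sup>2 * mean_sq M (?C N)) \<longlonglongrightarrow> 0"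
    by (simp only: mult_zero_right add_0_right)
  have "(\<lambda>N. mean_sq M (\<lambda>x. ?u N x - ?e1 x * ?e2 x)) \<longlonglongrightarrow> 0"
    by (rule tendsto_sandwich[OF _ _ tendsto_const bound];
        intro always_eventually allI mean_sq_nonneg le)
  then have "(\<lambda>N. L2_norm M (\<lambda>x. ?u N x - ?e1 x * ?e2 x)) \<longlonglongrightarrow> sqrt 0"
    unfolding L2_norm_mean_sq by (rule tendsto_real_sqrt)
  then show "L2_tendsto M ?u (\<lambda>x. ?e1 x * ?e2 x)"
    unfolding L2_tendsto_def real_sqrt_zero by (intro conjI allI T.Linf_L2 uL Linf_mult e1L e2L)
qed

text \<open>Convergence in mean square implies convergence of the inner products with the indicator
  of \<open>A\<close>, which are the averaged measures of intersections; the inequality for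
  conditional expectations bounds the limit from below.\<close>

lemma recurrence_boundI:
  assumes conv: "mean_convergence F M T S a"
  shows "recurrence_bound F M T S a"
  unfolding recurrence_bound_def
proof
  fix A assume A [measurable]: "A \<in> sets M"
  define f where "f = (indicator A :: 'x \<Rightarrow> complex)"
  have fL: "f \<in> Linf M" unfolding f_def by (rule LinfI[of _ _ 1]) (auto simp: indicator_def)
  let ?u = "\<lambda>N x. avg F N (\<lambda>g. koopman M T g f x * koopman M S (a g) f x)"
  let ?v = "\<lambda>x. inv_exp M T f x * inv_exp M S f x"
  have uL: "?u N \<in> Linf M" for N by (intro Linf_avg Linf_mult T.koopman_Linf S.koopman_Linf fL)
  have vL: "?v \<in> Linf M" by (intro Linf_mult T.inv_exp_Linf S.inv_exp_Linf fL)
  have "L2_tendsto M ?u ?v" using conv fL by (simp add: mean_convergence_def)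
  then have lim: "(\<lambda>N. L2_norm M (\<lambda>x. ?u N x - ?v x)) \<longlonglongrightarrow> 0" by (simp add: L2_tendsto_def)
  \<comment> \<open>Because \<open>koopman\<close> composes with the inverse map, the indicator of
    \<open>A\<close> becomes the indicator of the image of \<open>A\<close>.\<close>
  have koop: "koopman M R g f x = indicator (R g ` A) x" if "x \<in> space M" "mp_system M R" for R g x
  proof -
    interpret R: mp_system M R by fact
    have "inv_into (space M) (R g) x \<in> A \<longleftrightarrow> x \<in> R g ` A"
    proof
      assume "inv_into (space M) (R g) x \<in> A"
      moreover have "R g (inv_into (space M) (R g) x) = x"
        using that(1) R.action_bij[of g] by (simp add: bij_betw_def f_inv_into_f)
      ultimately show "x \<in> R g ` A" by (metis imageI)
    next
      assume "x \<in> R g ` A"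
      then obtain y where y: "y \<in> A" "x = R g y" by auto
      then have "y \<in> space M" using sets.sets_into_space[OF A] by auto
      then have "inv_into (space M) (R g) x = y"
        using R.action_bij[of g] y by (simp add: bij_betw_def inv_into_f_f)
      then show "inv_into (space M) (R g) x \<in> A" using y by simp
    qed
    then show ?thesis by (simp add: koopman_def f_def indicator_def)
  qed
  have img: "R g ` A \<in> sets M" if "mp_system M R" for R g
  proof -
    interpret R: mp_system M R by fact
    have "{x \<in> space M. koopman M R g f x = 1} \<in> sets M"
      using Linf_measurable[OF R.koopman_Linf[OF fL]] by measurable
    moreover have "R g ` A \<subseteq> space M" using sets.sets_into_space[OF A] R.action_space by auto
    then have "{x \<in> space M. koopman M R g f x = 1} = R g ` A"
      using koop[OF _ that] by (auto simp: indicator_def)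
    ultimately show ?thesis by simp
  qed
  have avg_eq: "complex_of_real (avg F N (\<lambda>g. measure M (A \<inter> T g ` A \<inter> S (a g) ` A))) = L2_inner M (?u N) f" for N
  proof -
    have "L2_inner M (\<lambda>x. koopman M T g f x * koopman M S (a g) f x) f = complex_of_real (measure M (A \<inter> T g ` A \<inter> S (a g) ` A))" for g
    proof -
      have s: "A \<inter> T g ` A \<inter> S (a g) ` A \<in> sets M"
        using img[OF T.mp_system_axioms] img[OF S.mp_system_axioms] by auto
      have "L2_inner M (\<lambda>x. koopman M T g f x * koopman M S (a g) f x) f
          = (\<integral>x. complex_of_real (indicator (A \<inter> T g ` A \<inter> S (a g) ` A) x) \<partial>M)"
        unfolding L2_inner_def
        by (intro Bochner_Integration.integral_cong refl)
           (simp add: koop[OF _ T.mp_system_axioms] koop[OF _ S.mp_system_axioms],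
            simp add: f_def indicator_def, blast)
      also have "\<dots> = complex_of_real (measure M (A \<inter> T g ` A \<inter> S (a g) ` A))"
        using s by (simp only: integral_complex_of_real) simp
      finally show ?thesis .
    qed
    moreover have "L2_inner M (?u N) f = avg F N (\<lambda>g. L2_inner M (\<lambda>x. koopman M T g f x * koopman M S (a g) f x) f)"
      by (intro T.L2_inner_avg_left Linf_mult T.koopman_Linf S.koopman_Linf fL)
    ultimately show ?thesis by (simp add: avg_def scaleR_conv_of_real)
  qed
  have inner_lim: "(\<lambda>N. L2_inner M (?u N) f) \<longlonglongrightarrow> L2_inner M ?v f"
    by (rule T.L2_inner_tendsto[OF uL vL fL lim])
  let ?e1 = "real_cond_exp M (inv_algebra M T) (indicator A)" and ?e2 = "real_cond_exp M (inv_algebra M S) (indicator A)"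
  have inv_exp_f: "AE x in M. inv_exp M R f x = complex_of_real (real_cond_exp M (inv_algebra M R) (indicator A) x)" for R :: "'g \<Rightarrow> 'x \<Rightarrow> 'x"
    unfolding f_def by (rule T.complex_cond_exp_indicator[OF subalgebra_inv_algebra])
  have L: "L2_inner M ?v f = complex_of_real (\<integral>x. indicator A x * ?e1 x * ?e2 x \<partial>M)"
  proof -
    have "L2_inner M ?v f = (\<integral>x. complex_of_real (indicator A x * ?e1 x * ?e2 x) \<partial>M)"
      unfolding L2_inner_def
    proof (rule integral_cong_AE)
      show "(\<lambda>x. ?v x * cnj (f x)) \<in> borel_measurable M"
        by (rule Linf_measurable[OF Linf_mult[OF vL Linf_cnj[OF fL]]])
      show "(\<lambda>x. complex_of_real (indicator A x * ?e1 x * ?e2 x)) \<in> borel_measurable M"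
      proof -
        have [measurable]: "real_cond_exp M G (indicator A) \<in> borel_measurable M" for G
          by (rule borel_measurable_cond_exp2)
        show ?thesis by measurable
      qed
      show "AE x in M. ?v x * cnj (f x) = complex_of_real (indicator A x * ?e1 x * ?e2 x)"
        using inv_exp_f[of T] inv_exp_f[of S]
      proof eventually_elim
        case (elim x)
        have "cnj (f x) = complex_of_real (indicator A x)" by (simp add: f_def indicator_def)
        then show ?case unfolding elim by simp
      qed
    qed
    then show ?thesis by (simp only: integral_complex_of_real)
  qed
  show "\<exists>L. (\<lambda>N. avg F N (\<lambda>g. measure M (A \<inter> T g ` A \<inter> S (a g) ` A))) \<longlonglongrightarrow> L \<and> measure M A ^ 3 \<le> L"
  proof (intro exI conjI)
    have "(\<lambda>N. complex_of_real (avg F N (\<lambda>g. measure M (A \<inter> T g ` A \<inter> S (a g) ` A)))) \<longlonglongrightarrow> complex_of_real (\<integral>x. indicator A x * ?e1 x * ?e2 x \<partial>M)"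
      using inner_lim by (simp only: avg_eq L)
    then show "(\<lambda>N. avg F N (\<lambda>g. measure M (A \<inter> T g ` A \<inter> S (a g) ` A))) \<longlonglongrightarrow> (\<integral>x. indicator A x * ?e1 x * ?e2 x \<partial>M)"
      by (simp only: tendsto_of_real_iff)
    show "measure M A ^ 3 \<le> (\<integral>x. indicator A x * ?e1 x * ?e2 x \<partial>M)"
      by (rule T.cond_exp_product_ge_cube[OF subalgebra_inv_algebra subalgebra_inv_algebra A])
  qed
qed

end


section \<open>Uniform distribution in closed subgroups of the circle\<close>

lemma closure_range_character:
  assumes \<gamma>: "\<gamma> \<in> pontryagin_dual"
  defines "K \<equiv> closure (range \<gamma>)"
  shows "compact K" "K \<subseteq> sphere 0 1" "1 \<in> K" "\<And>z w. z \<in> K \<Longrightarrow> w \<in> K \<Longrightarrow> z * w \<in> K" "\<And>z. z \<in> K \<Longrightarrow> cnj z \<in> K"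
proof -
  have r: "range \<gamma> \<subseteq> sphere 0 1" using dualD(2)[OF \<gamma>] by auto
  then have "K \<subseteq> sphere 0 1" unfolding K_def by (intro closure_minimal) auto
  then show "K \<subseteq> sphere 0 1" "compact K"
    unfolding K_def by (auto intro: compact_closure[THEN iffD2] bounded_subset[OF bounded_sphere r])
  have "\<gamma> 0 \<in> K" unfolding K_def by (rule subsetD[OF closure_subset rangeI])
  then show "1 \<in> K" using dualD(3)[OF \<gamma>] by simp
  show "cnj z \<in> K" if "z \<in> K" for z
  proof -
    have "cnj ` closure (range \<gamma>) \<subseteq> closure (cnj ` range \<gamma>)"
      by (intro continuous_image_closure_subset[of UNIV] continuous_intros) auto
    also have "\<dots> \<subseteq> closure (range \<gamma>)"
    proof (rule closure_mono, clarify)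
      fix g
      show "cnj (\<gamma> g) \<in> range \<gamma>" unfolding dualD(4)[OF \<gamma>, symmetric] by (rule rangeI)
    qed
    finally show ?thesis using that unfolding K_def by (meson image_subset_iff)
  qed
  show "z * w \<in> K" if zw: "z \<in> K" "w \<in> K" for z w
  proof -
    have "(\<lambda>(z, w). z * w) ` closure (range \<gamma> \<times> range \<gamma>) \<subseteq> closure ((\<lambda>(z, w). z * w) ` (range \<gamma> \<times> range \<gamma>))"
      unfolding case_prod_unfold by (intro continuous_image_closure_subset[of UNIV] continuous_intros) auto
    also have "\<dots> \<subseteq> closure (range \<gamma>)"
    proof (rule closure_mono, clarify)
      fix g h
      show "\<gamma> g * \<gamma> h \<in> range \<gamma>" unfolding dualD(1)[OF \<gamma>, symmetric] by (rule rangeI)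
    qed
    finally have "(\<lambda>(z, w). z * w) (z, w) \<in> closure (range \<gamma>)"
      using zw unfolding closure_Times K_def by (meson SigmaI image_subset_iff)
    then show ?thesis by (simp add: K_def)
  qed
qed

lemma continuous_rotation_measurable:
  assumes "k \<in> K" "\<And>z w. z \<in> K \<Longrightarrow> w \<in> K \<Longrightarrow> z * w \<in> (K :: complex set)"
  shows "(*) k \<in> measurable (restrict_space borel K) (restrict_space borel K)"
proof (rule measurable_restrict_space2)
  show "(*) k \<in> space (restrict_space borel K) \<rightarrow> K" using assms by (auto simp: space_restrict_space)
  show "(*) k \<in> borel_measurable (restrict_space borel K)"
    by (intro borel_measurable_continuous_on_restrict continuous_intros)
qed

text \<open>Multiplication by an element of \<open>K\<close> is an injective self-map of a finite
  set, hence a permutation, and preserves counting.\<close>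

lemma finite_group_haar:
  assumes K: "finite K" "K \<noteq> {}" "0 \<notin> K" and mult: "\<And>z w. z \<in> K \<Longrightarrow> w \<in> K \<Longrightarrow> z * w \<in> (K :: complex set)"
  shows "normalized_haar (*) K (uniform_count_measure K)"
proof -
  have "K \<in> sets borel" using K finite_imp_closed by (intro borel_closed) auto
  have sets: "sets (restrict_space borel K) = Pow K"
  proof -
    have "X \<in> sets borel" if "X \<subseteq> K" for X
      using finite_subset[OF that K(1)] finite_imp_closed by (intro borel_closed) auto
    then show ?thesis using \<open>K \<in> sets borel\<close> by (auto simp: sets_restrict_space_iff)
  qed
  have "distr (uniform_count_measure K) (uniform_count_measure K) ((*) k) = uniform_count_measure K" if k: "k \<in> K" for k
  proof (rule measure_eqI)
    have meas: "(*) k \<in> measurable (uniform_count_measure K) (uniform_count_measure K)"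
      using k mult by (auto simp: measurable_def space_uniform_count_measure sets_uniform_count_measure)
    have inj: "inj_on ((*) k) K" using k K(3) by (auto simp: inj_on_def)
    have im: "(*) k ` K = K" using endo_inj_surj[OF K(1) _ inj] k mult by auto
    fix X assume "X \<in> sets (distr (uniform_count_measure K) (uniform_count_measure K) ((*) k))"
    then have X: "X \<subseteq> K" by (simp add: sets_uniform_count_measure)
    let ?Y = "(*) k -` X \<inter> K"
    have "(*) k ` ?Y = X"
    proof
      show "X \<subseteq> (*) k ` ?Y"
      proof
        fix x assume x: "x \<in> X"
        then have "x \<in> (*) k ` K" using X im by blast
        then obtain y where "y \<in> K" "x = k * y" by auto
        then show "x \<in> (*) k ` ?Y" using x by auto
      qed
    qed auto
    moreover have "card ((*) k ` ?Y) = card ?Y"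
      by (rule card_image[OF inj_on_subset[OF inj]]) simp
    ultimately have "card X = card ?Y" by simp
    then show "emeasure (distr (uniform_count_measure K) (uniform_count_measure K) ((*) k)) X = emeasure (uniform_count_measure K) X"
      using X K meas by (simp add: emeasure_distr sets_uniform_count_measure space_uniform_count_measure emeasure_uniform_count_measure)
  qed simp
  moreover have "prob_space (uniform_count_measure K)" using K by (intro prob_space_uniform_count_measure)
  ultimately show ?thesis
    by (simp add: normalized_haar_def sets sets_uniform_count_measure)
qed

text \<open>The pushforward of Lebesgue measure on \<open>[0, 1]\<close>; a rotation translates the interval, and the
  part that leaves it is moved back by periodicity.\<close>

lemma circle_haar:
  "\<exists>m. normalized_haar (*) (sphere (0::complex) 1) m"
proof -
  define E where "E t = cis (2 * pi * t)" for t :: real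
  have E_add: "E (s + t) = E s * E t" for s t by (simp add: E_def cis_mult distrib_left)
  have E_1: "E 1 = 1" by (simp add: E_def)
  let ?S = "sphere (0::complex) 1" and ?U = "restrict_space lborel {0..<1::real}"
  let ?B = "restrict_space borel ?S"
  have E_meas: "E \<in> measurable borel ?B"
  proof (rule measurable_restrict_space2)
    show "E \<in> borel_measurable borel" unfolding E_def
      by (intro borel_measurable_continuous_onI continuous_intros)
  qed (auto simp: E_def)
  have E_measU: "E \<in> measurable ?U ?B"
    using measurable_restrict_space1[of E lborel ?B "{0..<1}"] E_meas by (simp add: measurable_lborel2)
  define m where "m = distr ?U ?B E"
  have em: "emeasure m X = (\<integral>\<^sup>+t. indicator X (E t) * indicator {0..<1} t \<partial>lborel)" if X: "X \<in> sets ?B" for X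
  proof -
    have [measurable]: "E \<in> measurable borel ?B" "X \<in> sets ?B" using E_meas X by auto
    have "{t. E t \<in> X} \<in> sets borel" 
      using measurable_sets[OF E_meas X] by (simp add: vimage_def)
    then have s: "{t. E t \<in> X} \<inter> {0..<1} \<in> sets lborel" by auto
    have "emeasure m X = emeasure ?U (E -` X \<inter> space ?U)"
      unfolding m_def by (rule emeasure_distr[OF E_measU X])
    also have "E -` X \<inter> space ?U = {t. E t \<in> X} \<inter> {0..<1}" by (auto simp: space_restrict_space)
    also have "emeasure ?U ({t. E t \<in> X} \<inter> {0..<1}) = emeasure lborel ({t. E t \<in> X} \<inter> {0..<1})"
      by (rule emeasure_restrict_space) auto
    also have "\<dots> = (\<integral>\<^sup>+t. indicator ({t. E t \<in> X} \<inter> {0..<1}) t \<partial>lborel)"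
      using s by simp
    finally show ?thesis by (simp add: indicator_def if_distrib mult.commute cong: if_cong)
       (auto intro!: nn_integral_cong simp: indicator_def)
  qed
  have rot: "emeasure m ((*) (E s) -` X \<inter> ?S) = emeasure m X" if X: "X \<in> sets ?B" and s: "0 \<le> s" "s < 1" for X s
  proof -
    have mX: "{t. E t \<in> X} \<in> sets borel"
      using measurable_sets[OF E_meas X] by (simp add: vimage_def)
    have [measurable]: "(\<lambda>t. indicator X (E t) :: ennreal) \<in> borel_measurable borel"
    proof -
      have "(\<lambda>t. indicator X (E t) :: ennreal) = indicator {t. E t \<in> X}" by (auto simp: indicator_def)
      then show ?thesis using mX by simp
    qed
    have Es: "cmod (E t) = 1" for t by (simp add: E_def)
    have affine: "(\<integral>\<^sup>+t. indicator X (E t) * indicator I t \<partial>lborel) = (\<integral>\<^sup>+t. indicator X (E (u + t)) * indicator I (u + t) \<partial>lborel)"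
      if [measurable]: "I \<in> sets borel" for I and u :: real
    proof -
      have "(\<lambda>t. indicator X (E t) * indicator I t :: ennreal) \<in> borel_measurable borel" by measurable
      from nn_integral_real_affine[OF this, of 1 u] show ?thesis by simp
    qed
    have "(*) (E s) -` X \<inter> ?S \<in> sets ?B"
      using measurable_sets[OF continuous_rotation_measurable[of "E s" ?S] X] Es by (simp add: norm_mult space_restrict_space)
    then have "emeasure m ((*) (E s) -` X \<inter> ?S) = (\<integral>\<^sup>+t. indicator X (E (s + t)) * indicator {0..<1} t \<partial>lborel)"
      by (subst em) (auto intro!: nn_integral_cong simp: indicator_def E_add Es)
    also have "\<dots> = (\<integral>\<^sup>+t. indicator X (E t) * indicator {s..<s+1} t \<partial>lborel)"
      by (subst affine[of "{s..<s+1}" s]) (auto intro!: nn_integral_cong simp: indicator_def)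
    also have "\<dots> = (\<integral>\<^sup>+t. indicator X (E t) * indicator {s..<1} t + indicator X (E t) * indicator {1..<s+1} t \<partial>lborel)"
      using s by (intro nn_integral_cong) (auto simp: indicator_def)
    also have "\<dots> = (\<integral>\<^sup>+t. indicator X (E t) * indicator {s..<1} t \<partial>lborel) + (\<integral>\<^sup>+t. indicator X (E t) * indicator {1..<s+1} t \<partial>lborel)"
      by (intro nn_integral_add) auto
    also have "(\<integral>\<^sup>+t. indicator X (E t) * indicator {1..<s+1} t \<partial>lborel) = (\<integral>\<^sup>+t. indicator X (E t) * indicator {0..<s} t \<partial>lborel)"
      by (subst affine[of "{1..<s+1}" 1]) (auto intro!: nn_integral_cong simp: indicator_def E_add E_1)
    also have "(\<integral>\<^sup>+t. indicator X (E t) * indicator {s..<1} t \<partial>lborel) + (\<integral>\<^sup>+t. indicator X (E t) * indicator {0..<s} t \<partial>lborel)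
        = (\<integral>\<^sup>+t. indicator X (E t) * indicator {s..<1} t + indicator X (E t) * indicator {0..<s} t \<partial>lborel)"
      by (intro nn_integral_add[symmetric]) auto
    also have "\<dots> = (\<integral>\<^sup>+t. indicator X (E t) * indicator {0..<1} t \<partial>lborel)"
      using s by (intro nn_integral_cong) (auto simp: indicator_def)
    finally show ?thesis using em[OF X] by simp
  qed
  have sm: "sets m = sets ?B" by (simp add: m_def)
  have "distr m m ((*) k) = m" if k: "k \<in> ?S" for k
  proof (rule measure_eqI)
    have "Arg2pi k / (2 * pi) \<ge> 0" "Arg2pi k / (2 * pi) < 1"
      using Arg2pi[of k] by auto
    moreover have "E (Arg2pi k / (2 * pi)) = k"
      using Arg2pi_eq[of k] k by (simp add: E_def cis_conv_exp)
    ultimately obtain s where s: "0 \<le> s" "s < 1" "k = E s" by metis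
    have meas: "(*) k \<in> measurable m m"
      using continuous_rotation_measurable[of k ?S] k measurable_cong_sets[OF sm sm] by (auto simp: norm_mult)
    have sp: "space m = ?S" using sets_eq_imp_space_eq[OF sm] by (simp add: space_restrict_space)
    fix X assume "X \<in> sets (distr m m ((*) k))"
    then have X: "X \<in> sets m" by simp
    have "emeasure (distr m m ((*) k)) X = emeasure m ((*) k -` X \<inter> space m)"
      by (rule emeasure_distr[OF meas X])
    then show "emeasure (distr m m ((*) k)) X = emeasure m X"
      using rot[of X s] X s by (simp only: sp sm)
  qed simp
  moreover have "prob_space m"
  proof
    have "space m = ?S" using sets_eq_imp_space_eq[OF sm] by (simp add: space_restrict_space)
    moreover have "?S \<in> sets ?B" by (simp add: sets_restrict_space_iff)
    moreover have "indicator ?S (E t) * indicator {0..<1} t = (indicator {0..<1} t :: ennreal)" for t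
      by (simp add: E_def)
    ultimately have "emeasure m (space m) = (\<integral>\<^sup>+t. indicator {0..<1::real} t \<partial>lborel)"
      by (simp only: em)
    also have "\<dots> = emeasure lborel {0..<1::real}" by (rule nn_integral_indicator) simp
    finally show "emeasure m (space m) = 1" by simp
  qed
  ultimately show ?thesis using sm by (intro exI[of _ m]) (simp add: normalized_haar_def)
qed

text \<open>An infinite compact set has two distinct elements that are arbitrarily close; their
  quotient is a nontrivial rotation by a small angle, and its powers meet every short arc.
  Closedness does the rest.\<close>

lemma infinite_closed_circle_group:
  assumes K: "compact K" "K \<subseteq> sphere 0 1" "infinite K" "1 \<in> K"
    and mult: "\<And>z w. z \<in> K \<Longrightarrow> w \<in> K \<Longrightarrow> z * w \<in> (K :: complex set)" and cnj: "\<And>z. z \<in> K \<Longrightarrow> cnj z \<in> K"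
  shows "K = sphere 0 1"
proof
  have pow: "z ^ n \<in> K" if "z \<in> K" for z n by (induction n) (auto intro: mult K(4) that)
  show "sphere 0 1 \<subseteq> K"
  proof
    fix z :: complex assume z: "z \<in> sphere 0 1"
    have "z \<in> closure K"
      unfolding closure_approachable
    proof (intro allI impI)
      fix e :: real assume e: "e > 0"
      obtain l where "l \<in> K" "l islimpt K" using K(1,3) by (metis Heine_Borel_imp_Bolzano_Weierstrass subset_refl)
      have "isCont Arg 1" by (rule continuous_at_Arg) (auto simp: complex_nonpos_Reals_iff)
      then obtain d where d: "d > 0" "\<And>v. dist v 1 < d \<Longrightarrow> dist (Arg v) (Arg 1) < e"
        using e unfolding continuous_at_eps_delta by (metis dist_commute)
      obtain x where x: "x \<in> K" "x \<noteq> l" "dist x l < d"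
        using \<open>l islimpt K\<close> d(1) unfolding islimpt_approachable by blast
      define v where "v = x * cnj l"
      have l1: "l * cnj l = 1" using \<open>l \<in> K\<close> K(2) by (auto simp: complex_norm_square[symmetric])
      have v: "v \<in> K" unfolding v_def by (intro mult cnj x \<open>l \<in> K\<close>)
      have "v - 1 = (x - l) * cnj l" unfolding v_def using l1 by (simp add: algebra_simps)
      then have "dist v 1 = dist x l" using \<open>l \<in> K\<close> K(2) by (auto simp: dist_norm norm_mult)
      then have "dist v 1 < d" "v \<noteq> 1" using x by auto
      define s where "s = \<bar>Arg v\<bar>"
      have "s < e" using d(2)[OF \<open>dist v 1 < d\<close>] by (simp add: s_def dist_real_def)
      have "cmod v = 1" using v K(2) by auto
      then have vc: "v = cis (Arg v)" using cis_Arg[of v] by (cases "v = 0") (simp_all add: sgn_div_norm)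
      then have "s > 0" using \<open>v \<noteq> 1\<close> by (auto simp: s_def)
      \<comment> \<open>Conjugation, which is inversion on the circle, makes the angle positive when
        the argument of \<open>v\<close> is negative.\<close>
      have "cis s \<in> K"
      proof (cases "Arg v \<ge> 0")
        case True
        then show ?thesis using v vc by (simp add: s_def)
      next
        case False
        then have "cis s = cnj v" using vc by (metis abs_of_neg cis_cnj not_le s_def)
        then show ?thesis using cnj v by simp
      qed
      define t where "t = Arg2pi z"
      have t: "t \<ge> 0" "z = cis t"
        using Arg2pi[of z] Arg2pi_eq[of z] z by (auto simp: t_def cis_conv_exp)
      \<comment> \<open>The largest number of steps of length \<open>s\<close> that does not pass
        the angle \<open>t\<close> of \<open>z\<close>; the remaining angle is below
        \<open>s\<close>, hence below \<open>e\<close>.\<close>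
      define n where "n = nat \<lfloor>t / s\<rfloor>"
      have "real n \<le> t / s" "t / s < real n + 1"
        using t(1) \<open>s > 0\<close> by (auto simp: n_def floor_less_iff)
      then have n: "0 \<le> t - real n * s" "t - real n * s < s"
        using \<open>s > 0\<close> by (auto simp: field_simps)
      have "dist (cis s ^ n) z = dist (cis (real n * s)) (cis t)" unfolding Complex.DeMoivre t(2) ..
      also have "\<dots> \<le> \<bar>t - real n * s\<bar>"
      proof -
        have "cis t - cis (real n * s) = cis (real n * s) * (cis (t - real n * s) - 1)"
          by (simp add: algebra_simps cis_mult)
        then have "cmod (cis t - cis (real n * s)) = cmod (exp (\<i> * complex_of_real (t - real n * s)) - 1)"
          by (simp add: norm_mult cis_conv_exp)
        also have "\<dots> \<le> \<bar>t - real n * s\<bar>" using dist_exp_i_1[of "t - real n * s"]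
            abs_sin_le_one abs_sin_x_le_abs_x[of "(t - real n * s) / 2"] by (simp add: abs_mult)
        finally show ?thesis by (simp add: dist_norm norm_minus_commute)
      qed
      also have "\<dots> < e" using n \<open>s < e\<close> by simp
      finally show "\<exists>y\<in>K. dist y z < e" using pow[OF \<open>cis s \<in> K\<close>] by blast
    qed
    then show "z \<in> K" using compact_imp_closed[OF K(1)] by simp
  qed
qed (rule K(2))

lemma haar_closure_range_character:
  assumes \<gamma>: "\<gamma> \<in> pontryagin_dual"
  obtains m where "normalized_haar (*) (closure (range \<gamma>)) m"
proof (cases "finite (closure (range \<gamma>))")
  case True
  moreover have "0 \<notin> closure (range \<gamma>)" using closure_range_character(2)[OF \<gamma>] by auto
  ultimately show ?thesis
    using that finite_group_haar[OF True] closure_range_character(3,4)[OF \<gamma>] by blast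
next
  case False
  then have "closure (range \<gamma>) = sphere 0 1"
    by (intro infinite_closed_circle_group closure_range_character[OF \<gamma>])
  then show ?thesis using that circle_haar by metis
qed

text \<open>Weyl's criterion. The distribution of \<open>\<gamma>\<close> is tested on powers of
  \<open>\<gamma>\<close>, which are again characters; this is why vanishing averages are assumed
  for all nontrivial characters and not just for \<open>\<gamma>\<close>.\<close>

lemma unif_distributed_character:
  fixes F :: "nat \<Rightarrow> 'g::ab_group_add set" and b :: "'g \<Rightarrow> 'g"
  assumes F: "Folner F" and \<gamma>: "\<gamma> \<in> pontryagin_dual"
    and van: "\<And>\<psi>. \<psi> \<in> pontryagin_dual - {\<lambda>_. 1} \<Longrightarrow> (\<lambda>N. avg F N (\<lambda>g. \<psi> (b g))) \<longlonglongrightarrow> 0"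
  shows "unif_distributed F (\<lambda>g. \<gamma> (b g)) (closure (range \<gamma>))"
proof -
  define K where "K = closure (range \<gamma>)"
  note K = closure_range_character[OF \<gamma>, folded K_def]
  have \<gamma>K: "\<gamma> g \<in> K" for g unfolding K_def by (rule subsetD[OF closure_subset rangeI])
  obtain m where m: "normalized_haar (*) K m" using haar_closure_range_character[OF \<gamma>] K_def by blast
  then have sm: "sets m = sets (restrict_space borel K)" and prob: "prob_space m"
    and inv: "\<And>k. k \<in> K \<Longrightarrow> distr m m ((*) k) = m" by (auto simp: normalized_haar_def)
  interpret m: prob_space m by (rule prob)
  have sp: "space m = K" using sets_eq_imp_space_eq[OF sm] by (simp add: space_restrict_space)
  have int: "integrable m f" if "continuous_on K f" for f :: "complex \<Rightarrow> complex"
    by (rule compact_continuous_integrable[OF m.finite_measure_axioms sm K(1) that])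
  \<comment> \<open>Powers of \<open>z\<close> and \<open>cnj z\<close> together cover all integer
    powers on the circle and, by linear combination, all polynomials in the real and imaginary
    parts.\<close>
  define mon where "mon i j z = z ^ i * cnj z ^ j" for i j :: nat and z :: complex
  have mon_cont: "continuous_on X (mon i j)" for X i j
    unfolding mon_def by (intro continuous_intros)
  have mon_mult: "mon i j (z * w) = mon i j z * mon i j w" for i j z w
    by (simp add: mon_def power_mult_distrib mult_ac)
  have mon_dual: "(\<lambda>g. mon i j (\<gamma> g)) \<in> pontryagin_dual" for i j
    unfolding pontryagin_dual_def
    by (simp add: dualD(1)[OF \<gamma>] mon_mult) (simp add: mon_def norm_mult norm_power dualD(2)[OF \<gamma>])
  \<comment> \<open>If the monomial is trivial on the range, both sides are 1. Otherwise it gives a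
    nontrivial character: its averages vanish by assumption, and its integral vanishes by invariance
    of \<open>m\<close> under a suitable rotation.\<close>
  have base: "(\<lambda>N. avg F N (\<lambda>g. mon i j (\<gamma> (b g)))) \<longlonglongrightarrow> (\<integral>z. mon i j z \<partial>m)" for i j
  proof (cases "(\<lambda>g. mon i j (\<gamma> g)) = (\<lambda>_. 1)")
    case True
    have "mon i j z = 1" if "z \<in> K" for z
      by (rule continuous_constant_on_closure[where S = "range \<gamma>"])
         (use that fun_cong[OF True] in \<open>auto simp: K_def mon_cont\<close>)
    then have "(\<integral>z. mon i j z \<partial>m) = (\<integral>z. 1 \<partial>m)" by (intro Bochner_Integration.integral_cong) (auto simp: sp)
    then show ?thesis using fun_cong[OF True] by (simp add: avg_const[OF F] m.prob_space)
  next
    case False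
    then obtain g where g: "mon i j (\<gamma> g) \<noteq> 1" by auto
    have "(\<integral>z. mon i j z \<partial>m) = (\<integral>z. mon i j z \<partial>distr m m ((*) (\<gamma> g)))" by (simp only: inv[OF \<gamma>K])
    also have "\<dots> = (\<integral>z. mon i j (\<gamma> g * z) \<partial>m)"
    proof (rule integral_distr)
      show "(*) (\<gamma> g) \<in> measurable m m"
        using continuous_rotation_measurable[OF \<gamma>K K(4)] measurable_cong_sets[OF sm sm] by blast
      show "mon i j \<in> borel_measurable m" by (rule compact_continuous_measurable[OF sm mon_cont])
    qed
    also have "\<dots> = mon i j (\<gamma> g) * (\<integral>z. mon i j z \<partial>m)" unfolding mon_mult by (rule integral_mult_right_zero)
    finally have "(1 - mon i j (\<gamma> g)) * (\<integral>z. mon i j z \<partial>m) = 0" by (metis diff_self left_diff_distrib mult_1)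
    then have "(\<integral>z. mon i j z \<partial>m) = 0" using g by simp
    then show ?thesis using van[of "\<lambda>g. mon i j (\<gamma> g)"] mon_dual False by simp
  qed
  \<comment> \<open>Quantifying over all monomials makes \<open>P\<close> stable under multiplication by \<open>z\<close> and \<open>cnj z\<close>.\<close>
  define P where "P f \<longleftrightarrow> continuous_on K f \<and> (\<forall>i j. (\<lambda>N. avg F N (\<lambda>g. f (\<gamma> (b g)) * mon i j (\<gamma> (b g))))
      \<longlonglongrightarrow> (\<integral>z. f z * mon i j z \<partial>m))" for f
  have P_1: "P (\<lambda>_. 1)" using base by (simp add: P_def)
  have P_lin: "P (\<lambda>z. \<alpha> * f z + \<beta> * h z)" if f: "P f" and h: "P h" for f h \<alpha> \<beta>
    unfolding P_def
  proof (intro conjI allI)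
    show "continuous_on K (\<lambda>z. \<alpha> * f z + \<beta> * h z)" using f h by (auto simp: P_def intro!: continuous_intros)
    fix i j
    have c: "integrable m (\<lambda>z. f z * mon i j z)" "integrable m (\<lambda>z. h z * mon i j z)"
      using f h by (auto simp: P_def intro!: int continuous_on_mult mon_cont)
    have "(\<integral>z. (\<alpha> * f z + \<beta> * h z) * mon i j z \<partial>m) = (\<integral>z. \<alpha> * (f z * mon i j z) + \<beta> * (h z * mon i j z) \<partial>m)"
      by (simp add: distrib_right mult.assoc)
    also have "\<dots> = \<alpha> * (\<integral>z. f z * mon i j z \<partial>m) + \<beta> * (\<integral>z. h z * mon i j z \<partial>m)"
      using c by (subst Bochner_Integration.integral_add) auto
    finally have eq: "(\<integral>z. (\<alpha> * f z + \<beta> * h z) * mon i j z \<partial>m) = \<alpha> * (\<integral>z. f z * mon i j z \<partial>m) + \<beta> * (\<integral>z. h z * mon i j z \<partial>m)" .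
    have "avg F N (\<lambda>g. (\<alpha> * f (\<gamma> (b g)) + \<beta> * h (\<gamma> (b g))) * mon i j (\<gamma> (b g)))
        = \<alpha> * avg F N (\<lambda>g. f (\<gamma> (b g)) * mon i j (\<gamma> (b g))) + \<beta> * avg F N (\<lambda>g. h (\<gamma> (b g)) * mon i j (\<gamma> (b g)))" for N
      by (simp add: distrib_right mult.assoc avg_add avg_mult_left)
    then show "(\<lambda>N. avg F N (\<lambda>g. (\<alpha> * f (\<gamma> (b g)) + \<beta> * h (\<gamma> (b g))) * mon i j (\<gamma> (b g))))
        \<longlonglongrightarrow> (\<integral>z. (\<alpha> * f z + \<beta> * h z) * mon i j z \<partial>m)"
      unfolding eq using f h by (auto simp: P_def intro!: tendsto_intros)
  qed
  have P_z: "P (\<lambda>z. z * f z)" and P_cnj: "P (\<lambda>z. cnj z * f z)" if f: "P f" for f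
  proof -
    have eq: "z * f z * mon i j z = f z * mon (Suc i) j z" "cnj z * f z * mon i j z = f z * mon i (Suc j) z" for z i j
      by (simp_all add: mon_def)
    from f have c: "continuous_on K f"
      and l: "(\<lambda>N. avg F N (\<lambda>g. f (\<gamma> (b g)) * mon i j (\<gamma> (b g)))) \<longlonglongrightarrow> (\<integral>z. f z * mon i j z \<partial>m)" for i j
      unfolding P_def by blast+
    have c': "continuous_on K (\<lambda>z. z * f z)" "continuous_on K (\<lambda>z. cnj z * f z)"
      by (intro continuous_intros c)+
    show "P (\<lambda>z. z * f z)" unfolding P_def eq using c'(1) l by blast
    show "P (\<lambda>z. cnj z * f z)" unfolding P_def eq using c'(2) l by blast
  qed
  have P_poly: "P (\<lambda>z. complex_of_real (p z) * f z)" if "real_polynomial_function p" "P f" for p f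
    using that
  proof (induction arbitrary: f)
    case (linear l)
    interpret l: bounded_linear l by (rule linear.hyps)
    have lz: "l z = Re z * l 1 + Im z * l \<i>" for z
    proof -
      have "z = Re z *\<^sub>R 1 + Im z *\<^sub>R \<i>" by (simp add: complex_eq_iff)
      then have "l z = l (Re z *\<^sub>R 1 + Im z *\<^sub>R \<i>)" by simp
      then show ?thesis by (simp only: l.add l.scale real_scaleR_def)
    qed
    \<comment> \<open>A real linear functional on the plane is a complex combination of
      \<open>z\<close> and \<open>cnj z\<close>, so the closure properties of \<open>P\<close>
      apply.\<close>
    have "complex_of_real (l z) * f z = Complex (l 1 / 2) (- l \<i> / 2) * (z * f z) + Complex (l 1 / 2) (l \<i> / 2) * (cnj z * f z)" for z
      unfolding lz[of z] by (simp add: complex_eq_iff field_simps)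
    then have "(\<lambda>z. complex_of_real (l z) * f z)
      = (\<lambda>z. Complex (l 1 / 2) (- l \<i> / 2) * (z * f z) + Complex (l 1 / 2) (l \<i> / 2) * (cnj z * f z))"
      by (rule ext)
    then show ?case using P_lin[OF P_z[OF linear.prems] P_cnj[OF linear.prems]] by simp
  next
    case (const c)
    then show ?case using P_lin[OF const const, of c 0] by simp
  next
    case (add p q)
    then show ?case using P_lin[of "\<lambda>z. complex_of_real (p z) * f z" "\<lambda>z. complex_of_real (q z) * f z" 1 1]
      by (simp add: distrib_right)
  next
    case (mult p q)
    then show ?case using mult.IH(1)[OF mult.IH(2)[OF mult.prems]] by (simp add: mult.assoc)
  qed
  have "(\<lambda>N. avg F N (\<lambda>g. \<phi> (\<gamma> (b g)))) \<longlonglongrightarrow> (\<integral>z. \<phi> z \<partial>m)" if \<phi>: "continuous_on K \<phi>" for \<phi> :: "complex \<Rightarrow> complex"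
  proof (rule LIMSEQ_I)
    fix e :: real assume e: "e > 0"
    then obtain q where q: "polynomial_function q" and near: "\<And>z. z \<in> K \<Longrightarrow> norm (\<phi> z - q z) < e / 4"
      using Stone_Weierstrass_polynomial_function[OF K(1) \<phi>, of "e / 4"] by auto
    have "real_polynomial_function (Re \<circ> q)" "real_polynomial_function (Im \<circ> q)"
      using q bounded_linear_Re bounded_linear_Im unfolding polynomial_function_def by blast+
    then have "P (\<lambda>z. 1 * (complex_of_real ((Re \<circ> q) z) * 1) + \<i> * (complex_of_real ((Im \<circ> q) z) * 1))"
      by (intro P_lin P_poly P_1)
    moreover have "(\<lambda>z. 1 * (complex_of_real ((Re \<circ> q) z) * 1) + \<i> * (complex_of_real ((Im \<circ> q) z) * 1)) = q"
      by (auto simp: complex_eq_iff)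
    ultimately have Pq: "P q" by simp
    then have qc: "continuous_on K q" and "(\<lambda>N. avg F N (\<lambda>g. q (\<gamma> (b g)) * mon 0 0 (\<gamma> (b g)))) \<longlonglongrightarrow> (\<integral>z. q z * mon 0 0 z \<partial>m)"
      by (auto simp: P_def)
    then have "(\<lambda>N. avg F N (\<lambda>g. q (\<gamma> (b g)))) \<longlonglongrightarrow> (\<integral>z. q z \<partial>m)" by (simp add: mon_def)
    then obtain N0 where N0: "\<And>N. N \<ge> N0 \<Longrightarrow> norm (avg F N (\<lambda>g. q (\<gamma> (b g))) - (\<integral>z. q z \<partial>m)) < e / 4"
      using LIMSEQ_D[of _ _ "e / 4"] e by (metis divide_pos_pos zero_less_numeral)
    have "norm (avg F N (\<lambda>g. \<phi> (\<gamma> (b g))) - avg F N (\<lambda>g. q (\<gamma> (b g)))) \<le> e / 4" for N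
      unfolding avg_diff[symmetric] using near[OF \<gamma>K] by (intro norm_avg_le[OF F]) (auto intro: less_imp_le)
    moreover have "norm ((\<integral>z. \<phi> z \<partial>m) - (\<integral>z. q z \<partial>m)) \<le> e / 4"
    proof -
      have "norm ((\<integral>z. \<phi> z \<partial>m) - (\<integral>z. q z \<partial>m)) = norm (\<integral>z. \<phi> z - q z \<partial>m)"
        using int[OF \<phi>] int[OF qc] by simp
      also have "\<dots> \<le> (\<integral>z. norm (\<phi> z - q z) \<partial>m)" by (rule integral_norm_bound)
      also have "\<dots> \<le> (\<integral>z. e / 4 \<partial>m)"
        using int[OF \<phi>] int[OF qc] near sp by (intro integral_mono) (auto intro: less_imp_le)
      finally show ?thesis by (simp add: m.prob_space)
    qed
    ultimately have "norm (avg F N (\<lambda>g. \<phi> (\<gamma> (b g))) - (\<integral>z. \<phi> z \<partial>m)) < e" if "N \<ge> N0" for N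
    proof -
      have tri: "norm (A - I) < e" if "norm (A - A') \<le> e / 4" "norm (A' - I') < e / 4" "norm (I - I') \<le> e / 4" for A A' I I' :: complex
      proof -
        have "norm (A - I) \<le> norm (A - A') + norm (A' - I') + norm (I' - I)"
          using norm_triangle_ineq[of "A - A' + (A' - I')" "I' - I"] norm_triangle_ineq[of "A - A'" "A' - I'"] by simp
        then show ?thesis using that e by (simp add: norm_minus_commute[of I'])
      qed
      show ?thesis by (rule tri) (fact | rule N0[OF that])+
    qed
    then show "\<exists>N0. \<forall>N\<ge>N0. norm (avg F N (\<lambda>g. \<phi> (\<gamma> (b g))) - (\<integral>z. \<phi> z \<partial>m)) < e" by blast
  qed
  then show ?thesis
    unfolding unif_distributed_def K_def[symmetric] using m \<gamma>K by blast
qed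

text \<open>The identity serves as test function, and its integral is 0 because rotation by some
  \<open>\<gamma> g \<noteq> 1\<close> preserves the measure.\<close>

lemma unif_distributed_imp_avg_tendsto_0:
  fixes F :: "nat \<Rightarrow> 'g::ab_group_add set"
  assumes \<gamma>: "\<gamma> \<in> pontryagin_dual - {\<lambda>_. 1}" and unif: "unif_distributed F u (closure (range \<gamma>))"
  shows "(\<lambda>N. avg F N u) \<longlonglongrightarrow> 0"
proof -
  have \<gamma>': "\<gamma> \<in> pontryagin_dual" using \<gamma> by simp
  define K where "K = closure (range \<gamma>)"
  note K = closure_range_character[OF \<gamma>', folded K_def]
  obtain m where m: "normalized_haar (*) K m"
    and lim: "\<And>\<phi>::complex \<Rightarrow> complex. continuous_on K \<phi> \<Longrightarrow> (\<lambda>N. avg F N (\<lambda>g. \<phi> (u g))) \<longlonglongrightarrow> (\<integral>z. \<phi> z \<partial>m)"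
    using unif unfolding unif_distributed_def K_def by blast
  then have sm: "sets m = sets (restrict_space borel K)"
    and inv: "\<And>k. k \<in> K \<Longrightarrow> distr m m ((*) k) = m" by (auto simp: normalized_haar_def)
  obtain g where g: "\<gamma> g \<noteq> 1" using \<gamma> by auto
  have gK: "\<gamma> g \<in> K" unfolding K_def by (rule subsetD[OF closure_subset rangeI])
  have "(\<integral>z. z \<partial>m) = (\<integral>z. z \<partial>distr m m ((*) (\<gamma> g)))" by (simp only: inv[OF gK])
  also have "\<dots> = (\<integral>z. \<gamma> g * z \<partial>m)"
  proof (rule integral_distr)
    show "(*) (\<gamma> g) \<in> measurable m m"
      using continuous_rotation_measurable[OF gK K(4)] measurable_cong_sets[OF sm sm] by blast
    show "(\<lambda>z. z) \<in> borel_measurable m" by (rule compact_continuous_measurable[OF sm continuous_on_id])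
  qed
  also have "\<dots> = \<gamma> g * (\<integral>z. z \<partial>m)" by (rule integral_mult_right_zero)
  finally have "(1 - \<gamma> g) * (\<integral>z. z \<partial>m) = 0" by (metis diff_self left_diff_distrib mult_1)
  then have "(\<integral>z. z \<partial>m) = 0" using g by simp
  then show ?thesis using lim[OF continuous_on_id] by simp
qed


section \<open>Characters of finite order\<close>

text \<open>Among the multiples of \<open>g\<close> two lie in the same coset of \<open>H\<close>,
  where \<open>\<gamma>\<close> is constant.\<close>

lemma finite_index_root_of_unity:
  assumes \<gamma>: "\<gamma> \<in> pontryagin_dual" and H: "add_subgroup H" "finite_index H" "vanishes_on \<gamma> H"
  shows "\<exists>n>0. \<gamma> g ^ n = 1"
proof -
  let ?p = "\<lambda>n::nat. \<Sum>i<n. g"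
  have \<gamma>p: "\<gamma> (?p n) = \<gamma> g ^ n" for n
    by (induction n) (simp_all add: dualD(1,3)[OF \<gamma>] mult.commute)
  let ?c = "\<lambda>n. (\<lambda>h. ?p n + h) ` H"
  have "range ?c \<subseteq> range (\<lambda>g. (\<lambda>h. g + h) ` H)" by auto
  then have "finite (range ?c)" using H(2) unfolding finite_index_def by (rule finite_subset)
  then have "\<not> inj ?c" using range_inj_infinite by blast
  then obtain m n where mn: "?c m = ?c n" "m < n"
    unfolding inj_def by (metis linorder_neqE_nat)
  have "0 \<in> H" using H(1) by (simp add: add_subgroup_def)
  then have "?p n \<in> ?c n" by (metis add.right_neutral imageI)
  then have "?p n \<in> ?c m" using mn(1) by simp
  then obtain h where h: "h \<in> H" "?p n = ?p m + h" by auto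
  have "\<gamma> g ^ n = \<gamma> (?p m + h)" unfolding \<gamma>p[symmetric] h(2) ..
  also have "\<dots> = \<gamma> g ^ m" using H(3) h(1) by (simp add: dualD(1)[OF \<gamma>] \<gamma>p vanishes_on_def)
  finally have "\<gamma> g ^ m * \<gamma> g ^ (n - m) = \<gamma> g ^ m * 1" using mn(2) by (simp flip: power_add)
  moreover have "\<gamma> g \<noteq> 0" using dualD(2)[OF \<gamma>, of g] by auto
  ultimately have "\<gamma> g ^ (n - m) = 1" by simp
  then show ?thesis using mn(2) by (intro exI[of _ "n - m"]) simp
qed

text \<open>A character is determined by its values on finitely many generators, and each of these
  values is a root of unity, of which there are countably many.\<close>

lemma countable_finite_order_characters:
  assumes "finitely_generated TYPE('g::ab_group_add)"
  shows "countable {\<gamma> \<in> pontryagin_dual. \<exists>H :: 'g set. add_subgroup H \<and> finite_index H \<and> vanishes_on \<gamma> H}"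
proof -
  obtain C :: "'g set" where C: "finite C" "group_closure C = UNIV"
    using assms by (auto simp: finitely_generated_def)
  let ?B = "{\<gamma> \<in> pontryagin_dual. \<exists>H :: 'g set. add_subgroup H \<and> finite_index H \<and> vanishes_on \<gamma> H}"
  let ?R = "{z::complex. \<exists>n>0. z ^ n = 1}"
  have "?R = (\<Union>n\<in>{0<..}. {z. z ^ n = 1})" by auto
  also have "countable \<dots>"
    by (rule countable_UN[OF countableI_type]) (rule countable_finite, rule finite_roots_unity, simp)
  finally have "countable (PiE C (\<lambda>_. ?R))" using C(1) by (intro countable_PiE)
  moreover have "(\<lambda>\<gamma>. restrict \<gamma> C) ` ?B \<subseteq> PiE C (\<lambda>_. ?R)"
    using finite_index_root_of_unity by (auto simp: PiE_iff)
  ultimately have "countable ((\<lambda>\<gamma>. restrict \<gamma> C) ` ?B)" by (rule countable_subset[rotated])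
  moreover have "inj_on (\<lambda>\<gamma>. restrict \<gamma> C) ?B"
  proof (rule inj_onI)
    fix \<gamma> \<psi> assume "\<gamma> \<in> ?B" "\<psi> \<in> ?B" and eq: "restrict \<gamma> C = restrict \<psi> C"
    then have \<gamma>: "\<gamma> \<in> pontryagin_dual" and \<psi>: "\<psi> \<in> pontryagin_dual" by auto
    show "\<gamma> = \<psi>"
    proof
      fix g
      have "g \<in> group_closure C" using C(2) by simp
      then show "\<gamma> g = \<psi> g"
      proof induction
        case (base s)
        then show ?case using fun_cong[OF eq, of s] dualD(3)[OF \<gamma>] dualD(3)[OF \<psi>] by (auto simp: restrict_def)
      next
        case (diff s t)
        then show ?case by (simp add: dualD(5)[OF \<gamma>] dualD(5)[OF \<psi>])
      qed
    qed
  qed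
  ultimately show ?thesis by (rule countable_image_inj_on)
qed

text \<open>A common form of the two settings, with \<open>B\<close> the characters at which the
  condition on \<open>a\<close> may fail. The trivial character is no atom because the invariant
  part has been subtracted; the others in \<open>B\<close> are no atoms by ergodicity of
  \<open>S\<close> on a subgroup where they are trivial.\<close>

lemma (in mp_pair) mean_convergence_recurrence:
  fixes a :: "'g \<Rightarrow> 'g"
  assumes inf: "infinite (UNIV :: 'g set)" and sing: "singular_spectrum M T" and B: "countable B"
    and van: "\<And>\<gamma> h. \<gamma> \<in> pontryagin_dual - B \<Longrightarrow> h \<noteq> 0 \<Longrightarrow> diff_avg_vanishes F a \<gamma> h"
    and erg: "\<And>\<gamma>. \<gamma> \<in> B \<inter> pontryagin_dual \<Longrightarrow> \<gamma> \<noteq> (\<lambda>_. 1) \<Longrightarrow> \<exists>H. ergodic_on M S H \<and> vanishes_on \<gamma> H"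
  shows "mean_convergence F M T S a \<and> recurrence_bound F M T S a"
proof -
  obtain m where m: "haar_dual (m :: ('g \<Rightarrow> complex) measure)"
    using sing by (auto simp: singular_spectrum_def haar_dual_def)
  have "mean_convergence F M T S a"
  proof (rule mean_convergenceI[OF inf sing])
    fix f and h :: 'g assume f: "f \<in> Linf M" and h: "h \<noteq> 0"
    define f' where "f' = (\<lambda>y. f y - inv_exp M S f y)"
    have f'L: "f' \<in> Linf M" unfolding f'_def by (intro Linf_diff f S.inv_exp_Linf)
    have "(\<lambda>N. avg F N (\<lambda>g. L2_inner M (koopman M S (a (g + h) - a g) f') f')) \<longlonglongrightarrow> 0"
    proof (rule S.correlation_avg_tendsto_0[OF m F f'L B])
      show "(\<lambda>N. avg F N (\<lambda>g. \<gamma> (a (g + h) - a g))) \<longlonglongrightarrow> 0" if "\<gamma> \<in> pontryagin_dual - B" for \<gamma>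
        using van[OF that h] by (simp add: diff_avg_vanishes_def)
      show "(\<lambda>N. mean_sq M (\<lambda>x. avg F N (\<lambda>g. cnj (\<gamma> g) * koopman M S g f' x))) \<longlonglongrightarrow> 0"
        if \<gamma>: "\<gamma> \<in> B \<inter> pontryagin_dual" for \<gamma>
      proof (cases "\<gamma> = (\<lambda>_. 1)")
        case True
        then show ?thesis using S.avg_koopman_orthogonal_part[OF F f] by (simp add: f'_def)
      next
        case False
        then obtain k where "\<gamma> k \<noteq> 1" by auto
        moreover obtain H where "ergodic_on M S H" "vanishes_on \<gamma> H" using erg[OF \<gamma> False] by blast
        ultimately show ?thesis using S.avg_twisted_koopman[OF F f'L] \<gamma> by blast
      qed
    qed
    then show "(\<lambda>N. avg F N (\<lambda>g. L2_inner M (koopman M S (a (g + h) - a g) (\<lambda>y. f y - inv_exp M S f y))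
        (\<lambda>y. f y - inv_exp M S f y))) \<longlonglongrightarrow> 0"
      by (simp only: f'_def)
  qed
  then show ?thesis using recurrence_boundI by blast
qed

theorem theorem1p13:
  fixes F :: "nat \<Rightarrow> 'g::{ab_group_add, countable} set"
    and M :: "'x measure"
    and T S :: "'g \<Rightarrow> 'x \<Rightarrow> 'x"
    and a :: "'g \<Rightarrow> 'g"
  assumes "infinite (UNIV :: 'g set)"
    and "Folner F"
    and "standard_prob_space M"
    and "mp_action M T"
    and "mp_action M S"
    and "singular_spectrum M T"
  shows
    "((\<forall>\<gamma>\<in>pontryagin_dual - {\<lambda>_. 1}. \<forall>h. h \<noteq> 0 \<longrightarrow> diff_avg_vanishes F a \<gamma> h) \<longleftrightarrow>
      (\<forall>\<gamma>\<in>pontryagin_dual. \<forall>h. h \<noteq> 0 \<longrightarrow>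
         unif_distributed F (\<lambda>g. \<gamma> (a (g + h) - a g)) (closure (range \<gamma>)))) \<and>
     ((\<forall>\<gamma>\<in>pontryagin_dual - {\<lambda>_. 1}. \<forall>h. h \<noteq> 0 \<longrightarrow> diff_avg_vanishes F a \<gamma> h) \<longrightarrow>
        mean_convergence F M T S a \<and> recurrence_bound F M T S a) \<and>
     (finitely_generated TYPE('g) \<and>
      (\<forall>\<gamma>\<in>pontryagin_dual.
         (\<forall>H. add_subgroup H \<and> finite_index H \<longrightarrow> \<not> vanishes_on \<gamma> H) \<longrightarrow>
         (\<forall>h. h \<noteq> 0 \<longrightarrow> diff_avg_vanishes F a \<gamma> h)) \<and>
      totally_ergodic M S \<longrightarrow>
        mean_convergence F M T S a \<and> recurrence_bound F M T S a)"
proof (intro conjI[of "_ \<longleftrightarrow> _"] conjI[of "_ \<longrightarrow> _"] iffI impI ballI allI)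
  have "prob_space M" using assms(3) by (simp add: standard_prob_space_def)
  then have pair: "mp_pair M T S F"
    using assms by (simp add: mp_pair_def mp_system_def mp_system_axioms_def mp_pair_axioms_def)
  show "unif_distributed F (\<lambda>g. \<gamma> (a (g + h) - a g)) (closure (range \<gamma>))"
    if *: "\<forall>\<gamma>\<in>pontryagin_dual - {\<lambda>_. 1}. \<forall>h. h \<noteq> 0 \<longrightarrow> diff_avg_vanishes F a \<gamma> h"
      and "\<gamma> \<in> pontryagin_dual" "h \<noteq> 0" for \<gamma> h
    using that by (intro unif_distributed_character[OF assms(2)]) (auto simp: diff_avg_vanishes_def)
  show "diff_avg_vanishes F a \<gamma> h"
    if "\<forall>\<gamma>\<in>pontryagin_dual. \<forall>h. h \<noteq> 0 \<longrightarrow>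
         unif_distributed F (\<lambda>g. \<gamma> (a (g + h) - a g)) (closure (range \<gamma>))"
      and "\<gamma> \<in> pontryagin_dual - {\<lambda>_. 1}" "h \<noteq> 0" for \<gamma> h
    unfolding diff_avg_vanishes_def using that by (intro unif_distributed_imp_avg_tendsto_0[of \<gamma>]) auto
  \<comment> \<open>With the trivial character as only exception, no ergodicity of \<open>S\<close>
    is called for.\<close>
  show "mean_convergence F M T S a \<and> recurrence_bound F M T S a"
    if "\<forall>\<gamma>\<in>pontryagin_dual - {\<lambda>_. 1}. \<forall>h. h \<noteq> 0 \<longrightarrow> diff_avg_vanishes F a \<gamma> h"
    using that by (intro mp_pair.mean_convergence_recurrence[OF pair assms(1,6), where B = "{\<lambda>_. 1}"]) auto
  \<comment> \<open>The exceptions are the characters that vanish on some finite index subgroup;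
    total ergodicity makes \<open>S\<close> ergodic on that very subgroup.\<close>
  show "mean_convergence F M T S a \<and> recurrence_bound F M T S a"
    if *: "finitely_generated TYPE('g) \<and>
      (\<forall>\<gamma>\<in>pontryagin_dual.
         (\<forall>H. add_subgroup H \<and> finite_index H \<longrightarrow> \<not> vanishes_on \<gamma> H) \<longrightarrow>
         (\<forall>h. h \<noteq> 0 \<longrightarrow> diff_avg_vanishes F a \<gamma> h)) \<and>
      totally_ergodic M S"
  proof (rule mp_pair.mean_convergence_recurrence[OF pair assms(1,6)])
    show "countable {\<gamma> \<in> pontryagin_dual. \<exists>H :: 'g set. add_subgroup H \<and> finite_index H \<and> vanishes_on \<gamma> H}"
      using * by (intro countable_finite_order_characters) blast
  qed (use * in \<open>auto simp: totally_ergodic_def\<close>)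
qed

end
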